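(* The map $$S:\mathcal{M}_{1,n}\longrightarrow X_n/G_n,\qquad (C,x_1,\dots,x_n)\longmapsto\bigl[(\operatorname{dist}_\Gamma(x_i,x_j))_{\{i,j\}\in\mathcal{T}}\bigr]$$ is a homeomorphism.
   Context: **The space $\mathcal{M}_{1,n}$.** An abstract tropical curve is a connected graph with a metric, where bounded edges have finite positive length and leaves have infinite length; $\mathcal{M}_{1,n}$ is the set of isomorphism classes (isometries respecting labels) of such curves $C$ with exactly $n$ leaves, labelled $x_1,\dots,x_n$, all vertices of valence at least $3$, and exactly one simple cycle. Curves with the same graph, or with a graph obtained from it by contracting bounded edges, form a combinatorial cone, with coordinates the lengths of the bounded edges; these are glued along faces representing the same curves, which gives the topology of $\mathcal{M}_{1,n}$. **$V_n$ and $G_n$.** Let $\mathcal{T}$ be the set of two-element subsets of $\{1,\dots,n+2\}$, and write $A=n+1$, $B=n+2$. Let $\Phi_n:\mathbb{R}^n\to\mathbb{R}^{\binom{n+2}{2}}$, $b\mapsto(\tilde b_i+\tilde b_j)_{\{i,j\}\in\mathcal{T}}$ with $\tilde b=(b,0,0)$, and let $s\in\mathbb{R}^{\binom{n+2}{2}}$ have $s_{\{m,A\}}=1$, $s_{\{m,B\}}=-1$ for $m\le n$ and all other entries $0$. Put $V_n=\mathbb{R}^{\binom{n+2}{2}}/(\Phi_n(\mathbb{R}^n)+\langle s\rangle)$. $G_n$ is the group generated by the maps (induced on $V_n$ by) $I$ and $M_p$, $p=1,\dots,n$: $I$ exchanges the coordinates $x_{\{m,A\}}$ and $x_{\{m,B\}}$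 for all $m\le n$ and fixes all others; $M_p$ maps $x$ to $y$ with $y_{\{p,A\}}=x_{\{p,A\}}-x_{\{A,B\}}$, $y_{\{p,B\}}=x_{\{p,B\}}+x_{\{A,B\}}$, $y_{\{p,k\}}=x_{\{p,k\}}+x_{\{k,A\}}+x_{\{p,B\}}+x_{\{A,B\}}-x_{\{k,B\}}-x_{\{p,A\}}$ for $k\le n$, $k\ne p$, and $y_{\{k,l\}}=x_{\{k,l\}}$ otherwise. **Distances and $X_n$.** For $C\in\mathcal{M}_{1,n}$ choose a point $a$ on its cycle, cut $C$ at $a$ and attach leaves $A=x_{n+1}$, $B=x_{n+2}$ at the two resulting ends (if $a$ is a vertex, decide for each non-cycle edge at it whether it is attached on the $A$- or $B$-side). For the resulting tree $\tilde C$ let $\operatorname{dist}_\Gamma(x_i,x_j)$ be the sum of the lengths of the bounded edges on the path from $x_i$ to $x_j$. The class $\operatorname{dist}_n(C)=[(\operatorname{dist}_\Gamma(x_i,x_j))_{\{i,j\}\in\mathcal{T}}]\in V_n/G_n$ is well defined. With $\Psi_n:V_n\to V_n/G_n$ the quotient map, $X_n=\Psi_n^{-1}(\operatorname{dist}_n(\mathcal{M}_{1,n}))$, a polyhedral complex whose polyhedra are the cones induced by the combinatorial cones of $\mathcal{M}_{1,n}$. $G_n$ acts on $X_n$, and $X_n/G_n$ carries the quotient topology. *)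

theory Defs
  imports "HOL-Analysis.Analysis" "HOL-Algebra.Group_Action" "HOL-Algebra.Bij" "HOL-Algebra.Generated_Groups"
begin

section \<open>Final topologies\<close>

text \<open>The finest topology on \<open>Y\<close> for which all maps \<open>f i\<close> out of the spaces \<open>X i\<close>
  (\<open>i \<in> I\<close>) are continuous: the topology obtained by gluing the \<open>X i\<close> along their common
  images in \<open>Y\<close>.\<close>

definition final_topology ::
    "'b set \<Rightarrow> 'i set \<Rightarrow> ('i \<Rightarrow> 'a topology) \<Rightarrow> ('i \<Rightarrow> 'a \<Rightarrow> 'b) \<Rightarrow> 'b topology" where
  "final_topology Y I X f =
     topology (\<lambda>U. U \<subseteq> Y \<and> (\<forall>i\<in>I. openin (X i) {x \<in> topspace (X i). f i x \<in> U}))"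

lemma openin_final_topology:
  "openin (final_topology Y I X f) U \<longleftrightarrow>
     U \<subseteq> Y \<and> (\<forall>i\<in>I. openin (X i) {x \<in> topspace (X i). f i x \<in> U})"
proof -
  let ?P = "\<lambda>U. U \<subseteq> Y \<and> (\<forall>i\<in>I. openin (X i) {x \<in> topspace (X i). f i x \<in> U})"
  have "istopology ?P"
    unfolding istopology_def
  proof (intro conjI allI impI)
    fix S T assume S: "?P S" and T: "?P T"
    show "S \<inter> T \<subseteq> Y" using S by blast
    have eq: "{x \<in> topspace (X i). f i x \<in> S \<inter> T} =
        {x \<in> topspace (X i). f i x \<in> S} \<inter> {x \<in> topspace (X i). f i x \<in> T}" for i
      by blast
    show "\<forall>i\<in>I. openin (X i) {x \<in> topspace (X i). f i x \<in> S \<inter> T}"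
      unfolding eq using S T by auto
  next
    fix K assume K: "\<forall>S\<in>K. ?P S"
    show "\<Union>K \<subseteq> Y" using K by blast
    have eq: "{x \<in> topspace (X i). f i x \<in> \<Union>K} =
        (\<Union>S\<in>K. {x \<in> topspace (X i). f i x \<in> S})" for i
      by blast
    show "\<forall>i\<in>I. openin (X i) {x \<in> topspace (X i). f i x \<in> \<Union>K}"
      unfolding eq using K by auto
  qed
  then show ?thesis by (simp add: final_topology_def)
qed

definition quotient_topology :: "'a topology \<Rightarrow> ('a \<Rightarrow> 'b) \<Rightarrow> 'b topology" where
  "quotient_topology X f = final_topology (f ` topspace X) {()} (\<lambda>_. X) (\<lambda>_. f)"

lemma quotient_map_quotient_topology: "quotient_map X (quotient_topology X f) f"
proof -
  have o: "openin (quotient_topology X f) U \<longleftrightarrow>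
      U \<subseteq> f ` topspace X \<and> openin X {x \<in> topspace X. f x \<in> U}" for U
    by (simp add: quotient_topology_def openin_final_topology)
  have "{x \<in> topspace X. f x \<in> f ` topspace X} = topspace X" by blast
  then have "openin (quotient_topology X f) (f ` topspace X)" by (simp add: o)
  then have "topspace (quotient_topology X f) = f ` topspace X"
    by (metis o openin_subset openin_topspace subset_antisym)
  then show ?thesis by (simp add: quotient_map_def o)
qed

section \<open>Abstract tropical curves\<close>

text \<open>A finite metric graph, given by its vertices, its bounded edges with their lengths, and
  its leaves, which are labelled \<open>1, \<dots>, N\<close> and have a single end vertex. \<open>ends C e\<close> is the
  set of end vertices of \<open>e\<close>, a singleton if \<open>e\<close> is a loop; multiple edges are allowed. The values
  of \<open>ends\<close> and \<open>len\<close> outside \<open>bedges\<close>, and of \<open>leaf\<close> outside \<open>{1..N}\<close>, are irrelevant.\<close>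

record curve =
  verts :: "nat set"
  bedges :: "nat set"
  ends :: "nat \<Rightarrow> nat set"
  len :: "nat \<Rightarrow> real"
  leaf :: "nat \<Rightarrow> nat"

definition joined :: "curve \<Rightarrow> nat set \<Rightarrow> (nat \<times> nat) set" where
  "joined C F = {(u, v). \<exists>e\<in>F. ends C e = {u, v}}"

definition connected_graph :: "curve \<Rightarrow> bool" where
  "connected_graph C \<longleftrightarrow> verts C \<noteq> {} \<and>
     (\<forall>u\<in>verts C. \<forall>v\<in>verts C. (u, v) \<in> (joined C (bedges C))\<^sup>*)"

definition abstract_curve :: "nat \<Rightarrow> curve \<Rightarrow> bool" where
  "abstract_curve N C \<longleftrightarrow>
     finite (verts C) \<and> finite (bedges C) \<and>
     (\<forall>e\<in>bedges C. ends C e \<subseteq> verts C \<and> card (ends C e) \<in> {1, 2} \<and> 0 < len C e) \<and>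
     leaf C ` {1..N} \<subseteq> verts C \<and> connected_graph C"

definition valence :: "nat \<Rightarrow> curve \<Rightarrow> nat \<Rightarrow> nat" where
  "valence N C v =
     card {e \<in> bedges C. v \<in> ends C e} + card {e \<in> bedges C. ends C e = {v}} +
     card {i \<in> {1..N}. leaf C i = v}"

text \<open>\<open>Z\<close> is the edge set of a simple cycle; loops are cycles of length 1 and pairs of parallel
  edges cycles of length 2. Cycles are identified with their edge sets, so that the choice of
  starting point and direction is immaterial.\<close>

definition simple_cycle :: "curve \<Rightarrow> nat set \<Rightarrow> bool" where
  "simple_cycle C Z \<longleftrightarrow>
     (\<exists>vs es. es \<noteq> [] \<and> length vs = length es \<and> distinct vs \<and> distinct es \<and>
        set vs \<subseteq> verts C \<and> set es \<subseteq> bedges C \<and> Z = set es \<and>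
        (\<forall>i<length es. ends C (es ! i) = {vs ! i, vs ! (Suc i mod length es)}))"

definition on_cycle :: "curve \<Rightarrow> nat \<Rightarrow> bool" where
  "on_cycle C v \<longleftrightarrow> (\<exists>Z. simple_cycle C Z \<and> v \<in> \<Union>(ends C ` Z))"

definition elliptic_curves :: "nat \<Rightarrow> curve set" where
  "elliptic_curves n =
     {C. abstract_curve n C \<and> (\<forall>v\<in>verts C. 3 \<le> valence n C v) \<and> (\<exists>!Z. simple_cycle C Z)}"

text \<open>As there are no vertices of valence 2, the isometries of curves respecting the labels are
  given by the length-preserving isomorphisms of the underlying graphs.\<close>

definition curve_iso :: "nat \<Rightarrow> curve \<Rightarrow> curve \<Rightarrow> bool" where
  "curve_iso n C D \<longleftrightarrow>
     (\<exists>f g. bij_betw f (verts C) (verts D) \<and> bij_betw g (bedges C) (bedges D) \<and>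
        (\<forall>e\<in>bedges C. ends D (g e) = f ` ends C e \<and> len D (g e) = len C e) \<and>
        (\<forall>i\<in>{1..n}. leaf D i = f (leaf C i)))"

definition iso_rel :: "nat \<Rightarrow> (curve \<times> curve) set" where
  "iso_rel n = {(C, D). C \<in> elliptic_curves n \<and> D \<in> elliptic_curves n \<and> curve_iso n C D}"

definition M1 :: "nat \<Rightarrow> curve set set" where
  "M1 n = elliptic_curves n // iso_rel n"

section \<open>The topology of \<open>M\<^sub>1\<^sub>,\<^sub>n\<close>\<close>

text \<open>The curve obtained from the graph of \<open>C\<close> and edge lengths \<open>l \<ge> 0\<close> by contracting the edges
  of length \<open>0\<close>. Vertices joined by such edges are represented by the least one among them.\<close>

definition contract :: "curve \<Rightarrow> (nat \<Rightarrow> real) \<Rightarrow> curve" where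
  "contract C l =
     (let rep = (\<lambda>v. Min {u \<in> verts C. (u, v) \<in> (joined C {e \<in> bedges C. l e = 0})\<^sup>*})
      in \<lparr>verts = rep ` verts C, bedges = {e \<in> bedges C. l e \<noteq> 0},
          ends = (\<lambda>e. rep ` ends C e), len = l, leaf = (\<lambda>i. rep (leaf C i))\<rparr>)"

text \<open>The combinatorial cone of the graph underlying \<open>C\<close> (the lengths in \<open>C\<close> play no role). The
  faces on which the whole cycle is contracted do not belong to it.\<close>

definition comb_cone :: "nat \<Rightarrow> curve \<Rightarrow> (nat \<Rightarrow> real) set" where
  "comb_cone n C =
     {l \<in> bedges C \<rightarrow>\<^sub>E {0..}. contract C l \<in> elliptic_curves n}"

definition M1_topology :: "nat \<Rightarrow> curve set topology" where
  "M1_topology n =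
     final_topology (M1 n) (elliptic_curves n)
       (\<lambda>C. subtopology (powertop_real (bedges C)) (comb_cone n C))
       (\<lambda>C l. iso_rel n `` {contract C l})"

section \<open>The space \<open>V\<^sub>n\<close> and the group \<open>G\<^sub>n\<close>\<close>

type_synonym vec = "nat set \<Rightarrow> real"

definition pairs :: "nat \<Rightarrow> nat set set" where
  "pairs n = {t. t \<subseteq> {1..n+2} \<and> card t = 2}"

definition Rpairs :: "nat \<Rightarrow> vec set" where
  "Rpairs n = pairs n \<rightarrow>\<^sub>E UNIV"

definition Phi :: "nat \<Rightarrow> (nat \<Rightarrow> real) \<Rightarrow> vec" where
  "Phi n b = (\<lambda>t\<in>pairs n. \<Sum>i\<in>t. if i \<le> n then b i else 0)"

definition svec :: "nat \<Rightarrow> vec" where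
  "svec n = (\<lambda>t\<in>pairs n. if \<exists>m\<in>{1..n}. t = {m, n+1} then 1
                          else if \<exists>m\<in>{1..n}. t = {m, n+2} then -1 else 0)"

text \<open>The class of a vector in the quotient vector space \<open>Vn n\<close>, whose elements are cosets.\<close>

definition Vclass :: "nat \<Rightarrow> vec \<Rightarrow> vec set" where
  "Vclass n x = {y \<in> Rpairs n. \<exists>b r. \<forall>t\<in>pairs n. y t = x t + Phi n b t + r * svec n t}"

definition Vn :: "nat \<Rightarrow> vec set set" where
  "Vn n = Vclass n ` Rpairs n"

definition Vn_topology :: "nat \<Rightarrow> vec set topology" where
  "Vn_topology n = quotient_topology (powertop_real (pairs n)) (Vclass n)"

definition Imap :: "nat \<Rightarrow> vec \<Rightarrow> vec" where
  "Imap n x = (\<lambda>t\<in>pairs n. x (id(n+1 := n+2, n+2 := n+1) ` t))"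

definition Mmap :: "nat \<Rightarrow> nat \<Rightarrow> vec \<Rightarrow> vec" where
  "Mmap n p x = (\<lambda>t\<in>pairs n. let A = n+1; B = n+2 in
     if t = {p, A} then x {p, A} - x {A, B}
     else if t = {p, B} then x {p, B} + x {A, B}
     else if p \<in> t then
       (let k = the_elem (t - {p})
        in x {p, k} + x {k, A} + x {p, B} + x {A, B} - x {k, B} - x {p, A})
     else x t)"

text \<open>A linear automorphism of the space of vectors that preserves the subspace divided out
  induces on cosets the map taking a coset to its image. \<open>BijGroup S\<close> is the group of all
  permutations of \<open>S\<close>.\<close>

definition Gn :: "nat \<Rightarrow> (vec set \<Rightarrow> vec set) monoid" where
  "Gn n = BijGroup (Vn n)
     \<lparr>carrier := generate (BijGroup (Vn n))
        (insert (\<lambda>K\<in>Vn n. Imap n ` K) ((\<lambda>p. \<lambda>K\<in>Vn n. Mmap n p ` K) ` {1..n}))\<rparr>"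

text \<open>The quotient map to \<open>Vn n\<close> modulo \<open>Gn n\<close>, whose elements are the orbits.\<close>

definition Psi :: "nat \<Rightarrow> vec set \<Rightarrow> vec set set" where
  "Psi n K = orbit (Gn n) (\<lambda>g. g) K"

section \<open>Cutting curves and distances\<close>

text \<open>\<open>D\<close> is obtained from \<open>C\<close> by declaring an interior point of a bounded edge to be a
  (two-valent) vertex \<open>w\<close>.\<close>

definition subdivides :: "nat \<Rightarrow> curve \<Rightarrow> nat \<Rightarrow> curve \<Rightarrow> bool" where
  "subdivides n C w D \<longleftrightarrow>
     w \<notin> verts C \<and> verts D = insert w (verts C) \<and>
     (\<exists>e\<in>bedges C. \<exists>e1 e2 u v.
        ends C e = {u, v} \<and> e1 \<noteq> e2 \<and> e1 \<notin> bedges C - {e} \<and> e2 \<notin> bedges C - {e} \<and>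
        bedges D = {e1, e2} \<union> (bedges C - {e}) \<and>
        ends D e1 = {u, w} \<and> ends D e2 = {w, v} \<and>
        0 < len D e1 \<and> 0 < len D e2 \<and> len D e1 + len D e2 = len C e \<and>
        (\<forall>e'\<in>bedges C - {e}. ends D e' = ends C e' \<and> len D e' = len C e')) \<and>
     (\<forall>i\<in>{1..n}. leaf D i = leaf C i)"

text \<open>\<open>D\<close> is obtained from \<open>C\<close> by splitting the vertex \<open>a\<close> into two vertices, distributing the
  edges and leaves at \<open>a\<close> among them, and attaching the leaf \<open>n+1\<close> to one and the leaf \<open>n+2\<close>
  to the other; \<open>q\<close> is the map that identifies the two vertices again.\<close>

definition splits :: "nat \<Rightarrow> curve \<Rightarrow> nat \<Rightarrow> curve \<Rightarrow> bool" where
  "splits n C a D \<longleftrightarrow>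
     bedges D = bedges C \<and> (\<forall>e\<in>bedges C. len D e = len C e) \<and>
     leaf D (n+1) \<in> verts D \<and> leaf D (n+2) \<in> verts D \<and> leaf D (n+1) \<noteq> leaf D (n+2) \<and>
     (\<exists>q. q ` verts D = verts C \<and>
        q (leaf D (n+1)) = a \<and> q (leaf D (n+2)) = a \<and> inj_on q (verts D - {leaf D (n+1)}) \<and>
        (\<forall>e\<in>bedges C. ends D e \<subseteq> verts D \<and> ends C e = q ` ends D e) \<and>
        (\<forall>i\<in>{1..n}. leaf D i \<in> verts D \<and> leaf C i = q (leaf D i)))"

definition tropical_tree :: "nat \<Rightarrow> curve \<Rightarrow> bool" where
  "tropical_tree N D \<longleftrightarrow> abstract_curve N D \<and> (\<nexists>Z. simple_cycle D Z)"

text \<open>\<open>D\<close> is a tree obtained by cutting \<open>C\<close> at a point \<open>a\<close> of its cycle. Requiring \<open>D\<close> to be a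
  tree means that the two germs of the cycle at \<open>a\<close> go to different sides of the cut, while
  the side of every other edge and leaf at \<open>a\<close> is arbitrary.\<close>

definition cut_tree :: "nat \<Rightarrow> curve \<Rightarrow> curve \<Rightarrow> bool" where
  "cut_tree n C D \<longleftrightarrow>
     (\<exists>C' a. (C' = C \<or> subdivides n C a C') \<and> on_cycle C' a \<and> splits n C' a D) \<and>
     tropical_tree (n+2) D"

text \<open>The length of the simple path from \<open>u\<close> to \<open>v\<close>, which is unique in a tree.\<close>

definition path_dist :: "curve \<Rightarrow> nat \<Rightarrow> nat \<Rightarrow> real" where
  "path_dist D u v = (THE d. \<exists>vs es.
     length vs = Suc (length es) \<and> distinct vs \<and> set vs \<subseteq> verts D \<and> set es \<subseteq> bedges D \<and>
     hd vs = u \<and> last vs = v \<and>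
     (\<forall>i<length es. ends D (es ! i) = {vs ! i, vs ! Suc i}) \<and>
     d = (\<Sum>e\<leftarrow>es. len D e))"

text \<open>The distance is symmetric, so the minimum and maximum just serve to name the two elements
  of \<open>t\<close>.\<close>

definition dist_vec :: "nat \<Rightarrow> curve \<Rightarrow> vec" where
  "dist_vec n D = (\<lambda>t\<in>pairs n. path_dist D (leaf D (Min t)) (leaf D (Max t)))"

text \<open>The class in \<open>Vn n\<close> modulo \<open>Gn n\<close>; it depends neither on the representative \<open>C\<close> of the
  isomorphism class \<open>c\<close> nor on the cut.\<close>

definition dist_class :: "nat \<Rightarrow> curve set \<Rightarrow> vec set set" where
  "dist_class n c =
     (THE w. \<exists>C\<in>c. \<exists>D. cut_tree n C D \<and> w = Psi n (Vclass n (dist_vec n D)))"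

section \<open>The space \<open>X\<^sub>n\<close> and its quotient\<close>

definition Xn :: "nat \<Rightarrow> vec set set" where
  "Xn n = {K \<in> Vn n. Psi n K \<in> dist_class n ` M1 n}"

definition XG_topology :: "nat \<Rightarrow> vec set set topology" where
  "XG_topology n = quotient_topology (subtopology (Vn_topology n) (Xn n)) (Psi n)"

end

theory Submission
  imports Defs
begin

text \<open>Cutting a curve in its cycle turns it into a tree, and the distance of two leaves of a tree is
  the sum of the lengths of the edges that separate them. So the distance vector depends linearly on
  the edge lengths as soon as the side of each edge is known, that is, the set of leaves beyond it
  as seen from the new leaf \<open>A\<close>.

  The proof uses explicit invariants. Let \<open>L\<close> be the length of the cycle. For two leaves, let
  \<open>a\<close> be the length of the arc between the points where they leave the cycle, and \<open>g\<close> the length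
  that their paths from the cycle have in common. Then \<open>L\<close> and the numbers \<open>a (L - a) - 2 L g\<close> are
  polynomials in the coordinates that are invariant under \<open>G\<^sub>n\<close>. They do not depend on the cut
  (\<open>cut_system_invs\<close>), and on the vectors that come from curves they separate the orbits
  (\<open>Psi_eq_if_invs_eq\<close>): as one of \<open>a\<close> and \<open>g\<close> is zero, they determine \<open>g\<close> and, up to the exchange
  of the two arcs, \<open>a\<close>. Points on a circle are determined by their distances up to an isometry
  (\<open>circle_rigid\<close>), and rotations, reflections and windings around the cycle are what is divided
  out. This makes the distance class well defined (\<open>dist_class_eq\<close>).

  For injectivity (\<open>dist_class_injective\<close>), curves with the same class are cut in such a way that the
  positions on the cycle are the same. Then the paths from \<open>A\<close> to any two leaves have the same
  overlap in both curves. The sides form a laminar family whose members are the balls of the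
  ultrametric given by the overlaps, so the overlaps determine the family and the edge lengths.
  As all vertices have valence at least 3, different edges have different sides, and the family of
  sides determines the graph (\<open>same_sides_iso\<close>). Surjectivity holds by the definition of \<open>X\<^sub>n\<close>.

  The map is continuous, since it is induced by linear maps on the combinatorial cones
  (\<open>dist_class_chart\<close>). It is closed, since a bound on the invariants and a lower bound on \<open>L\<close> confine
  the edge lengths to a compact set (\<open>length_bounds\<close>), while there are only finitely many families of
  sides; thus the invariants of the curves in a closed set form a set that is closed where
  \<open>L > 0\<close> (\<open>closed_curve_invs\<close>). A continuous closed bijection is a homeomorphism.\<close>

section \<open>Cuts of graphs\<close>

text \<open>A cut is a colouring of the vertices with two colours. Connectedness, bridges, cycles
  and distances in trees are all expressed through the edges that a cut crosses, since cuts are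
  carried along more easily than paths when a curve is glued, subdivided or contracted.\<close>

definition crossing :: "curve \<Rightarrow> (nat \<Rightarrow> bool) \<Rightarrow> nat set" where
  "crossing C \<phi> = {e \<in> bedges C. \<exists>x\<in>ends C e. \<exists>y\<in>ends C e. \<phi> x \<noteq> \<phi> y}"

definition fin_graph :: "curve \<Rightarrow> bool" where
  "fin_graph C \<longleftrightarrow> finite (verts C) \<and> finite (bedges C) \<and>
     (\<forall>e\<in>bedges C. \<exists>u\<in>verts C. \<exists>v\<in>verts C. ends C e = {u, v})"

definition cut_conn :: "curve \<Rightarrow> bool" where
  "cut_conn C \<longleftrightarrow> (\<forall>\<phi>. crossing C \<phi> = {} \<longrightarrow> (\<forall>u\<in>verts C. \<forall>v\<in>verts C. \<phi> u = \<phi> v))"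

definition delete_edge :: "curve \<Rightarrow> nat \<Rightarrow> curve" where
  "delete_edge C e = C\<lparr>bedges := bedges C - {e}\<rparr>"

lemma delete_edge_simps [simp]:
  "verts (delete_edge C e) = verts C" "bedges (delete_edge C e) = bedges C - {e}"
  "ends (delete_edge C e) = ends C" "len (delete_edge C e) = len C" "leaf (delete_edge C e) = leaf C"
  by (simp_all add: delete_edge_def)

lemma crossing_delete_edge: "crossing (delete_edge C e) \<phi> = crossing C \<phi> - {e}"
  by (auto simp: crossing_def)

lemma fin_graph_delete_edge: "fin_graph C \<Longrightarrow> fin_graph (delete_edge C e)"
  by (auto simp: fin_graph_def)

lemma in_crossing_iff:
  "e \<in> bedges C \<Longrightarrow> ends C e = {u, v} \<Longrightarrow> e \<in> crossing C \<phi> \<longleftrightarrow> \<phi> u \<noteq> \<phi> v"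
  by (auto simp: crossing_def)

lemma crossing_subset: "crossing C \<phi> \<subseteq> bedges C"
  by (auto simp: crossing_def)

lemma not_crossingD:
  "e \<notin> crossing C \<phi> \<Longrightarrow> e \<in> bedges C \<Longrightarrow> x \<in> ends C e \<Longrightarrow> y \<in> ends C e \<Longrightarrow> \<phi> x = \<phi> y"
  unfolding crossing_def by blast

lemma crossing_neq [simp]: "crossing C (\<lambda>x. \<phi> x \<noteq> b) = crossing C \<phi>"
  by (auto simp: crossing_def)

lemma fin_graph_endsE:
  assumes "fin_graph C" "e \<in> bedges C"
  obtains u v where "u \<in> verts C" "v \<in> verts C" "ends C e = {u, v}"
  using assms by (auto simp: fin_graph_def)

lemma fin_graph_ends: "fin_graph C \<Longrightarrow> e \<in> bedges C \<Longrightarrow> x \<in> ends C e \<Longrightarrow> x \<in> verts C"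
  by (auto simp: fin_graph_def)

lemma crossing_xor:
  assumes "fin_graph C"
  shows "crossing C (\<lambda>x. \<phi> x \<noteq> \<psi> x) =
    (crossing C \<phi> - crossing C \<psi>) \<union> (crossing C \<psi> - crossing C \<phi>)"
proof -
  have "e \<in> crossing C (\<lambda>x. \<phi> x \<noteq> \<psi> x) \<longleftrightarrow>
      e \<in> (crossing C \<phi> - crossing C \<psi>) \<union> (crossing C \<psi> - crossing C \<phi>)" if e: "e \<in> bedges C" for e
  proof -
    obtain u v where "ends C e = {u, v}" using assms e by (rule fin_graph_endsE)
    then show ?thesis by (simp add: in_crossing_iff[OF e]) blast
  qed
  then show ?thesis using crossing_subset by blast
qed

lemma crossing_cong:
  assumes "fin_graph C" "\<And>x. x \<in> verts C \<Longrightarrow> \<phi> x = \<psi> x"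
  shows "crossing C \<phi> = crossing C \<psi>"
proof -
  have "e \<in> crossing C \<phi> \<longleftrightarrow> e \<in> crossing C \<psi>" if e: "e \<in> bedges C" for e
  proof -
    obtain u v where "ends C e = {u, v}" "u \<in> verts C" "v \<in> verts C"
      using assms(1) e by (rule fin_graph_endsE)
    then show ?thesis using assms(2) by (simp add: in_crossing_iff[OF e])
  qed
  then show ?thesis using crossing_subset by blast
qed

lemma cut_conn_const:
  "cut_conn C \<Longrightarrow> crossing C \<phi> = {} \<Longrightarrow> u \<in> verts C \<Longrightarrow> v \<in> verts C \<Longrightarrow> \<phi> u = \<phi> v"
  by (auto simp: cut_conn_def)

text \<open>The vertices on which two cuts with the same edges disagree form a cut that crosses
  no edge.\<close>

lemma cut_unique:
  assumes "fin_graph C" "cut_conn C" "crossing C \<phi> = crossing C \<psi>" "u \<in> verts C" "v \<in> verts C"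
  shows "(\<phi> u \<noteq> \<phi> v) \<longleftrightarrow> (\<psi> u \<noteq> \<psi> v)"
proof -
  have "crossing C (\<lambda>x. \<phi> x \<noteq> \<psi> x) = {}"
    using assms(3) crossing_xor[OF assms(1)] by auto
  from cut_conn_const[OF assms(2) this assms(4,5)] show ?thesis by blast
qed

text \<open>The ends of each of the two edges lie on one side of the other cut. So no edge leaves
  the set of vertices that lie on the opposite side of both cuts.\<close>

lemma four_values:
  assumes conn: "cut_conn C"
    and \<phi>: "crossing C \<phi> = {e}" and \<psi>: "crossing C \<psi> = {f}" and "e \<noteq> f"
    and v: "x \<in> verts C" "\<phi> x" "\<psi> x" "y \<in> verts C" "\<phi> y" "\<not> \<psi> y"
      "z \<in> verts C" "\<not> \<phi> z" "\<psi> z" "w \<in> verts C" "\<not> \<phi> w" "\<not> \<psi> w"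
  shows False
proof -
  have e: "e \<in> bedges C" "f \<in> bedges C" using \<phi> \<psi> crossing_subset by blast+
  obtain b where b: "\<And>u. u \<in> ends C e \<Longrightarrow> \<psi> u = b"
    using not_crossingD[of e C \<psi>] e \<psi> \<open>e \<noteq> f\<close> by (metis singletonD)
  obtain c where c: "\<And>u. u \<in> ends C f \<Longrightarrow> \<phi> u = c"
    using not_crossingD[of f C \<phi>] e \<phi> \<open>e \<noteq> f\<close> by (metis singletonD)
  have "crossing C (\<lambda>u. \<psi> u \<noteq> b \<and> \<phi> u \<noteq> c) = {}"
  proof (rule equals0I)
    fix g assume g: "g \<in> crossing C (\<lambda>u. \<psi> u \<noteq> b \<and> \<phi> u \<noteq> c)"
    then have gb: "g \<in> bedges C" using crossing_subset by blast
    from g obtain u v where uv: "u \<in> ends C g" "v \<in> ends C g"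
      "(\<psi> u \<noteq> b \<and> \<phi> u \<noteq> c) \<noteq> (\<psi> v \<noteq> b \<and> \<phi> v \<noteq> c)"
      unfolding crossing_def mem_Collect_eq by (elim conjE bexE)
    consider "g = e" | "g = f" | "g \<noteq> e" "g \<noteq> f" by blast
    then show False
    proof cases
      case 3
      then have "\<phi> u = \<phi> v" "\<psi> u = \<psi> v" using not_crossingD gb uv \<phi> \<psi> by (metis singletonD)+
      then show False using uv by simp
    qed (use b c uv in auto)
  qed
  note same = cut_conn_const[OF conn this]
  show False using same[OF v(1,4)] same[OF v(1,7)] same[OF v(1,10)] v(2,3,5,6,8,9,11,12)
    by (cases b; cases c) simp_all
qed

section \<open>Paths, cycles and cuts\<close>

definition edge_path :: "curve \<Rightarrow> nat set \<Rightarrow> nat list \<Rightarrow> nat list \<Rightarrow> bool" where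
  "edge_path C F vs es \<longleftrightarrow> length vs = Suc (length es) \<and> distinct vs \<and> set es \<subseteq> F \<and>
     (\<forall>i<length es. ends C (es ! i) = {vs ! i, vs ! Suc i})"

text \<open>The colour changes exactly at the crossing edges.\<close>

lemma walk_parity:
  assumes "\<And>i. i < k \<Longrightarrow> es i \<in> bedges C \<and> ends C (es i) = {w i, w (Suc i)}"
  shows "\<phi> (w 0) \<noteq> \<phi> (w k) \<longleftrightarrow> odd (card {i. i < k \<and> es i \<in> crossing C \<phi>})"
  using assms
proof (induction k)
  case (Suc k)
  have "es k \<in> crossing C \<phi> \<longleftrightarrow> \<phi> (w k) \<noteq> \<phi> (w (Suc k))"
    using in_crossing_iff[of "es k" C "w k" "w (Suc k)"] Suc.prems[of k] by simp
  moreover have "{i. i < Suc k \<and> es i \<in> crossing C \<phi>} =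
      (if es k \<in> crossing C \<phi> then insert k {i. i < k \<and> es i \<in> crossing C \<phi>}
       else {i. i < k \<and> es i \<in> crossing C \<phi>})"
    by (auto simp: less_Suc_eq)
  moreover have "\<phi> (w 0) \<noteq> \<phi> (w k) \<longleftrightarrow> odd (card {i. i < k \<and> es i \<in> crossing C \<phi>})"
    using Suc by simp
  ultimately show ?case by auto
qed simp

lemma distinct_card_hits:
  assumes "distinct es"
  shows "card {i. i < length es \<and> es ! i \<in> X} = card (set es \<inter> X)"
proof -
  have "set es \<inter> X = (!) es ` {i. i < length es \<and> es ! i \<in> X}"
    by (auto simp: in_set_conv_nth)
  moreover have "inj_on ((!) es) {i. i < length es \<and> es ! i \<in> X}"
    using assms by (auto simp: inj_on_def nth_eq_iff_index_eq)
  ultimately show ?thesis by (simp add: card_image)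
qed

lemma edge_path_distinct_edges:
  assumes "edge_path C F vs es"
  shows "distinct es"
proof -
  have d: "vs ! i \<noteq> vs ! j" if "i < j" "j \<le> length es" for i j
    using assms that by (auto simp: edge_path_def nth_eq_iff_index_eq)
  have E: "ends C (es ! i) = {vs ! i, vs ! Suc i}" if "i < length es" for i
    using assms that by (simp add: edge_path_def)
  have "es ! i \<noteq> es ! j" if "i < j" "j < length es" for i j
  proof
    assume "es ! i = es ! j"
    then have "{vs ! i, vs ! Suc i} = {vs ! j, vs ! Suc j}" using E[of i] E[of j] that by simp
    then show False using d[of i j] d[of i "Suc j"] that by (simp add: doubleton_eq_iff)
  qed
  then show ?thesis by (metis distinct_conv_nth nat_neq_iff)
qed

lemma edge_path_parity:
  assumes "edge_path C F vs es" "F \<subseteq> bedges C"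
  shows "\<phi> (hd vs) \<noteq> \<phi> (last vs) \<longleftrightarrow> odd (card (set es \<inter> crossing C \<phi>))"
proof -
  have vs: "vs \<noteq> []" "length vs = Suc (length es)" using assms by (auto simp: edge_path_def)
  have "\<phi> (vs ! 0) \<noteq> \<phi> (vs ! length es) \<longleftrightarrow>
      odd (card {i. i < length es \<and> es ! i \<in> crossing C \<phi>})"
    by (rule walk_parity) (use assms nth_mem in \<open>fastforce simp: edge_path_def\<close>)
  then show ?thesis
    using vs distinct_card_hits[OF edge_path_distinct_edges[OF assms(1)]]
    by (simp add: hd_conv_nth last_conv_nth)
qed

lemma simple_cycle_even:
  assumes "simple_cycle C Z"
  shows "even (card (Z \<inter> crossing C \<phi>))"
proof -
  obtain vs es where es: "es \<noteq> []" "length vs = length es" "distinct es" "set es \<subseteq> bedges C"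
      "Z = set es" "\<And>i. i < length es \<Longrightarrow> ends C (es ! i) = {vs ! i, vs ! (Suc i mod length es)}"
    using assms by (auto simp: simple_cycle_def)
  define w where "w i = vs ! (i mod length es)" for i
  have "\<phi> (w 0) \<noteq> \<phi> (w (length es)) \<longleftrightarrow>
      odd (card {i. i < length es \<and> es ! i \<in> crossing C \<phi>})"
    by (rule walk_parity) (use es nth_mem in \<open>force simp: w_def\<close>)
  moreover have "w 0 = w (length es)" by (simp add: w_def)
  ultimately show ?thesis using distinct_card_hits[OF es(3)] es(5) by simp
qed

lemma edge_path_exists:
  assumes "(u, v) \<in> (joined C F)\<^sup>*"
  shows "\<exists>vs es. edge_path C F vs es \<and> hd vs = u \<and> last vs = v"
  using assms
proof (induction rule: converse_rtrancl_induct)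
  case base
  have "edge_path C F [v] []" by (simp add: edge_path_def)
  then show ?case by force
next
  case (step u u')
  from step(1) obtain e where e: "e \<in> F" "ends C e = {u, u'}" by (auto simp: joined_def)
  from step(3) obtain vs es where p: "edge_path C F vs es" "hd vs = u'" "last vs = v" by blast
  then have len: "length vs = Suc (length es)" by (simp add: edge_path_def)
  show ?case
  proof (cases "u \<in> set vs")
    case False
    have "ends C ((e # es) ! i) = {(u # vs) ! i, (u # vs) ! Suc i}" if "i < length (e # es)" for i
      using that p e len by (cases i) (auto simp: edge_path_def hd_conv_nth simp flip: length_greater_0_conv)
    then have "edge_path C F (u # vs) (e # es)"
      using p(1) e(1) False by (simp add: edge_path_def)
    moreover have "last (u # vs) = v" using p len by auto
    ultimately show ?thesis by (metis list.sel(1))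
  next
    case True
    then obtain k where k: "k < length vs" "vs ! k = u" by (metis in_set_conv_nth)
    have "edge_path C F (drop k vs) (drop k es)"
      using p(1) k set_drop_subset[of k es] by (auto simp: edge_path_def)
    moreover have "hd (drop k vs) = u" "last (drop k vs) = v"
      using k p by (simp_all add: hd_drop_conv_nth)
    ultimately show ?thesis by blast
  qed
qed

lemma edge_path_vertices:
  assumes G: "fin_graph C" and p: "edge_path C F vs es" "F \<subseteq> bedges C" "last vs \<in> verts C"
  shows "set vs \<subseteq> verts C"
proof
  fix x assume "x \<in> set vs"
  then obtain i where i: "i < length vs" "x = vs ! i" by (metis in_set_conv_nth)
  have len: "length vs = Suc (length es)" using p(1) by (simp add: edge_path_def)
  show "x \<in> verts C"
  proof (cases "i < length es")
    case True
    then have "es ! i \<in> bedges C" "x \<in> ends C (es ! i)"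
      using p(1,2) i by (auto simp: edge_path_def dest!: nth_mem)
    then show ?thesis using fin_graph_ends G by blast
  next
    case False
    then have "i = length es" using i(1) len by simp
    moreover have "last vs = vs ! length es" using len by (subst last_conv_nth) auto
    ultimately show ?thesis using i(2) p(3) by simp
  qed
qed

lemma joined_sym: "(u, v) \<in> joined C F \<Longrightarrow> (v, u) \<in> joined C F"
  by (auto simp: joined_def insert_commute)

lemma crossing_empty_joined:
  assumes "(u, v) \<in> (joined C F)\<^sup>*" "F \<subseteq> bedges C" "F \<inter> crossing C \<phi> = {}"
  shows "\<phi> u = \<phi> v"
  using assms(1)
proof (induction rule: rtrancl_induct)
  case (step y z)
  then obtain e where e: "e \<in> F" "ends C e = {y, z}" by (auto simp: joined_def)
  then have "e \<notin> crossing C \<phi>" "e \<in> bedges C" using assms by auto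
  then show ?case using step e by (simp add: in_crossing_iff)
qed simp

lemma crossing_reachable:
  assumes "fin_graph C"
  shows "crossing C (\<lambda>x. (u, x) \<in> (joined C F)\<^sup>*) \<inter> F = {}"
proof (rule equals0I)
  fix e assume e: "e \<in> crossing C (\<lambda>x. (u, x) \<in> (joined C F)\<^sup>*) \<inter> F"
  then have eb: "e \<in> bedges C" using crossing_subset by blast
  obtain x y where xy: "ends C e = {x, y}" using assms eb by (rule fin_graph_endsE)
  then have "(x, y) \<in> joined C F" "(y, x) \<in> joined C F" using e by (auto simp: joined_def)
  then have "(u, x) \<in> (joined C F)\<^sup>* \<longleftrightarrow> (u, y) \<in> (joined C F)\<^sup>*"
    by (blast intro: rtrancl_into_rtrancl)
  then show False using e in_crossing_iff[OF eb xy, of "\<lambda>x. (u, x) \<in> (joined C F)\<^sup>*"] by blast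
qed

lemma cut_conn_joined:
  assumes "fin_graph C" "cut_conn C" "u \<in> verts C" "v \<in> verts C"
  shows "(u, v) \<in> (joined C (bedges C))\<^sup>*"
proof -
  have "crossing C (\<lambda>x. (u, x) \<in> (joined C (bedges C))\<^sup>*) = {}"
    using crossing_reachable[OF assms(1)] crossing_subset by blast
  from cut_conn_const[OF assms(2) this assms(3,4)] show ?thesis by simp
qed

lemma connected_graph_iff:
  assumes "fin_graph C"
  shows "connected_graph C \<longleftrightarrow> verts C \<noteq> {} \<and> cut_conn C"
proof
  assume c: "connected_graph C"
  have "\<phi> u = \<phi> v" if "crossing C \<phi> = {}" "u \<in> verts C" "v \<in> verts C" for \<phi> u v
    using c that crossing_empty_joined[of u v C "bedges C" \<phi>] by (simp add: connected_graph_def)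
  then show "verts C \<noteq> {} \<and> cut_conn C" using c by (simp add: cut_conn_def connected_graph_def)
next
  assume "verts C \<noteq> {} \<and> cut_conn C"
  then show "connected_graph C" using cut_conn_joined[OF assms] by (simp add: connected_graph_def)
qed

text \<open>The vertices connected with one end of the edge by the other edges form a cut that
  crosses at most this edge. If the other end is among them, a path between the ends closes up to
  a cycle.\<close>

lemma cut_or_cycle:
  assumes G: "fin_graph C" and e: "e \<in> bedges C"
  shows "(\<exists>\<phi>. crossing C \<phi> = {e}) \<or> (\<exists>Z. simple_cycle C Z)"
proof -
  obtain u v where uv: "u \<in> verts C" "v \<in> verts C" "ends C e = {u, v}" using G e by (rule fin_graph_endsE)
  show ?thesis
  proof (cases "u = v")
    case True
    have "simple_cycle C {e}"
      unfolding simple_cycle_def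
      by (rule exI[of _ "[u]"], rule exI[of _ "[e]"]) (use uv True e in auto)
    then show ?thesis by blast
  next
    case False
    let ?F = "bedges C - {e}"
    define \<phi> where "\<phi> = (\<lambda>x. (u, x) \<in> (joined C ?F)\<^sup>*)"
    have sub: "crossing C \<phi> \<subseteq> {e}"
      using crossing_reachable[OF G, of u ?F] crossing_subset[of C \<phi>] unfolding \<phi>_def by blast
    have "\<phi> u" by (simp add: \<phi>_def)
    show ?thesis
    proof (cases "\<phi> v")
      case False
      then have "e \<in> crossing C \<phi>" using \<open>\<phi> u\<close> in_crossing_iff[OF e uv(3)] by simp
      then show ?thesis using sub by blast
    next
      case True
      then obtain vs es where p: "edge_path C ?F vs es" "hd vs = u" "last vs = v"
        using edge_path_exists by (fastforce simp: \<phi>_def)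
      then have len: "length vs = Suc (length es)" by (simp add: edge_path_def)
      have nth: "vs ! 0 = u" "vs ! length es = v"
        using p len by (metis hd_conv_nth last_conv_nth list.size(3) nat.distinct(1) diff_Suc_1)+
      have "ends C ((es @ [e]) ! i) = {vs ! i, vs ! (Suc i mod length (es @ [e]))}"
        if "i < length (es @ [e])" for i
      proof (cases "i < length es")
        case True
        then have "Suc i mod length (es @ [e]) = Suc i" by simp
        then show ?thesis using True p(1) by (simp add: edge_path_def nth_append)
      next
        case False
        then have "i = length es" using that by simp
        then show ?thesis using nth uv(3) by (simp add: insert_commute)
      qed
      moreover have "set vs \<subseteq> verts C" by (rule edge_path_vertices[OF G p(1)]) (use p(3) uv(2) in auto)
      moreover have "distinct (es @ [e])"
        using edge_path_distinct_edges[OF p(1)] p(1) by (auto simp: edge_path_def)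
      moreover have "set (es @ [e]) \<subseteq> bedges C" "distinct vs" "es @ [e] \<noteq> []" "length vs = length (es @ [e])"
        using p(1) e by (auto simp: edge_path_def)
      ultimately have "simple_cycle C (set (es @ [e]))"
        unfolding simple_cycle_def by blast
      then show ?thesis by blast
    qed
  qed
qed

section \<open>Trees\<close>

lemma tree_vertices_separated:
  assumes G: "fin_graph C" "cut_conn C" and W: "\<And>e. e \<in> bedges C \<Longrightarrow> crossing C (W e) = {e}"
    and xy: "x \<in> verts C" "y \<in> verts C" "x \<noteq> y"
  obtains e where "e \<in> bedges C" "W e x \<noteq> W e y"
proof -
  from edge_path_exists[OF cut_conn_joined[OF G xy(1,2)]]
  obtain vs es where p: "edge_path C (bedges C) vs es" "hd vs = x" "last vs = y" by blast
  then have "es \<noteq> []" using xy by (cases vs) (auto simp: edge_path_def)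
  then have e: "hd es \<in> bedges C" "set es \<inter> {hd es} = {hd es}" using p(1) by (auto simp: edge_path_def)
  have "W (hd es) x \<noteq> W (hd es) y"
    using edge_path_parity[OF p(1) order_refl, of "W (hd es)"] p W[OF e(1)] e(2) by simp
  then show ?thesis using e that by blast
qed

text \<open>A path crosses the cut at an edge at most once, namely if it contains the edge. By
  parity, the cuts thus tell which edges lie on the path.\<close>

lemma path_dist_tree:
  assumes G: "fin_graph C" "cut_conn C" and W: "\<And>e. e \<in> bedges C \<Longrightarrow> crossing C (W e) = {e}"
    and uv: "u \<in> verts C" "v \<in> verts C"
  shows "path_dist C u v = (\<Sum>e\<in>bedges C. len C e * of_bool (W e u \<noteq> W e v))"
proof -
  let ?d = "\<Sum>e\<in>bedges C. len C e * of_bool (W e u \<noteq> W e v)"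
  have fin: "finite (bedges C)" using G by (simp add: fin_graph_def)
  have sum: "sum_list (map (len C) es) = ?d"
    if "edge_path C (bedges C) vs es" "hd vs = u" "last vs = v" for vs es
  proof -
    have es: "set es \<subseteq> bedges C" "distinct es"
      using that edge_path_distinct_edges by (auto simp: edge_path_def)
    have "W e u \<noteq> W e v \<longleftrightarrow> e \<in> set es" if "e \<in> bedges C" for e
      using edge_path_parity[OF \<open>edge_path C (bedges C) vs es\<close> order_refl, of "W e"]
        W[OF that] \<open>hd vs = u\<close> \<open>last vs = v\<close> by (cases "e \<in> set es") auto
    then have "?d = (\<Sum>e\<in>bedges C. if e \<in> set es then len C e else 0)"
      by (intro sum.cong) auto
    also have "\<dots> = sum (len C) (set es)"
      using fin es(1) by (simp add: sum.inter_restrict[symmetric] Int_absorb1)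
    finally show ?thesis using es(2) by (simp add: sum_list_distinct_conv_sum_set)
  qed
  obtain vs es where p: "edge_path C (bedges C) vs es" "hd vs = u" "last vs = v"
    using edge_path_exists[OF cut_conn_joined[OF G uv]] by blast
  have "set vs \<subseteq> verts C" by (rule edge_path_vertices[OF G(1) p(1)]) (use p(3) uv(2) in auto)
  define Q where "Q = (\<lambda>vs es. length vs = Suc (length es) \<and> distinct vs \<and> set vs \<subseteq> verts C \<and>
      set es \<subseteq> bedges C \<and> hd vs = u \<and> last vs = v \<and>
      (\<forall>i<length es. ends C (es ! i) = {vs ! i, vs ! Suc i}))"
  have Q: "Q vs es" using p \<open>set vs \<subseteq> verts C\<close> by (simp add: Q_def edge_path_def)
  have Q': "sum_list (map (len C) es') = ?d" if "Q vs' es'" for vs' es'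
    using sum[of vs' es'] that by (simp add: Q_def edge_path_def)
  have "path_dist C u v = (THE d. \<exists>vs es. Q vs es \<and> d = sum_list (map (len C) es))"
    by (simp add: path_dist_def Q_def conj_assoc)
  also have "\<dots> = ?d"
    by (rule the_equality) (use Q Q' in metis)+
  finally show ?thesis .
qed

section \<open>Curves with one cycle\<close>

definition nonbridge :: "curve \<Rightarrow> nat \<Rightarrow> bool" where
  "nonbridge C e \<longleftrightarrow> e \<in> bedges C \<and> (\<nexists>\<phi>. crossing C \<phi> = {e})"

text \<open>Removing an edge of the only cycle of a connected graph leaves a tree, in which every
  edge is a bridge.\<close>

definition unicyclic_at :: "curve \<Rightarrow> nat \<Rightarrow> bool" where
  "unicyclic_at C e\<^sub>0 \<longleftrightarrow> nonbridge C e\<^sub>0 \<and>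
     (\<forall>f\<in>bedges C - {e\<^sub>0}. \<exists>\<phi>. crossing (delete_edge C e\<^sub>0) \<phi> = {f})"

lemma cut_conn_delete_edge:
  assumes "cut_conn C" "nonbridge C e"
  shows "cut_conn (delete_edge C e)"
  unfolding cut_conn_def
proof (intro allI impI ballI)
  fix \<phi> u v assume *: "crossing (delete_edge C e) \<phi> = {}"
    "u \<in> verts (delete_edge C e)" "v \<in> verts (delete_edge C e)"
  then have "crossing C \<phi> = {} \<or> crossing C \<phi> = {e}" by (auto simp: crossing_delete_edge)
  then have "crossing C \<phi> = {}" using assms(2) by (auto simp: nonbridge_def)
  then show "\<phi> u = \<phi> v" using cut_conn_const[OF assms(1)] * by simp
qed

lemma abstract_curve_iff:
  "abstract_curve N C \<longleftrightarrow> fin_graph C \<and> verts C \<noteq> {} \<and> cut_conn C \<and>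
     (\<forall>e\<in>bedges C. 0 < len C e) \<and> leaf C ` {1..N} \<subseteq> verts C"
proof -
  have ends: "S \<subseteq> A \<and> card S \<in> {1, 2} \<longleftrightarrow> (\<exists>u\<in>A. \<exists>v\<in>A. S = {u, v})" for S A :: "nat set"
  proof
    assume S: "S \<subseteq> A \<and> card S \<in> {1, 2}"
    then consider x where "S = {x}" | x y where "S = {x, y}" by (auto simp: card_1_singleton_iff card_2_iff)
    then show "\<exists>u\<in>A. \<exists>v\<in>A. S = {u, v}" using S by cases auto
  next
    assume "\<exists>u\<in>A. \<exists>v\<in>A. S = {u, v}"
    then obtain u v where "u \<in> A" "v \<in> A" "S = {u, v}" by blast
    then show "S \<subseteq> A \<and> card S \<in> {1, 2}" by (cases "u = v") auto
  qed
  have "fin_graph C \<longleftrightarrow> finite (verts C) \<and> finite (bedges C) \<and>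
      (\<forall>e\<in>bedges C. ends C e \<subseteq> verts C \<and> card (ends C e) \<in> {1, 2})"
    unfolding fin_graph_def ends by simp
  then show ?thesis unfolding abstract_curve_def using connected_graph_iff[of C] by blast
qed

lemma simple_cycle_delete_edge:
  "simple_cycle (delete_edge C e) Z \<longleftrightarrow> simple_cycle C Z \<and> e \<notin> Z"
proof
  assume "simple_cycle (delete_edge C e) Z"
  then obtain vs es where *: "es \<noteq> []" "length vs = length es" "distinct vs" "distinct es"
    "set vs \<subseteq> verts C" "set es \<subseteq> bedges C - {e}" "Z = set es"
    "\<forall>i<length es. ends C (es ! i) = {vs ! i, vs ! (Suc i mod length es)}"
    by (auto simp: simple_cycle_def)
  then show "simple_cycle C Z \<and> e \<notin> Z" unfolding simple_cycle_def by blast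
next
  assume a: "simple_cycle C Z \<and> e \<notin> Z"
  then obtain vs es where *: "es \<noteq> []" "length vs = length es" "distinct vs" "distinct es"
    "set vs \<subseteq> verts C" "set es \<subseteq> bedges C" "Z = set es"
    "\<forall>i<length es. ends C (es ! i) = {vs ! i, vs ! (Suc i mod length es)}"
    by (auto simp: simple_cycle_def)
  then have "set es \<subseteq> bedges (delete_edge C e)" using a by auto
  then show "simple_cycle (delete_edge C e) Z"
    unfolding simple_cycle_def by (intro exI[of _ vs] exI[of _ es]) (use * in simp)
qed

lemma nonbridge_in_cycle:
  assumes "simple_cycle C Z" "e \<in> Z"
  shows "nonbridge C e"
proof -
  have "crossing C \<phi> \<noteq> {e}" for \<phi>
    using simple_cycle_even[OF assms(1), of \<phi>] assms(2) by auto
  moreover have "e \<in> bedges C" using assms by (auto simp: simple_cycle_def)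
  ultimately show ?thesis by (auto simp: nonbridge_def)
qed

lemma unicyclic_if_one_cycle:
  assumes "fin_graph C" "\<exists>!Z. simple_cycle C Z"
  shows "\<exists>e\<^sub>0. unicyclic_at C e\<^sub>0"
proof -
  from assms(2) obtain Z where Z: "simple_cycle C Z" by blast
  then obtain e\<^sub>0 where e0: "e\<^sub>0 \<in> Z" by (force simp: simple_cycle_def)
  have "\<nexists>Z. simple_cycle (delete_edge C e\<^sub>0) Z"
    using assms(2) Z e0 by (auto simp: simple_cycle_delete_edge)
  then have "\<exists>\<phi>. crossing (delete_edge C e\<^sub>0) \<phi> = {f}" if "f \<in> bedges C - {e\<^sub>0}" for f
    using cut_or_cycle[OF fin_graph_delete_edge[OF assms(1)], of f e\<^sub>0] that by simp
  then have "unicyclic_at C e\<^sub>0"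
    using nonbridge_in_cycle[OF Z e0] by (simp add: unicyclic_at_def)
  then show ?thesis by blast
qed

lemma crossing_delete_edge_cases:
  assumes "crossing (delete_edge C e) \<phi> = {f}"
  obtains "crossing C \<phi> = {f}" | "crossing C \<phi> = {f, e}" "f \<noteq> e"
  using assms by (auto simp: crossing_delete_edge)

text \<open>Every cut crosses a cycle an even number of times, so the cycle passes through \<open>e\<^sub>0\<close>, and
  through another edge \<open>f\<close> exactly if the cut at \<open>f\<close> also crosses \<open>e\<^sub>0\<close>.\<close>

lemma one_cycle_if_unicyclic:
  assumes fin: "fin_graph C" and uni: "unicyclic_at C e\<^sub>0"
  shows "\<exists>!Z. simple_cycle C Z"
proof -
  have e0: "e\<^sub>0 \<in> bedges C" "nonbridge C e\<^sub>0" using uni by (auto simp: unicyclic_at_def nonbridge_def)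
  obtain K where K: "\<And>f. f \<in> bedges C - {e\<^sub>0} \<Longrightarrow> crossing (delete_edge C e\<^sub>0) (K f) = {f}"
    using uni unfolding unicyclic_at_def by metis
  have mem: "f \<in> Z \<longleftrightarrow> f \<in> bedges C \<and> (f = e\<^sub>0 \<or> crossing C (K f) = {f, e\<^sub>0})"
    if Z: "simple_cycle C Z" for Z f
  proof -
    have sub: "Z \<subseteq> bedges C" "Z \<noteq> {}" using Z by (auto simp: simple_cycle_def)
    have even: "even (card (Z \<inter> crossing C \<phi>))" for \<phi> by (rule simple_cycle_even[OF Z])
    have other: "g \<in> Z \<longleftrightarrow> e\<^sub>0 \<in> Z \<and> crossing C (K g) = {g, e\<^sub>0}" if g: "g \<in> bedges C" "g \<noteq> e\<^sub>0" for g
    proof -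
      have "crossing (delete_edge C e\<^sub>0) (K g) = {g}" using K g by blast
      then show ?thesis
      proof (cases rule: crossing_delete_edge_cases)
        case 1
        then show ?thesis using even[of "K g"] g by (cases "g \<in> Z") (auto simp: doubleton_eq_iff)
      next
        case 2
        then have "Z \<inter> crossing C (K g) =
            (if g \<in> Z then {g} else {}) \<union> (if e\<^sub>0 \<in> Z then {e\<^sub>0} else {})" by auto
        then show ?thesis using 2 even[of "K g"] by (auto split: if_splits)
      qed
    qed
    then have "e\<^sub>0 \<in> Z" using sub by blast
    then show ?thesis using other[of f] sub e0 by blast
  qed
  have "\<exists>Z. simple_cycle C Z" using cut_or_cycle[OF fin e0(1)] e0(2) by (auto simp: nonbridge_def)
  moreover have "Z = Z'" if "simple_cycle C Z" "simple_cycle C Z'" for Z Z'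
    using mem[OF that(1)] mem[OF that(2)] by blast
  ultimately show ?thesis by blast
qed

text \<open>If \<open>e\<^sub>0\<close> and \<open>e\<^sub>1\<close> both lie on the cycle, a cut
  crosses exactly these two. Combined with it, a cut that crosses \<open>f\<close> and
  \<open>e\<^sub>1\<close> becomes one that crosses \<open>f\<close> and
  \<open>e\<^sub>0\<close>.\<close>

lemma unicyclic_at_any:
  assumes fin: "fin_graph C" and uni: "unicyclic_at C e\<^sub>1" and e0: "nonbridge C e\<^sub>0"
  shows "unicyclic_at C e\<^sub>0"
proof (cases "e\<^sub>0 = e\<^sub>1")
  case False
  have e0b: "e\<^sub>0 \<in> bedges C" using e0 by (simp add: nonbridge_def)
  obtain \<psi> where \<psi>: "crossing C \<psi> = {e\<^sub>0, e\<^sub>1}"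
  proof -
    have "\<exists>\<phi>. crossing (delete_edge C e\<^sub>1) \<phi> = {e\<^sub>0}" using uni e0b False by (simp add: unicyclic_at_def)
    then obtain \<phi> where "crossing (delete_edge C e\<^sub>1) \<phi> = {e\<^sub>0}" by blast
    then show ?thesis by (cases rule: crossing_delete_edge_cases) (use that e0 nonbridge_def in blast)+
  qed
  have "\<exists>\<phi>. crossing (delete_edge C e\<^sub>0) \<phi> = {f}" if f: "f \<in> bedges C - {e\<^sub>0}" for f
  proof (cases "f = e\<^sub>1")
    case True
    then have "crossing (delete_edge C e\<^sub>0) \<psi> = {f}" using \<psi> f by (auto simp: crossing_delete_edge)
    then show ?thesis by blast
  next
    case neq: False
    have "\<exists>\<phi>. crossing (delete_edge C e\<^sub>1) \<phi> = {f}" using uni f neq by (simp add: unicyclic_at_def)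
    then obtain \<phi> where "crossing (delete_edge C e\<^sub>1) \<phi> = {f}" by blast
    then show ?thesis
    proof (cases rule: crossing_delete_edge_cases)
      case 1
      then have "crossing (delete_edge C e\<^sub>0) \<phi> = {f}" using f by (auto simp: crossing_delete_edge)
      then show ?thesis by blast
    next
      case 2
      then have "crossing C (\<lambda>x. \<phi> x \<noteq> \<psi> x) = {f, e\<^sub>0}"
        using \<psi> f False crossing_xor[OF fin] by auto
      then have "crossing (delete_edge C e\<^sub>0) (\<lambda>x. \<phi> x \<noteq> \<psi> x) = {f}"
        using f by (auto simp: crossing_delete_edge)
      then show ?thesis by blast
    qed
  qed
  then show ?thesis using e0 by (simp add: unicyclic_at_def)
qed (use uni in simp)

lemma elliptic_curves_iff:
  "C \<in> elliptic_curves n \<longleftrightarrow> fin_graph C \<and> verts C \<noteq> {} \<and> cut_conn C \<and>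
     (\<forall>e\<in>bedges C. 0 < len C e) \<and> leaf C ` {1..n} \<subseteq> verts C \<and>
     (\<forall>v\<in>verts C. 3 \<le> valence n C v) \<and> (\<exists>e\<^sub>0. unicyclic_at C e\<^sub>0)"
proof (cases "fin_graph C")
  case True
  have "(\<exists>!Z. simple_cycle C Z) \<longleftrightarrow> (\<exists>e\<^sub>0. unicyclic_at C e\<^sub>0)"
    using one_cycle_if_unicyclic[OF True] unicyclic_if_one_cycle[OF True] by metis
  then show ?thesis by (simp add: elliptic_curves_def abstract_curve_iff True)
qed (simp add: elliptic_curves_def abstract_curve_iff)

section \<open>Rooted cuts\<close>

lemma finite_has_greatest:
  fixes d :: "'a \<Rightarrow> nat"
  assumes "finite R" "R \<noteq> {}"
  shows "\<exists>y\<in>R. \<forall>z\<in>R. d z \<le> d y"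
proof -
  have "Max (d ` R) \<in> d ` R" using assms by (intro Max_in) auto
  then obtain y where "y \<in> R" "d y = Max (d ` R)" by auto
  then show ?thesis using assms(1) by (metis Max_ge finite_imageI imageI)
qed

text \<open>The cycle is cut in the edge \<open>e\<^sub>0\<close> next to its end
  \<open>v\<^sub>0\<close>. The edges other than \<open>e\<^sub>0\<close> form a tree with root
  \<open>v\<^sub>0\<close>, where the leaf \<open>n + 1\<close> is attached, and
  \<open>e\<^sub>0\<close> hangs at \<open>u\<close> and leads to the leaf \<open>n + 2\<close>.
  \<open>W f\<close> is the part of the tree beyond \<open>f\<close>.\<close>

locale rooted_cut =
  fixes n :: nat and C :: curve and e\<^sub>0 v\<^sub>0 u :: nat and W :: "nat \<Rightarrow> nat \<Rightarrow> bool"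
  assumes fin: "fin_graph C" and conn: "cut_conn C"
    and leaf: "i \<in> {1..n} \<Longrightarrow> leaf C i \<in> verts C"
    and val: "x \<in> verts C \<Longrightarrow> 3 \<le> valence n C x"
    and e0: "nonbridge C e\<^sub>0" and ends0: "ends C e\<^sub>0 = {v\<^sub>0, u}"
    and W: "f \<in> bedges C \<Longrightarrow> f \<noteq> e\<^sub>0 \<Longrightarrow> crossing (delete_edge C e\<^sub>0) (W f) = {f}"
    and root: "f \<in> bedges C \<Longrightarrow> f \<noteq> e\<^sub>0 \<Longrightarrow> \<not> W f v\<^sub>0"

lemma rooted_cut_exists:
  assumes C: "C \<in> elliptic_curves n" and e0: "nonbridge C e\<^sub>0" "ends C e\<^sub>0 = {v\<^sub>0, u}"
  shows "\<exists>W. rooted_cut n C e\<^sub>0 v\<^sub>0 u W"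
proof -
  obtain e\<^sub>1 where "fin_graph C" "unicyclic_at C e\<^sub>1" using C unfolding elliptic_curves_iff by blast
  then have "unicyclic_at C e\<^sub>0" by (rule unicyclic_at_any[OF _ _ e0(1)])
  then obtain K where K: "\<And>f. f \<in> bedges C - {e\<^sub>0} \<Longrightarrow> crossing (delete_edge C e\<^sub>0) (K f) = {f}"
    unfolding unicyclic_at_def by metis
  have C': "fin_graph C" "cut_conn C" "leaf C ` {1..n} \<subseteq> verts C" "\<forall>v\<in>verts C. 3 \<le> valence n C v"
    using C unfolding elliptic_curves_iff by blast+
  have "rooted_cut n C e\<^sub>0 v\<^sub>0 u (\<lambda>f x. K f x \<noteq> K f v\<^sub>0)"
  proof
    show "leaf C i \<in> verts C" if "i \<in> {1..n}" for i using C'(3) that by blast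
    show "crossing (delete_edge C e\<^sub>0) (\<lambda>x. K f x \<noteq> K f v\<^sub>0) = {f}"
      if "f \<in> bedges C" "f \<noteq> e\<^sub>0" for f
      unfolding crossing_neq using K that by simp
  qed (use C' e0 in simp_all)
  then show ?thesis by blast
qed

context rooted_cut
begin

abbreviation "T \<equiv> delete_edge C e\<^sub>0"
abbreviation "E \<equiv> bedges C - {e\<^sub>0}"

lemma finT: "fin_graph T" by (rule fin_graph_delete_edge[OF fin])
lemma connT: "cut_conn T" by (rule cut_conn_delete_edge[OF conn e0])
lemma e0_in: "e\<^sub>0 \<in> bedges C" using e0 by (simp add: nonbridge_def)
lemma v0_in: "v\<^sub>0 \<in> verts C" and u_in: "u \<in> verts C"
  using fin_graph_ends[OF fin e0_in] ends0 by auto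
lemma finE: "finite E" using fin by (simp add: fin_graph_def)
lemma fin_verts: "finite (verts C)" using fin by (simp add: fin_graph_def)

lemma crossing_W:
  assumes "f \<in> E" shows "crossing C (W f) = (if W f u then {f, e\<^sub>0} else {f})"
proof -
  have "crossing C (W f) - {e\<^sub>0} = {f}" using W assms by (simp add: crossing_delete_edge)
  moreover have "e\<^sub>0 \<in> crossing C (W f) \<longleftrightarrow> W f u"
    using in_crossing_iff[OF e0_in ends0, of "W f"] root assms by simp
  ultimately show ?thesis by auto
qed

lemma four_values_T:
  assumes "f \<in> E" "g \<in> E" "f \<noteq> g" "x \<in> verts C" "W f x" "W g x"
    "y \<in> verts C" "W f y" "\<not> W g y" "z \<in> verts C" "\<not> W f z" "W g z"
  shows False
  by (rule four_values[OF connT, of "W f" f "W g" g x y z v\<^sub>0])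
    (use assms W root v0_in in auto)

text \<open>The root is beyond neither edge, so the other three combinations cannot all occur.\<close>

lemma laminar_W:
  assumes "f \<in> E" "g \<in> E" "x \<in> verts C" "W f x" "W g x"
  shows "(\<forall>y\<in>verts C. W f y \<longrightarrow> W g y) \<or> (\<forall>y\<in>verts C. W g y \<longrightarrow> W f y)"
  using four_values_T[OF assms(1,2) _ assms(3-5)] by (cases "f = g") blast+

lemma endsE:
  assumes "f \<in> E"
  obtains p q where "p \<in> verts C" "q \<in> verts C" "ends C f = {p, q}" "\<not> W f p" "W f q"
    "\<And>g. g \<in> E \<Longrightarrow> g \<noteq> f \<Longrightarrow> W g p = W g q"
proof -
  have fb: "f \<in> bedges T" using assms by simp
  obtain a b where ab: "a \<in> verts C" "b \<in> verts C" "ends C f = {a, b}"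
    using fin_graph_endsE[OF fin, of f] assms by blast
  have "W f a \<noteq> W f b" using in_crossing_iff[OF fb, of a b "W f"] W assms ab by auto
  moreover have same: "W g a = W g b" if "g \<in> E" "g \<noteq> f" for g
    using in_crossing_iff[OF fb, of a b "W g"] W that ab by auto
  ultimately consider "\<not> W f a" "W f b" | "\<not> W f b" "W f a" by blast
  then show ?thesis
  proof cases
    case 1
    then show ?thesis using that[OF ab] same by blast
  next
    case 2
    have ba: "ends C f = {b, a}" using ab by blast
    from that[OF ab(2,1) ba 2] same show ?thesis by simp
  qed
qed

lemma near_end:
  assumes "f \<in> E" "y \<in> ends C f" "W f y"
  shows "\<exists>p\<in>verts C. ends C f = {p, y} \<and> \<not> W f p \<and> (\<forall>g\<in>E - {f}. W g p = W g y)"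
proof -
  obtain p q where pq: "p \<in> verts C" "q \<in> verts C" "ends C f = {p, q}" "\<not> W f p" "W f q"
    "\<And>g. g \<in> E \<Longrightarrow> g \<noteq> f \<Longrightarrow> W g p = W g q"
    using endsE[OF assms(1)] by blast
  then have "y = q" using assms by auto
  then show ?thesis using pq by blast
qed

lemma separated:
  assumes "x \<in> verts C" "y \<in> verts C" "x \<noteq> y"
  obtains f where "f \<in> E" "W f x \<noteq> W f y"
  by (rule tree_vertices_separated[OF finT connT, of W x y]) (use assms W in auto)

text \<open>Beyond \<open>e\<^sub>0\<close> there is only the leaf \<open>n + 2\<close>, which lies beyond another edge exactly if \<open>u\<close> does.\<close>

definition side :: "nat \<Rightarrow> nat set" where
  "side f = (if f = e\<^sub>0 then {n + 2}
     else {i \<in> {1..n}. W f (leaf C i)} \<union> (if W f u then {n + 2} else {}))"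

lemma side_e0 [simp]: "side e\<^sub>0 = {n + 2}" by (simp add: side_def)

lemma in_side_leaf: "f \<in> E \<Longrightarrow> i \<in> {1..n} \<Longrightarrow> i \<in> side f \<longleftrightarrow> W f (leaf C i)"
  by (auto simp: side_def)

lemma in_side_B: "f \<in> E \<Longrightarrow> n + 2 \<in> side f \<longleftrightarrow> W f u"
  by (auto simp: side_def)

lemma side_subset: "side f \<subseteq> insert (n + 2) {1..n}"
  by (auto simp: side_def)

text \<open>At a vertex of the region that is farthest from the root, every edge is the one
  towards the root, an edge of \<open>F\<close> or \<open>e\<^sub>0\<close>. By stability at
  least three edges and leaves meet there.\<close>

lemma farthest_vertex_labels:
  assumes e: "e \<in> E" and F: "F \<subseteq> E" and x: "x \<in> verts C" "W e x" "\<forall>f\<in>F. \<not> W f x"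
  obtains y where "y \<in> verts C" "W e y" "\<forall>f\<in>F. \<not> W f y"
    "2 \<le> card {i \<in> {1..n}. leaf C i = y} + of_bool (y = u) + card F"
proof -
  let ?R = "{y \<in> verts C. W e y \<and> (\<forall>f\<in>F. \<not> W f y)}"
  let ?d = "\<lambda>y. card {g \<in> E. W g y}"
  have fin_R: "finite ?R" "?R \<noteq> {}" using fin_verts x by auto
  then obtain y where y: "y \<in> ?R" "\<And>z. z \<in> ?R \<Longrightarrow> ?d z \<le> ?d y"
    using finite_has_greatest[of ?R ?d] by blast
  then have yv: "y \<in> verts C" "W e y" "\<forall>f\<in>F. \<not> W f y" by auto
  have y0: "y \<noteq> v\<^sub>0" using yv(2) root e by auto
  let ?P = "{g \<in> E. y \<in> ends C g \<and> W g y}"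
  have P1: "card ?P \<le> 1"
  proof -
    have "g = h" if g: "g \<in> ?P" and h: "h \<in> ?P" for g h
    proof (rule ccontr)
      assume "g \<noteq> h"
      have g': "g \<in> E" "y \<in> ends C g" "W g y" and h': "h \<in> E" "y \<in> ends C h" "W h y"
        using g h by simp_all
      from near_end[OF g'] obtain p where p: "p \<in> verts C" "\<not> W g p" "\<forall>k\<in>E - {g}. W k p = W k y"
        by (elim bexE conjE)
      from near_end[OF h'] obtain q where q: "q \<in> verts C" "\<not> W h q" "\<forall>k\<in>E - {h}. W k q = W k y"
        by (elim bexE conjE)
      have "h \<in> E - {g}" "g \<in> E - {h}" using g'(1) h'(1) \<open>g \<noteq> h\<close> by blast+
      then have hp: "W h p" and gq: "W g q"
        using bspec[OF p(3), of h] bspec[OF q(3), of g] g'(3) h'(3) by simp_all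
      show False
        by (rule four_values_T[OF g'(1) h'(1) \<open>g \<noteq> h\<close> yv(1) g'(3) h'(3) q(1) gq q(2) p(1,2) hp])
    qed
    then have "\<forall>g\<in>?P. \<forall>h\<in>?P. g = h" by blast
    moreover have "finite ?P" using finE by (rule rev_finite_subset) blast
    ultimately show ?thesis using card_le_Suc0_iff_eq[of ?P] by simp
  qed
  have sub: "{g \<in> bedges C. y \<in> ends C g} \<subseteq> ?P \<union> F \<union> (if y = u then {e\<^sub>0} else {})"
  proof
    fix g assume "g \<in> {g \<in> bedges C. y \<in> ends C g}"
    then have g: "g \<in> bedges C" "y \<in> ends C g" by auto
    show "g \<in> ?P \<union> F \<union> (if y = u then {e\<^sub>0} else {})"
    proof (cases "g = e\<^sub>0")
      case True
      then show ?thesis using g y0 ends0 by auto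
    next
      case False
      then have gE: "g \<in> E" using g by simp
      show ?thesis
      proof (cases "W g y")
        case True
        then show ?thesis using gE g by simp
      next
        case nW: False
        have "g \<in> F"
        proof (rule ccontr)
          assume gF: "g \<notin> F"
          obtain p q where pq: "p \<in> verts C" "q \<in> verts C" "ends C g = {p, q}" "\<not> W g p" "W g q"
            "\<And>h. h \<in> E \<Longrightarrow> h \<noteq> g \<Longrightarrow> W h p = W h q" using endsE[OF gE] by blast
          have py: "p = y" using pq g(2) nW by auto
          have "e \<noteq> g" using yv(2) nW by auto
          then have "W e q" using pq(6)[OF e] py yv(2) by auto
          moreover have "\<not> W f q" if "f \<in> F" for f
            using pq(6)[of f] that F gF py yv(3) by blast
          ultimately have "q \<in> ?R" using pq by simp
          moreover have "{h \<in> E. W h q} = insert g {h \<in> E. W h y}"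
            using pq py gE by blast
          then have "?d q = Suc (?d y)" using finE nW by simp
          ultimately show False using y(2)[of q] by simp
        qed
        then show ?thesis by simp
      qed
    qed
  qed
  have "card {g \<in> bedges C. y \<in> ends C g} \<le> card (?P \<union> F \<union> (if y = u then {e\<^sub>0} else {}))"
    by (rule card_mono[OF _ sub]) (use finE F finite_subset in auto)
  also have "\<dots> \<le> card ?P + card F + card (if y = u then {e\<^sub>0} else {})"
    using card_Un_le[of "?P \<union> F" "if y = u then {e\<^sub>0} else {}"] card_Un_le[of ?P F] by linarith
  also have "\<dots> \<le> 1 + card F + of_bool (y = u)"
  proof -
    have "card (if y = u then {e\<^sub>0} else {}) = of_bool (y = u)" by simp
    then show ?thesis using P1 by linarith
  qed
  finally have c: "card {g \<in> bedges C. y \<in> ends C g} \<le> 1 + card F + of_bool (y = u)" .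
  have no_loop: "{g \<in> bedges C. ends C g = {y}} = {}"
  proof -
    have False if g: "g \<in> bedges C" "ends C g = {y}" for g
    proof (cases "g = e\<^sub>0")
      case True
      then show ?thesis using g y0 ends0 by auto
    next
      case False
      then have "g \<in> E" using g by simp
      from endsE[OF this] show ?thesis using g(2) by (metis doubleton_eq_iff insert_absorb2)
    qed
    then show ?thesis by blast
  qed
  have "3 \<le> card {g \<in> bedges C. y \<in> ends C g} + card {i \<in> {1..n}. leaf C i = y}"
    using val[OF yv(1)] unfolding valence_def no_loop card.empty by linarith
  then have "2 \<le> card {i \<in> {1..n}. leaf C i = y} + of_bool (y = u) + card F" using c by linarith
  then show ?thesis by (rule that[OF yv])
qed

lemma card_pos_leaf:
  assumes "0 < card {i \<in> {1..n}. leaf C i = y}"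
  obtains i where "i \<in> {1..n}" "leaf C i = y"
proof -
  have "{i \<in> {1..n}. leaf C i = y} \<noteq> {}" using assms by (metis card.empty less_irrefl)
  then show ?thesis using that by blast
qed

lemma side_has_two:
  assumes "f \<in> E"
  obtains i j where "i \<in> side f" "j \<in> side f" "i \<noteq> j" "i \<in> {1..n}"
proof -
  have "\<exists>x\<in>verts C. W f x" by (rule endsE[OF assms]) blast
  then obtain x where "x \<in> verts C" "W f x" by blast
  then obtain y where y: "y \<in> verts C" "W f y"
    "2 \<le> card {i \<in> {1..n}. leaf C i = y} + of_bool (y = u)"
    using farthest_vertex_labels[OF assms, of "{}"] by auto
  let ?A = "{i \<in> {1..n}. leaf C i = y}"
  have A: "?A \<subseteq> side f" using assms y by (auto simp: side_def)
  show ?thesis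
  proof (cases "y = u")
    case True
    then have "0 < card ?A" using y by simp
    then obtain i where "i \<in> {1..n}" "leaf C i = y" by (rule card_pos_leaf)
    moreover have "n + 2 \<in> side f" using True y in_side_B[OF assms] by blast
    moreover have "i \<noteq> n + 2" using \<open>i \<in> {1..n}\<close> by auto
    ultimately show ?thesis using that[of i "n + 2"] A by blast
  next
    case False
    then have "2 \<le> card ?A" using y by simp
    then have "\<not> (\<forall>i\<in>?A. \<forall>j\<in>?A. i = j)" using card_le_Suc0_iff_eq[of ?A] by simp
    then obtain i j where "i \<in> ?A" "j \<in> ?A" "i \<noteq> j" by blast
    moreover have "i \<in> {1..n}" using \<open>i \<in> ?A\<close> by simp
    ultimately show ?thesis using that[of i j] A by blast
  qed
qed

lemma side_diff:
  assumes "e \<in> E" "f \<in> E" "x \<in> verts C" "W e x" "\<not> W f x"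
  shows "\<not> side e \<subseteq> side f"
proof -
  obtain y where y: "y \<in> verts C" "W e y" "\<not> W f y"
    "2 \<le> card {i \<in> {1..n}. leaf C i = y} + of_bool (y = u) + card {f}"
    using farthest_vertex_labels[OF assms(1), of "{f}"] assms by auto
  show ?thesis
  proof (cases "y = u")
    case True
    then show ?thesis using y assms in_side_B by blast
  next
    case False
    then have "0 < card {i \<in> {1..n}. leaf C i = y}" using y(4) by simp
    then obtain i where "i \<in> {1..n}" "leaf C i = y" by (rule card_pos_leaf)
    then show ?thesis using y assms in_side_leaf by blast
  qed
qed

lemma side_neq_e0:
  assumes "f \<in> E" shows "side f \<noteq> {n + 2}"
proof
  assume *: "side f = {n + 2}"
  show False by (rule side_has_two[OF assms]) (simp add: *)
qed

lemma side_subset_iff: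
  assumes "e \<in> E" "f \<in> E"
  shows "side e \<subseteq> side f \<longleftrightarrow> (\<forall>x\<in>verts C. W e x \<longrightarrow> W f x)"
proof
  show "side e \<subseteq> side f \<Longrightarrow> \<forall>x\<in>verts C. W e x \<longrightarrow> W f x" using side_diff[OF assms] by blast
next
  assume *: "\<forall>x\<in>verts C. W e x \<longrightarrow> W f x"
  show "side e \<subseteq> side f" using assms * leaf u_in by (auto simp: side_def)
qed

text \<open>This rests on stability: the two edges at a vertex of valence two would have the same
  side.\<close>

lemma inj_side: "inj_on side (bedges C)"
proof (rule inj_onI)
  fix e f assume *: "e \<in> bedges C" "f \<in> bedges C" "side e = side f"
  show "e = f"
  proof (cases "e = e\<^sub>0 \<or> f = e\<^sub>0")
    case True
    then show ?thesis
      using side_neq_e0[of e] side_neq_e0[of f] * side_e0 by (metis Diff_iff singletonD)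
  next
    case False
    then have E: "e \<in> E" "f \<in> E" using * by auto
    then have "\<forall>x\<in>verts C. W e x \<longleftrightarrow> W f x"
      using side_subset_iff[OF E] side_subset_iff[OF E(2,1)] *(3) by simp blast
    then have "crossing T (W e) = crossing T (W f)"
      by (intro crossing_cong[OF finT]) simp
    then show ?thesis using W E by simp
  qed
qed

end

section \<open>Reconstructing a curve from its sides\<close>

context rooted_cut
begin

text \<open>The sides of the edges between the root and a vertex.\<close>

definition label :: "nat \<Rightarrow> nat set set" where
  "label x = side ` {f \<in> E. W f x}"

lemma far_end_iff:
  assumes f: "f \<in> E" "y \<in> ends C f" "W f y" and g: "g \<in> E"
  shows "W g y \<longleftrightarrow> side f \<subseteq> side g"
proof
  have y: "y \<in> verts C" using fin_graph_ends[OF fin, of f y] f by simp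
  show "W g y" if "side f \<subseteq> side g" using that side_subset_iff[OF f(1) g] y f(3) by blast
  assume gy: "W g y"
  show "side f \<subseteq> side g"
  proof (cases "g = f")
    case False
    from near_end[OF f] obtain p where p: "p \<in> verts C" "\<not> W f p" "\<forall>k\<in>E - {f}. W k p = W k y"
      by (elim bexE conjE)
    have "W g p" using bspec[OF p(3), of g] g False gy by simp
    then have "\<forall>z\<in>verts C. W f z \<longrightarrow> W g z"
      using laminar_W[OF f(1) g y f(3) gy] p(1,2) by blast
    then show ?thesis using side_subset_iff[OF f(1) g] by simp
  qed simp
qed

text \<open>The edge is the one whose far side is the smallest that contains the vertex; its far
  end is separated from the vertex by no edge.\<close>

lemma parent_edge:
  assumes x: "x \<in> verts C" "x \<noteq> v\<^sub>0"
  shows "\<exists>f\<in>E. x \<in> ends C f \<and> W f x"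
proof -
  let ?d = "\<lambda>f. card (verts C) - card {y \<in> verts C. W f y}"
  obtain f\<^sub>0 where "f\<^sub>0 \<in> E" "W f\<^sub>0 x"
  proof (rule separated[OF x(1) v0_in x(2)])
    fix f assume "f \<in> E" "W f x \<noteq> W f v\<^sub>0"
    then show thesis using that root by auto
  qed
  then have "{f \<in> E. W f x} \<noteq> {}" by blast
  then obtain f where f: "f \<in> {f \<in> E. W f x}" "\<forall>g\<in>{f \<in> E. W f x}. ?d g \<le> ?d f"
    using finite_has_greatest[of "{f \<in> E. W f x}" ?d] finE by auto
  then have fE: "f \<in> E" "W f x" by simp_all
  have le: "card {y \<in> verts C. W g y} \<le> card (verts C)" for g
    by (rule card_mono[OF fin_verts]) blast
  have min: "card {y \<in> verts C. W f y} \<le> card {y \<in> verts C. W g y}" if "g \<in> E" "W g x" for g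
    using f(2) that le[of f] le[of g] by force
  have "\<exists>y. y \<in> ends C f \<and> W f y" by (rule endsE[OF fE(1)]) blast
  then obtain y where y: "y \<in> ends C f" "W f y" by blast
  have yv: "y \<in> verts C" using fin_graph_ends[OF fin, of f y] fE y by simp
  have sub: "\<forall>z\<in>verts C. W f z \<longrightarrow> W g z" if g: "g \<in> E" "W g x" for g
  proof (cases "\<forall>z\<in>verts C. W g z \<longrightarrow> W f z")
    case True
    then have "{z \<in> verts C. W g z} = {z \<in> verts C. W f z}"
      using min[OF g] fin_verts by (intro card_seteq) auto
    then show ?thesis by blast
  next
    case False
    then show ?thesis using laminar_W[OF fE(1) g(1) x(1) fE(2) g(2)] by blast
  qed
  have "W g x = W g y" if g: "g \<in> E" for g
  proof
    show "W g x \<Longrightarrow> W g y" using sub[OF g] yv y(2) by blast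
    assume "W g y"
    then have "side f \<subseteq> side g" using far_end_iff[OF fE(1) y g] by simp
    then show "W g x" using side_subset_iff[OF fE(1) g] x(1) fE(2) by blast
  qed
  then have "x = y" using separated[OF x(1) yv] by metis
  then show ?thesis using fE y by blast
qed

lemma side_E: "side ` E = side ` bedges C - {{n + 2}}"
proof -
  have "side ` (bedges C - {e\<^sub>0}) = side ` bedges C - side ` {e\<^sub>0}"
    by (rule inj_on_image_set_diff[OF inj_side]) (use e0_in in auto)
  then show ?thesis by simp
qed

lemma label_far_end:
  assumes "f \<in> E" "y \<in> ends C f" "W f y"
  shows "label y = {X \<in> side ` E. side f \<subseteq> X}"
  using far_end_iff[OF assms] unfolding label_def by blast

lemma label_root: "label v\<^sub>0 = {}"
  using root by (auto simp: label_def)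

lemma label_leaf: "i \<in> {1..n} \<Longrightarrow> label (leaf C i) = {X \<in> side ` E. i \<in> X}"
  using in_side_leaf unfolding label_def by blast

lemma label_u: "label u = {X \<in> side ` E. n + 2 \<in> X}"
  using in_side_B unfolding label_def by blast

text \<open>A vertex other than the root is the far end of its parent edge, whose side is the
  smallest one in the label.\<close>

lemma label_image: "label ` verts C = insert {} ((\<lambda>Y. {X \<in> side ` E. Y \<subseteq> X}) ` (side ` E))"
proof
  show "label ` verts C \<subseteq> insert {} ((\<lambda>Y. {X \<in> side ` E. Y \<subseteq> X}) ` (side ` E))"
  proof
    fix l assume "l \<in> label ` verts C"
    then obtain x where x: "x \<in> verts C" "l = label x" by blast
    show "l \<in> insert {} ((\<lambda>Y. {X \<in> side ` E. Y \<subseteq> X}) ` (side ` E))"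
    proof (cases "x = v\<^sub>0")
      case True
      then show ?thesis using label_root x by simp
    next
      case False
      then obtain f where f: "f \<in> E" "x \<in> ends C f" "W f x" using parent_edge x(1) by blast
      show ?thesis unfolding x(2) label_far_end[OF f] using f(1) by blast
    qed
  qed
  show "insert {} ((\<lambda>Y. {X \<in> side ` E. Y \<subseteq> X}) ` (side ` E)) \<subseteq> label ` verts C"
  proof
    fix l assume "l \<in> insert {} ((\<lambda>Y. {X \<in> side ` E. Y \<subseteq> X}) ` (side ` E))"
    then consider "l = {}" | f where "f \<in> E" "l = {X \<in> side ` E. side f \<subseteq> X}" by blast
    then show "l \<in> label ` verts C"
    proof cases
      case 1
      then show ?thesis using label_root v0_in by blast
    next
      case (2 f)
      have "\<exists>y. y \<in> verts C \<and> y \<in> ends C f \<and> W f y" by (rule endsE[OF 2(1)]) blast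
      then obtain y where "y \<in> verts C" "y \<in> ends C f" "W f y" by blast
      then show ?thesis using label_far_end[OF 2(1)] 2(2) by blast
    qed
  qed
qed

lemma inj_label: "inj_on label (verts C)"
proof (rule inj_onI, rule ccontr)
  fix x y assume *: "x \<in> verts C" "y \<in> verts C" "label x = label y" "x \<noteq> y"
  obtain f where f: "f \<in> E" "W f x \<noteq> W f y" by (rule separated[OF *(1,2,4)])
  have "inj_on side E" using inj_side by (rule inj_on_subset) blast
  then have "side f \<in> label z \<longleftrightarrow> W f z" for z
    using f(1) unfolding label_def by (auto dest: inj_onD)
  then show False using *(3) f(2) by blast
qed

lemma label_endsE:
  assumes f: "f \<in> E"
  obtains p q where "ends C f = {p, q}" "p \<in> verts C" "q \<in> verts C"
    "label q = {X \<in> side ` E. side f \<subseteq> X}" "label p = {X \<in> side ` E. side f \<subset> X}"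
proof -
  obtain p q where pq: "p \<in> verts C" "q \<in> verts C" "ends C f = {p, q}" "\<not> W f p" "W f q"
    "\<And>g. g \<in> E \<Longrightarrow> g \<noteq> f \<Longrightarrow> W g p = W g q"
    by (rule endsE[OF f]) blast
  have q: "label q = {X \<in> side ` E. side f \<subseteq> X}" using label_far_end[OF f] pq by simp
  have "W g p \<longleftrightarrow> side f \<subset> side g" if g: "g \<in> E" for g
  proof (cases "g = f")
    case True
    then show ?thesis using pq by simp
  next
    case False
    then have "side g \<noteq> side f" using inj_onD[OF inj_side] g f by blast
    then show ?thesis using pq(6)[OF g False] far_end_iff[OF f _ pq(5) g] pq(3) by blast
  qed
  then have "label p = {X \<in> side ` E. side f \<subset> X}" unfolding label_def by blast
  then show ?thesis using that pq(1-3) q by blast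
qed

end

definition cut_sides :: "nat \<Rightarrow> curve \<Rightarrow> (nat \<Rightarrow> nat set) \<Rightarrow> bool" where
  "cut_sides n C S \<longleftrightarrow>
     (\<exists>e\<^sub>0 v\<^sub>0 u W. rooted_cut n C e\<^sub>0 v\<^sub>0 u W \<and> S = rooted_cut.side n C e\<^sub>0 u W)"

lemma cut_sidesE:
  assumes "cut_sides n C S"
  obtains e\<^sub>0 v\<^sub>0 u W where "rooted_cut n C e\<^sub>0 v\<^sub>0 u W" "S = rooted_cut.side n C e\<^sub>0 u W"
  using assms unfolding cut_sides_def by blast

lemma cut_sidesI: "rooted_cut n C e\<^sub>0 v\<^sub>0 u W \<Longrightarrow> cut_sides n C (rooted_cut.side n C e\<^sub>0 u W)"
  unfolding cut_sides_def by blast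

text \<open>Vertices are recognized by their labels, and the labels of the two ends of an edge,
  of the root, of \<open>u\<close> and of the ends of the leaves can be read off from the family
  of sides. So this family determines the graph together with its leaves.\<close>

lemma same_sides_iso:
  assumes S: "cut_sides n C S" and S': "cut_sides n C' S'" and eq: "S ` bedges C = S' ` bedges C'"
  shows "\<exists>f g. bij_betw f (verts C) (verts C') \<and> bij_betw g (bedges C) (bedges C') \<and>
    (\<forall>e\<in>bedges C. ends C' (g e) = f ` ends C e \<and> S' (g e) = S e) \<and>
    (\<forall>i\<in>{1..n}. leaf C' i = f (leaf C i))"
proof -
  obtain e\<^sub>0 v\<^sub>0 u W where R: "rooted_cut n C e\<^sub>0 v\<^sub>0 u W" and Sdef: "S = rooted_cut.side n C e\<^sub>0 u W"
    using S by (rule cut_sidesE)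
  obtain e\<^sub>0' v\<^sub>0' u' W' where R': "rooted_cut n C' e\<^sub>0' v\<^sub>0' u' W'"
    and S'def: "S' = rooted_cut.side n C' e\<^sub>0' u' W'"
    using S' by (rule cut_sidesE)
  interpret R: rooted_cut n C e\<^sub>0 v\<^sub>0 u W by fact
  interpret R': rooted_cut n C' e\<^sub>0' v\<^sub>0' u' W' by fact
  note [simp] = Sdef[symmetric] S'def[symmetric]
  have bS: "bij_betw S (bedges C) (S ` bedges C)"
    using R.inj_side by (simp add: bij_betw_def)
  have bS': "bij_betw S' (bedges C') (S ` bedges C)"
    using R'.inj_side eq by (simp add: bij_betw_def)
  have SE: "S ` R.E = S' ` R'.E" using R.side_E R'.side_E eq by simp
  have bl: "bij_betw R.label (verts C) (R.label ` verts C)"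
    using R.inj_label by (simp add: bij_betw_def)
  have "R.label ` verts C = R'.label ` verts C'" using R.label_image R'.label_image SE by simp
  then have bl': "bij_betw R'.label (verts C') (R.label ` verts C)"
    using R'.inj_label by (simp add: bij_betw_def)
  define f where "f = inv_into (verts C') R'.label \<circ> R.label"
  define g where "g = inv_into (bedges C') S' \<circ> S"
  have bf: "bij_betw f (verts C) (verts C')"
    unfolding f_def by (rule bij_betw_trans[OF bl bij_betw_inv_into[OF bl']])
  have bg: "bij_betw g (bedges C) (bedges C')"
    unfolding g_def by (rule bij_betw_trans[OF bS bij_betw_inv_into[OF bS']])
  have fI: "f x = y" if "x \<in> verts C" "y \<in> verts C'" "R'.label y = R.label x" for x y
    unfolding f_def using that(3) inv_into_f_f[OF R'.inj_label that(2)] by simp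
  have gS: "S' (g e) = S e" if "e \<in> bedges C" for e
    unfolding g_def using that bij_betw_inv_into_right[OF bS', of "S e"] by simp
  have gE: "g e \<in> R'.E" if e: "e \<in> R.E" for e
  proof -
    have "g e \<in> bedges C'" using bg e bij_betwE by blast
    moreover have "S' (g e) \<noteq> S' e\<^sub>0'" using gS[of e] e R.side_neq_e0[OF e] R'.side_e0 by simp
    ultimately show ?thesis by auto
  qed
  have E: "ends C' (g e) = f ` ends C e" if e: "e \<in> bedges C" for e
  proof (cases "e = e\<^sub>0")
    case True
    have "S' (g e\<^sub>0) = S' e\<^sub>0'" using gS[OF R.e0_in] R.side_e0 R'.side_e0 by simp
    moreover have "g e\<^sub>0 \<in> bedges C'" using bg R.e0_in bij_betwE by blast
    ultimately have "g e\<^sub>0 = e\<^sub>0'" using inj_onD[OF R'.inj_side] R'.e0_in by simp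
    moreover have "f v\<^sub>0 = v\<^sub>0'"
      by (rule fI[OF R.v0_in R'.v0_in]) (simp add: R.label_root R'.label_root)
    moreover have "f u = u'"
      by (rule fI[OF R.u_in R'.u_in]) (use SE R.label_u R'.label_u in simp)
    ultimately show ?thesis using True R.ends0 R'.ends0 by simp
  next
    case False
    then have eE: "e \<in> R.E" using e by simp
    obtain p q where pq: "ends C e = {p, q}" "p \<in> verts C" "q \<in> verts C"
      "R.label q = {X \<in> S ` R.E. S e \<subseteq> X}" "R.label p = {X \<in> S ` R.E. S e \<subset> X}"
      by (rule R.label_endsE[OF eE, folded Sdef])
    obtain p' q' where pq': "ends C' (g e) = {p', q'}" "p' \<in> verts C'" "q' \<in> verts C'"
      "R'.label q' = {X \<in> S' ` R'.E. S' (g e) \<subseteq> X}" "R'.label p' = {X \<in> S' ` R'.E. S' (g e) \<subset> X}"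
      by (rule R'.label_endsE[OF gE[OF eE], folded S'def])
    have "f p = p'" "f q = q'"
      using fI[OF pq(2) pq'(2)] fI[OF pq(3) pq'(3)] pq(4,5) pq'(4,5) SE gS[OF e] by simp_all
    then show ?thesis using pq(1) pq'(1) by simp
  qed
  have L: "leaf C' i = f (leaf C i)" if i: "i \<in> {1..n}" for i
    using fI[OF R.leaf[OF i] R'.leaf[OF i]] R.label_leaf[OF i] R'.label_leaf[OF i] SE by simp
  show ?thesis using bf bg gS E L by (intro exI[of _ f] exI[of _ g]) simp
qed

section \<open>Moving the cut\<close>

context rooted_cut
begin

text \<open>Cutting \<open>e\<^sub>0\<close> next to its other end reverses the direction in
  which the cycle is traversed.\<close>

lemma reversal: "rooted_cut n C e\<^sub>0 u v\<^sub>0 (\<lambda>f x. W f x \<noteq> W f u)"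
proof
  show "crossing (delete_edge C e\<^sub>0) (\<lambda>x. W f x \<noteq> W f u) = {f}"
    if "f \<in> bedges C" "f \<noteq> e\<^sub>0" for f
    unfolding crossing_neq using W that by simp
  show "ends C e\<^sub>0 = {u, v\<^sub>0}" using ends0 by blast
qed (use fin conn leaf val e0 in auto)

lemma side_reversal:
  assumes "f \<in> E" "n + 2 \<in> side f"
  shows "rooted_cut.side n C e\<^sub>0 v\<^sub>0 (\<lambda>f x. W f x \<noteq> W f u) f = insert (n + 2) ({1..n} - side f)"
proof -
  interpret R: rooted_cut n C e\<^sub>0 u v\<^sub>0 "\<lambda>f x. W f x \<noteq> W f u" by (rule reversal)
  have "W f u" using assms in_side_B by blast
  then show ?thesis using assms(1) root unfolding R.side_def side_def by auto
qed

lemma side_reversal_cyc: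
  assumes "f \<in> bedges C"
  shows "n + 2 \<in> rooted_cut.side n C e\<^sub>0 v\<^sub>0 (\<lambda>f x. W f x \<noteq> W f u) f \<longleftrightarrow> n + 2 \<in> side f"
proof -
  interpret R: rooted_cut n C e\<^sub>0 u v\<^sub>0 "\<lambda>f x. W f x \<noteq> W f u" by (rule reversal)
  show ?thesis
  proof (cases "f = e\<^sub>0")
    case False
    then have "f \<in> E" using assms by simp
    then show ?thesis using R.in_side_B in_side_B root by blast
  next
    case True
    show ?thesis by (simp only: True R.side_e0 side_e0)
  qed
qed

text \<open>The other cycle edge at the root has the largest far side among the cycle edges, and cutting
  it instead of \<open>e\<^sub>0\<close> traverses the cycle in the opposite direction.\<close>

lemma flip:
  assumes "\<exists>f\<in>E. n + 2 \<in> side f"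
  obtains e\<^sub>1 u\<^sub>1 W\<^sub>1 where "rooted_cut n C e\<^sub>1 v\<^sub>0 u\<^sub>1 W\<^sub>1" "e\<^sub>1 \<in> E" "n + 2 \<in> side e\<^sub>1"
    "\<forall>f\<in>bedges C. n + 2 \<in> side f \<longrightarrow> side f \<subseteq> side e\<^sub>1"
    "\<forall>f\<in>bedges C. n + 2 \<in> rooted_cut.side n C e\<^sub>1 u\<^sub>1 W\<^sub>1 f \<longleftrightarrow> n + 2 \<in> side f"
    "\<forall>f\<in>bedges C. n + 2 \<in> side f \<longrightarrow>
       rooted_cut.side n C e\<^sub>1 u\<^sub>1 W\<^sub>1 f = insert (n + 2) (side e\<^sub>1 - side f)"
proof -
  let ?Z = "{f \<in> E. W f u}" and ?d = "\<lambda>f. card {y \<in> verts C. W f y}"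
  have "?Z \<noteq> {}" using assms in_side_B by blast
  then obtain e\<^sub>1 where "e\<^sub>1 \<in> ?Z" and e1max: "\<forall>f\<in>?Z. ?d f \<le> ?d e\<^sub>1"
    using finite_has_greatest[of ?Z ?d] finE by auto
  then have e1: "e\<^sub>1 \<in> E" "W e\<^sub>1 u" by simp_all
  have top: "\<forall>z\<in>verts C. W h z \<longrightarrow> W e\<^sub>1 z" if h: "h \<in> E" "W h u" for h
  proof (cases "\<forall>z\<in>verts C. W e\<^sub>1 z \<longrightarrow> W h z")
    case True
    then have "{z \<in> verts C. W e\<^sub>1 z} = {z \<in> verts C. W h z}"
      using e1max h fin_verts by (intro card_seteq) auto
    then show ?thesis by blast
  next
    case False
    then show ?thesis using laminar_W[OF e1(1) h(1) u_in e1(2) h(2)] by blast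
  qed
  obtain p q where pq: "p \<in> verts C" "q \<in> verts C" "ends C e\<^sub>1 = {p, q}" "\<not> W e\<^sub>1 p" "W e\<^sub>1 q"
    "\<And>g. g \<in> E \<Longrightarrow> g \<noteq> e\<^sub>1 \<Longrightarrow> W g p = W g q"
    by (rule endsE[OF e1(1)]) blast
  have "p = v\<^sub>0"
  proof (rule ccontr)
    assume "p \<noteq> v\<^sub>0"
    then obtain f where f: "f \<in> E" "W f p \<noteq> W f v\<^sub>0" by (rule separated[OF pq(1) v0_in])
    then have fp: "W f p" using root by simp
    have fe: "f \<noteq> e\<^sub>1" using fp pq(4) by blast
    have fq: "W f q" using pq(6)[OF f(1) fe] fp by simp
    show False
    proof (cases "W f u")
      case True
      then show False using top[OF f(1) True] pq(1,4) fp by blast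
    next
      case False
      show False by (rule four_values_T[OF f(1) e1(1) fe pq(2) fq pq(5) pq(1) fp pq(4) u_in False e1(2)])
    qed
  qed
  define W\<^sub>1 where "W\<^sub>1 h x \<longleftrightarrow> (if h = e\<^sub>0 then W e\<^sub>1 x else if W h u then W h x \<noteq> W e\<^sub>1 x else W h x)" for h x
  have W1: "W\<^sub>1 e\<^sub>0 = W e\<^sub>1" "\<And>h. h \<noteq> e\<^sub>0 \<Longrightarrow> W h u \<Longrightarrow> W\<^sub>1 h = (\<lambda>x. W h x \<noteq> W e\<^sub>1 x)"
    "\<And>h. h \<noteq> e\<^sub>0 \<Longrightarrow> \<not> W h u \<Longrightarrow> W\<^sub>1 h = W h"
    unfolding W\<^sub>1_def by (auto intro!: ext)
  have nb: "nonbridge C e\<^sub>1"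
    unfolding nonbridge_def
  proof (intro conjI notI)
    show "e\<^sub>1 \<in> bedges C" using e1 by simp
    assume "\<exists>\<phi>. crossing C \<phi> = {e\<^sub>1}"
    then obtain \<phi> where \<phi>: "crossing C \<phi> = {e\<^sub>1}" by blast
    then have "crossing T \<phi> = crossing T (W e\<^sub>1)"
      using W e1 by (auto simp: crossing_delete_edge)
    then have "(\<phi> v\<^sub>0 \<noteq> \<phi> u) = (W e\<^sub>1 v\<^sub>0 \<noteq> W e\<^sub>1 u)"
      by (rule cut_unique[OF finT connT]) (use v0_in u_in in simp_all)
    then have "\<phi> v\<^sub>0 \<noteq> \<phi> u" using root e1 by simp
    then have "e\<^sub>0 \<in> crossing C \<phi>" using in_crossing_iff[OF e0_in ends0] by blast
    then show False using \<phi> e1 by auto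
  qed
  have R1: "rooted_cut n C e\<^sub>1 v\<^sub>0 q W\<^sub>1"
  proof
    show "ends C e\<^sub>1 = {v\<^sub>0, q}" using pq(3) \<open>p = v\<^sub>0\<close> by simp
    fix f assume f: "f \<in> bedges C" "f \<noteq> e\<^sub>1"
    have ce1: "crossing C (W e\<^sub>1) = {e\<^sub>1, e\<^sub>0}" using crossing_W[OF e1(1)] e1(2) by simp
    show "crossing (delete_edge C e\<^sub>1) (W\<^sub>1 f) = {f}"
    proof (cases "f = e\<^sub>0")
      case True
      then show ?thesis using W1(1) ce1 f by (auto simp: crossing_delete_edge)
    next
      case False
      then have fE: "f \<in> E" using f by simp
      show ?thesis
      proof (cases "W f u")
        case True
        have "crossing C (W\<^sub>1 f) = {f, e\<^sub>1}"
          unfolding W1(2)[OF False True] crossing_xor[OF fin] ce1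
          using crossing_W[OF fE] True fE e1 f by auto
        then show ?thesis using f by (auto simp: crossing_delete_edge)
      next
        case nu: False
        then show ?thesis
          using W1(3)[OF False nu] crossing_W[OF fE] f by (auto simp: crossing_delete_edge)
      qed
    qed
    show "\<not> W\<^sub>1 f v\<^sub>0" using root f e1 by (auto simp: W\<^sub>1_def)
  qed (use fin conn leaf val nb in auto)
  interpret R1: rooted_cut n C e\<^sub>1 v\<^sub>0 q W\<^sub>1 by (rule R1)
  have cyc: "n + 2 \<in> R1.side f \<longleftrightarrow> n + 2 \<in> side f" if f: "f \<in> bedges C" for f
  proof -
    consider "f = e\<^sub>1" | "f = e\<^sub>0" | "f \<noteq> e\<^sub>1" "f \<noteq> e\<^sub>0" by blast
    then show ?thesis
    proof cases
      case 1
      then show ?thesis using R1.side_e0 e1 in_side_B by blast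
    next
      case 2
      then have "f \<in> bedges C - {e\<^sub>1}" using e1 e0_in by auto
      moreover have "W\<^sub>1 f q" using 2 W1(1) pq(5) by simp
      ultimately have "n + 2 \<in> R1.side f" using R1.in_side_B by blast
      then show ?thesis using 2 side_e0 by simp
    next
      case 3
      then have fE: "f \<in> E" "f \<in> bedges C - {e\<^sub>1}" using f by auto
      have "W f q = W f p" using pq(6)[OF fE(1) 3(1)] by simp
      then have "\<not> W f q" using \<open>p = v\<^sub>0\<close> root fE by simp
      then have "W\<^sub>1 f q \<longleftrightarrow> W f u" using 3 pq(5) by (auto simp: W\<^sub>1_def)
      then show ?thesis using R1.in_side_B[OF fE(2)] in_side_B[OF fE(1)] by blast
    qed
  qed
  have sides: "R1.side f = insert (n + 2) (side e\<^sub>1 - side f)"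
    if f: "f \<in> bedges C" "n + 2 \<in> side f" for f
  proof -
    have "i \<in> R1.side f \<longleftrightarrow> i \<in> side e\<^sub>1 - side f" if i: "i \<in> {1..n}" for i
    proof -
      have in2: "i \<noteq> n + 2" using i by auto
      have ie1: "i \<in> side e\<^sub>1 \<longleftrightarrow> W e\<^sub>1 (leaf C i)" by (rule in_side_leaf[OF e1(1) i])
      consider "f = e\<^sub>1" | "f = e\<^sub>0" | "f \<noteq> e\<^sub>1" "f \<noteq> e\<^sub>0" by blast
      then show ?thesis
      proof cases
        case 1
        then show ?thesis using R1.side_e0 in2 by simp
      next
        case 2
        then have "f \<in> bedges C - {e\<^sub>1}" using f e1 by auto
        then have "i \<in> R1.side f \<longleftrightarrow> W\<^sub>1 f (leaf C i)" using R1.in_side_leaf i by blast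
        then show ?thesis using 2 W1(1) ie1 side_e0 in2 by simp
      next
        case 3
        then have fE: "f \<in> E" "f \<in> bedges C - {e\<^sub>1}" using f by auto
        have Wu: "W f u" using f in_side_B[OF fE(1)] by blast
        have "i \<in> R1.side f \<longleftrightarrow> W f (leaf C i) \<noteq> W e\<^sub>1 (leaf C i)"
          using R1.in_side_leaf[OF fE(2) i] W1(2)[OF 3(2) Wu] by simp
        moreover have "W f (leaf C i) \<longrightarrow> W e\<^sub>1 (leaf C i)" using top[OF fE(1) Wu] leaf[OF i] by blast
        ultimately show ?thesis using ie1 in_side_leaf[OF fE(1) i] by blast
      qed
    qed
    moreover have "n + 2 \<in> R1.side f" using cyc f by blast
    ultimately show ?thesis using R1.side_subset[of f] side_subset[of e\<^sub>1] f(2) by blast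
  qed
  have sub: "side f \<subseteq> side e\<^sub>1" if f: "f \<in> bedges C" "n + 2 \<in> side f" for f
  proof (cases "f = e\<^sub>0")
    case True
    then show ?thesis using side_e0 e1 in_side_B by simp
  next
    case False
    then have fE: "f \<in> E" using f by simp
    then show ?thesis using top[OF fE] in_side_B[OF fE] f(2) side_subset_iff[OF fE e1(1)] by blast
  qed
  have "n + 2 \<in> side e\<^sub>1" using in_side_B[OF e1(1)] e1(2) by blast
  then show ?thesis using that[OF R1 e1(1)] sub cyc sides by simp
qed

end

text \<open>A flip followed by a reversal moves the cut past one edge of the cycle and keeps the
  direction. This is repeated until the path to \<open>i\<close> leaves the cycle at the root.\<close>

lemma cut_sides_normalized:
  assumes "cut_sides n C S" "i \<in> {1..n}"
  shows "\<exists>S'. cut_sides n C S' \<and> (\<forall>f\<in>bedges C. n + 2 \<in> S' f \<longrightarrow> i \<notin> S' f)"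
  using assms(1)
proof (induction "card {f \<in> bedges C. n + 2 \<in> S f \<and> i \<in> S f}" arbitrary: S rule: less_induct)
  case less
  have in2: "i \<noteq> n + 2" using assms(2) by auto
  obtain e\<^sub>0 v\<^sub>0 u W where R: "rooted_cut n C e\<^sub>0 v\<^sub>0 u W" and Sdef: "S = rooted_cut.side n C e\<^sub>0 u W"
    using less.prems by (rule cut_sidesE)
  interpret R: rooted_cut n C e\<^sub>0 v\<^sub>0 u W by fact
  show ?case
  proof (cases "\<exists>f\<in>bedges C. n + 2 \<in> S f \<and> i \<in> S f")
    case False
    then show ?thesis using less.prems by blast
  next
    case True
    then obtain f where f: "f \<in> bedges C" "n + 2 \<in> S f" "i \<in> S f" by blast
    have "f \<noteq> e\<^sub>0" using f(3) Sdef R.side_e0 in2 by auto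
    then have "\<exists>f\<in>R.E. n + 2 \<in> S f" using f by blast
    then obtain e\<^sub>1 u\<^sub>1 W\<^sub>1 where R1: "rooted_cut n C e\<^sub>1 v\<^sub>0 u\<^sub>1 W\<^sub>1"
      and e1: "e\<^sub>1 \<in> R.E" "n + 2 \<in> S e\<^sub>1" "\<forall>f\<in>bedges C. n + 2 \<in> S f \<longrightarrow> S f \<subseteq> S e\<^sub>1"
      and cyc: "\<forall>f\<in>bedges C. n + 2 \<in> rooted_cut.side n C e\<^sub>1 u\<^sub>1 W\<^sub>1 f \<longleftrightarrow> n + 2 \<in> S f"
      and sides: "\<forall>f\<in>bedges C. n + 2 \<in> S f \<longrightarrow>
        rooted_cut.side n C e\<^sub>1 u\<^sub>1 W\<^sub>1 f = insert (n + 2) (S e\<^sub>1 - S f)"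
      by (rule R.flip[folded Sdef])
    interpret R1: rooted_cut n C e\<^sub>1 v\<^sub>0 u\<^sub>1 W\<^sub>1 by fact
    let ?W2 = "\<lambda>f x. W\<^sub>1 f x \<noteq> W\<^sub>1 f u\<^sub>1"
    interpret R2: rooted_cut n C e\<^sub>1 u\<^sub>1 v\<^sub>0 ?W2 by (rule R1.reversal)
    define S2 where "S2 = R2.side"
    have S2: "cut_sides n C S2" unfolding S2_def by (rule cut_sidesI[OF R1.reversal])
    have ie1: "i \<in> S e\<^sub>1" using e1(3) f by blast
    have cyc2: "n + 2 \<in> S2 g \<longleftrightarrow> n + 2 \<in> S g" if "g \<in> bedges C" for g
      using R1.side_reversal_cyc[OF that] cyc that unfolding S2_def by blast
    have "i \<in> S g \<and> g \<noteq> e\<^sub>1" if g: "g \<in> bedges C" "n + 2 \<in> S g" "i \<in> S2 g" for g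
    proof -
      have ne: "g \<noteq> e\<^sub>1" using g(3) R2.side_e0 in2 unfolding S2_def by auto
      then have gE: "g \<in> bedges C - {e\<^sub>1}" using g by simp
      have "S2 g = insert (n + 2) ({1..n} - R1.side g)"
        unfolding S2_def by (rule R1.side_reversal[OF gE]) (use cyc g in blast)
      then show ?thesis using g(3) in2 bspec[OF sides g(1)] g(2) ie1 ne by auto
    qed
    then have "{f \<in> bedges C. n + 2 \<in> S2 f \<and> i \<in> S2 f} \<subseteq> {f \<in> bedges C. n + 2 \<in> S f \<and> i \<in> S f} - {e\<^sub>1}"
      using cyc2 by blast
    moreover have "e\<^sub>1 \<in> {f \<in> bedges C. n + 2 \<in> S f \<and> i \<in> S f}" using e1 ie1 by blast
    ultimately have "{f \<in> bedges C. n + 2 \<in> S2 f \<and> i \<in> S2 f} \<subset> {f \<in> bedges C. n + 2 \<in> S f \<and> i \<in> S f}"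
      by blast
    moreover have "finite {f \<in> bedges C. n + 2 \<in> S f \<and> i \<in> S f}" using R.fin by (simp add: fin_graph_def)
    ultimately show ?thesis using less.hyps[OF psubset_card_mono S2] by blast
  qed
qed

text \<open>The cycle is traversed in the opposite direction from the same root; \<open>F\<close>
  consists of the leaves whose path does not leave the cycle at the root.\<close>

lemma cut_sides_reversed:
  assumes S: "cut_sides n C S"
  shows "\<exists>S' F. cut_sides n C S' \<and> (\<forall>f\<in>bedges C. n + 2 \<in> S' f \<longleftrightarrow> n + 2 \<in> S f) \<and>
    (\<forall>f\<in>bedges C. n + 2 \<in> S f \<longrightarrow> S f - {n + 2} \<subseteq> F \<and> S' f - {n + 2} = F - S f)"
proof -
  obtain e\<^sub>0 v\<^sub>0 u W where R: "rooted_cut n C e\<^sub>0 v\<^sub>0 u W" and Sdef: "S = rooted_cut.side n C e\<^sub>0 u W"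
    using S by (rule cut_sidesE)
  interpret R: rooted_cut n C e\<^sub>0 v\<^sub>0 u W by fact
  show ?thesis
  proof (cases "\<exists>f\<in>R.E. n + 2 \<in> S f")
    case True
    then obtain e\<^sub>1 u\<^sub>1 W\<^sub>1 where R1: "rooted_cut n C e\<^sub>1 v\<^sub>0 u\<^sub>1 W\<^sub>1"
      and e1: "e\<^sub>1 \<in> R.E" "n + 2 \<in> S e\<^sub>1" "\<forall>f\<in>bedges C. n + 2 \<in> S f \<longrightarrow> S f \<subseteq> S e\<^sub>1"
      and cyc: "\<forall>f\<in>bedges C. n + 2 \<in> rooted_cut.side n C e\<^sub>1 u\<^sub>1 W\<^sub>1 f \<longleftrightarrow> n + 2 \<in> S f"
      and sides: "\<forall>f\<in>bedges C. n + 2 \<in> S f \<longrightarrow>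
        rooted_cut.side n C e\<^sub>1 u\<^sub>1 W\<^sub>1 f = insert (n + 2) (S e\<^sub>1 - S f)"
      by (rule R.flip[folded Sdef])
    let ?S' = "rooted_cut.side n C e\<^sub>1 u\<^sub>1 W\<^sub>1" and ?F = "S e\<^sub>1 - {n + 2}"
    have "?S' f - {n + 2} = ?F - S f" if "f \<in> bedges C" "n + 2 \<in> S f" for f
      using bspec[OF sides that(1)] that(2) by blast
    moreover have "S f - {n + 2} \<subseteq> ?F" if "f \<in> bedges C" "n + 2 \<in> S f" for f
      using e1(3) that by blast
    ultimately show ?thesis
      by (intro exI[of _ ?S'] exI[of _ ?F]) (use cut_sidesI[OF R1] cyc in blast)
  next
    case False
    have "f = e\<^sub>0" if "f \<in> bedges C" "n + 2 \<in> S f" for f using False that Sdef by blast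
    then have "S f = {n + 2}" if "f \<in> bedges C" "n + 2 \<in> S f" for f
      using that R.side_e0 Sdef by blast
    then show ?thesis using S by (intro exI[of _ S] exI[of _ "{}"]) auto
  qed
qed

section \<open>Coordinates on \<open>V\<^sub>n\<close>\<close>

text \<open>For the distances on a cut curve, \<open>cyc_len\<close> is the length
  \<open>L\<close> of the cycle, and \<open>pos\<close> the position on it of the point where the
  path to the leaf \<open>i\<close> leaves the cycle, measured from the middle of the path
  between the leaves \<open>n + 1\<close> and \<open>n + 2\<close>. In \<open>rdist\<close>, the
  distances of the leaves from the cycle cancel: it is the length \<open>a\<close> of the arc
  between the two points on the cycle, minus twice the length \<open>g\<close> of the common part
  of the paths from the cycle to \<open>i\<close> and \<open>j\<close>.\<close>

definition cyc_len :: "nat \<Rightarrow> vec \<Rightarrow> real" where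
  "cyc_len n x = x {n+1, n+2}"

definition pos :: "nat \<Rightarrow> vec \<Rightarrow> nat \<Rightarrow> real" where
  "pos n x i = (x {i, n+1} - x {i, n+2}) / 2"

definition rdist :: "nat \<Rightarrow> vec \<Rightarrow> nat \<Rightarrow> nat \<Rightarrow> real" where
  "rdist n x i j = x {i, j} - (x {i, n+1} + x {i, n+2} + x {j, n+1} + x {j, n+2}) / 2 + cyc_len n x"

text \<open>In the situation above this is \<open>a (L - a) - 2 L g\<close>, which does not
  depend on which of the two arcs is taken. Divided by \<open>L\<close>, its first part is the
  effective resistance between two points of a circle.\<close>

definition cinv :: "nat \<Rightarrow> vec \<Rightarrow> nat \<Rightarrow> nat \<Rightarrow> real" where
  "cinv n x i j = cyc_len n x * rdist n x i j - (pos n x i - pos n x j)\<^sup>2"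

text \<open>The pair \<open>(0, 0)\<close> stands for the invariant \<open>cyc_len\<close>.\<close>

definition index :: "nat \<Rightarrow> (nat \<times> nat) set" where
  "index n = insert (0, 0) {(i, j). i \<in> {1..n} \<and> j \<in> {1..n} \<and> i \<noteq> j}"

definition invs :: "nat \<Rightarrow> vec \<Rightarrow> nat \<times> nat \<Rightarrow> real" where
  "invs n x = (\<lambda>k\<in>index n. if k = (0, 0) then cyc_len n x else cinv n x (fst k) (snd k))"

lemma invs_eq_iff:
  "invs n x = invs n y \<longleftrightarrow> cyc_len n x = cyc_len n y \<and>
     (\<forall>i\<in>{1..n}. \<forall>j\<in>{1..n}. i \<noteq> j \<longrightarrow> cinv n x i j = cinv n y i j)"
proof
  assume eq: "invs n x = invs n y"
  have "cyc_len n x = cyc_len n y" using fun_cong[OF eq, of "(0, 0)"] by (simp add: invs_def index_def)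
  moreover have "cinv n x i j = cinv n y i j" if "i \<in> {1..n}" "j \<in> {1..n}" "i \<noteq> j" for i j
    using fun_cong[OF eq, of "(i, j)"] that by (auto simp: invs_def index_def)
  ultimately show "cyc_len n x = cyc_len n y \<and>
     (\<forall>i\<in>{1..n}. \<forall>j\<in>{1..n}. i \<noteq> j \<longrightarrow> cinv n x i j = cinv n y i j)" by blast
next
  assume *: "cyc_len n x = cyc_len n y \<and>
     (\<forall>i\<in>{1..n}. \<forall>j\<in>{1..n}. i \<noteq> j \<longrightarrow> cinv n x i j = cinv n y i j)"
  show "invs n x = invs n y"
    unfolding invs_def by (rule restrict_ext) (use * in \<open>auto simp: index_def\<close>)
qed

lemma pair_in_pairs: "{i, j} \<in> pairs n \<longleftrightarrow> i \<noteq> j \<and> i \<in> {1..n+2} \<and> j \<in> {1..n+2}"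
  by (cases "i = j") (auto simp: pairs_def)

lemma pairs_cases:
  assumes "t \<in> pairs n"
  obtains "t = {n+1, n+2}" | i where "i \<in> {1..n}" "t = {i, n+1}" | i where "i \<in> {1..n}" "t = {i, n+2}"
    | i j where "i \<in> {1..n}" "j \<in> {1..n}" "i \<noteq> j" "t = {i, j}"
proof -
  obtain i j where t: "t = {i, j}" "i \<noteq> j" "i \<in> {1..n+2}" "j \<in> {1..n+2}"
    using assms by (auto simp: pairs_def card_2_iff)
  have k: "k \<in> {1..n} \<or> k = n+1 \<or> k = n+2" if "k \<in> {1..n+2}" for k using that by auto
  have t': "t = {j, i}" using t(1) by blast
  show ?thesis
  proof (cases "i \<in> {1..n}")
    case True
    show ?thesis
    proof (cases "j \<in> {1..n}")
      case False
      then have "j = n+1 \<or> j = n+2" using k[OF t(4)] by blast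
      then show ?thesis using that(2,3) True t(1) by blast
    qed (use that(4) True t(1,2) in blast)
  next
    case False
    then have i: "i = n+1 \<or> i = n+2" using k[OF t(3)] by blast
    show ?thesis
    proof (cases "j \<in> {1..n}")
      case True
      then show ?thesis using that(2,3) i t' by blast
    next
      case False
      then have "j = n+1 \<or> j = n+2" using k[OF t(4)] by blast
      then have "t = {n+1, n+2}" using i t(1,2) t' by blast
      then show ?thesis by (rule that(1))
    qed
  qed
qed

lemma Phi_values:
  assumes "i \<in> {1..n}"
  shows "Phi n b {i, n+1} = b i" "Phi n b {i, n+2} = b i"
  using assms by (auto simp: Phi_def pair_in_pairs)

lemma Phi_AB: "Phi n b {n+1, n+2} = 0"
  by (simp add: Phi_def pair_in_pairs)

lemma Phi_pair: "i \<in> {1..n} \<Longrightarrow> j \<in> {1..n} \<Longrightarrow> i \<noteq> j \<Longrightarrow> Phi n b {i, j} = b i + b j"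
  by (simp add: Phi_def pair_in_pairs)

lemma svec_values:
  assumes "i \<in> {1..n}"
  shows "svec n {i, n+1} = 1" "svec n {i, n+2} = -1"
  using assms by (auto simp: svec_def pair_in_pairs doubleton_eq_iff)

lemma svec_AB: "svec n {n+1, n+2} = 0"
  by (auto simp: svec_def pair_in_pairs doubleton_eq_iff)

lemma svec_pair: "i \<in> {1..n} \<Longrightarrow> j \<in> {1..n} \<Longrightarrow> i \<noteq> j \<Longrightarrow> svec n {i, j} = 0"
  by (auto simp: svec_def pair_in_pairs doubleton_eq_iff)

text \<open>The three kinds of coordinates are unchanged by \<open>Phi\<close>, whereas
  \<open>svec\<close> shifts all positions; together with \<open>x {i, n+1} + x {i, n+2}\<close>,
  which \<open>Phi\<close> makes arbitrary, they determine \<open>x\<close>.\<close>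

lemma Vclass_iff:
  "y \<in> Vclass n x \<longleftrightarrow> y \<in> Rpairs n \<and> cyc_len n y = cyc_len n x \<and>
     (\<exists>r. \<forall>i\<in>{1..n}. pos n y i = pos n x i + r) \<and>
     (\<forall>i\<in>{1..n}. \<forall>j\<in>{1..n}. i \<noteq> j \<longrightarrow> rdist n y i j = rdist n x i j)"
    (is "?L \<longleftrightarrow> ?R")
proof
  assume ?L
  then obtain b r where y: "y \<in> Rpairs n"
    and b: "\<And>t. t \<in> pairs n \<Longrightarrow> y t = x t + Phi n b t + r * svec n t" by (auto simp: Vclass_def)
  have AB: "y {n+1, n+2} = x {n+1, n+2}"
    using b[of "{n+1, n+2}"] Phi_AB svec_AB by (simp add: pair_in_pairs)
  have iA: "y {i, n+1} = x {i, n+1} + b i + r" if "i \<in> {1..n}" for i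
    using b[of "{i, n+1}"] Phi_values(1)[OF that] svec_values(1)[OF that] that by (simp add: pair_in_pairs)
  have iB: "y {i, n+2} = x {i, n+2} + b i - r" if "i \<in> {1..n}" for i
    using b[of "{i, n+2}"] Phi_values(2)[OF that] svec_values(2)[OF that] that by (simp add: pair_in_pairs)
  have ij: "y {i, j} = x {i, j} + b i + b j" if "i \<in> {1..n}" "j \<in> {1..n}" "i \<noteq> j" for i j
    using b[of "{i, j}"] Phi_pair[OF that] svec_pair[OF that] that by (simp add: pair_in_pairs)
  have "cyc_len n y = cyc_len n x" using AB by (simp add: cyc_len_def)
  moreover have "pos n y i = pos n x i + r" if "i \<in> {1..n}" for i
    unfolding pos_def iA[OF that] iB[OF that] by (simp add: field_simps)
  moreover have "rdist n y i j = rdist n x i j" if "i \<in> {1..n}" "j \<in> {1..n}" "i \<noteq> j" for i j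
    unfolding rdist_def cyc_len_def iA[OF that(1)] iB[OF that(1)] iA[OF that(2)] iB[OF that(2)]
      ij[OF that] AB by (simp add: field_simps)
  ultimately show ?R using y by blast
next
  assume R: ?R
  then obtain r where r: "\<And>i. i \<in> {1..n} \<Longrightarrow> pos n y i = pos n x i + r" by blast
  define b where "b i = (y {i, n+1} + y {i, n+2} - x {i, n+1} - x {i, n+2}) / 2" for i
  have "y t = x t + Phi n b t + r * svec n t" if "t \<in> pairs n" for t
    using that
  proof (cases rule: pairs_cases)
    case 1
    have "y t = x t" unfolding 1 using R by (simp add: cyc_len_def)
    moreover have "Phi n b t = 0" "svec n t = 0" unfolding 1 by (fact Phi_AB, fact svec_AB)
    ultimately show ?thesis by simp
  next
    case (2 i)
    have "y {i, n+1} = x {i, n+1} + b i + r"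
      using r[OF 2(1)] by (simp add: pos_def b_def field_simps)
    then show ?thesis unfolding 2(2) Phi_values(1)[OF 2(1)] svec_values(1)[OF 2(1)] by simp
  next
    case (3 i)
    have "y {i, n+2} = x {i, n+2} + b i - r"
      using r[OF 3(1)] by (simp add: pos_def b_def field_simps)
    then show ?thesis unfolding 3(2) Phi_values(2)[OF 3(1)] svec_values(2)[OF 3(1)] by simp
  next
    case (4 i j)
    have "rdist n y i j = rdist n x i j" using R 4 by blast
    then have "y {i, j} = x {i, j} + b i + b j"
      using R by (simp add: rdist_def b_def field_simps)
    then show ?thesis unfolding 4(4) Phi_pair[OF 4(1-3)] svec_pair[OF 4(1-3)] by simp
  qed
  then show ?L using R unfolding Vclass_def by blast
qed

lemma Vclass_self: "x \<in> Rpairs n \<Longrightarrow> x \<in> Vclass n x"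
  by (auto simp: Vclass_iff intro: exI[of _ 0])

lemma Vclass_eq:
  assumes "y \<in> Vclass n x"
  shows "Vclass n y = Vclass n x"
proof -
  obtain r where r: "\<And>i. i \<in> {1..n} \<Longrightarrow> pos n y i = pos n x i + r" and
    y: "cyc_len n y = cyc_len n x" "\<And>i j. i \<in> {1..n} \<Longrightarrow> j \<in> {1..n} \<Longrightarrow> i \<noteq> j \<Longrightarrow> rdist n y i j = rdist n x i j"
    using assms unfolding Vclass_iff by blast
  have "(\<exists>s. \<forall>i\<in>{1..n}. pos n z i = pos n y i + s) \<longleftrightarrow> (\<exists>s. \<forall>i\<in>{1..n}. pos n z i = pos n x i + s)" for z
  proof
    assume "\<exists>s. \<forall>i\<in>{1..n}. pos n z i = pos n y i + s"
    then obtain s where "\<forall>i\<in>{1..n}. pos n z i = pos n y i + s" by blast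
    then have "\<forall>i\<in>{1..n}. pos n z i = pos n x i + (r + s)" using r by simp
    then show "\<exists>s. \<forall>i\<in>{1..n}. pos n z i = pos n x i + s" by blast
  next
    assume "\<exists>s. \<forall>i\<in>{1..n}. pos n z i = pos n x i + s"
    then obtain s where "\<forall>i\<in>{1..n}. pos n z i = pos n x i + s" by blast
    then have "\<forall>i\<in>{1..n}. pos n z i = pos n y i + (s - r)" using r by simp
    then show "\<exists>s. \<forall>i\<in>{1..n}. pos n z i = pos n y i + s" by blast
  qed
  then show ?thesis unfolding set_eq_iff Vclass_iff using y by simp
qed

lemma Vn_memE:
  assumes "K \<in> Vn n" "x \<in> K"
  shows "K = Vclass n x" "x \<in> Rpairs n"
proof -
  obtain y where "K = Vclass n y" using assms(1) by (auto simp: Vn_def)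
  then show "K = Vclass n x" using Vclass_eq assms(2) by blast
  show "x \<in> Rpairs n" using assms(2) \<open>K = Vclass n y\<close> by (simp add: Vclass_def)
qed

lemma invs_Vclass: "y \<in> Vclass n x \<Longrightarrow> invs n y = invs n x"
  unfolding Vclass_iff invs_eq_iff cinv_def by auto

section \<open>The group \<open>G\<^sub>n\<close>\<close>

lemma Imap_in: "Imap n x \<in> Rpairs n"
  by (simp add: Imap_def Rpairs_def)

lemma Mmap_in: "Mmap n p x \<in> Rpairs n"
  by (simp add: Mmap_def Rpairs_def)

lemma Imap_AB: "Imap n x {n+1, n+2} = x {n+1, n+2}"
  by (simp add: Imap_def pair_in_pairs insert_commute)

lemma Imap_values:
  assumes "i \<in> {1..n}"
  shows "Imap n x {i, n+1} = x {i, n+2}" "Imap n x {i, n+2} = x {i, n+1}"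
  using assms by (auto simp: Imap_def pair_in_pairs)

lemma Imap_pair: "i \<in> {1..n} \<Longrightarrow> j \<in> {1..n} \<Longrightarrow> i \<noteq> j \<Longrightarrow> Imap n x {i, j} = x {i, j}"
  by (auto simp: Imap_def pair_in_pairs)

lemmas Imap_simps = Imap_AB[simplified] Imap_values[simplified] Imap_pair[simplified]

text \<open>\<open>I\<close> reverses the direction of the cycle.\<close>

lemma Imap_coords:
  "cyc_len n (Imap n x) = cyc_len n x"
  "i \<in> {1..n} \<Longrightarrow> pos n (Imap n x) i = - pos n x i"
  "i \<in> {1..n} \<Longrightarrow> j \<in> {1..n} \<Longrightarrow> i \<noteq> j \<Longrightarrow> rdist n (Imap n x) i j = rdist n x i j"
  unfolding cyc_len_def pos_def rdist_def by (simp_all add: Imap_simps field_simps)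

lemma Mmap_AB: "p \<in> {1..n} \<Longrightarrow> Mmap n p x {n+1, n+2} = x {n+1, n+2}"
  by (auto simp: Mmap_def pair_in_pairs doubleton_eq_iff Let_def)

lemma Mmap_values:
  assumes "p \<in> {1..n}" "i \<in> {1..n}"
  shows "Mmap n p x {i, n+1} = x {i, n+1} - (if i = p then x {n+1, n+2} else 0)"
    "Mmap n p x {i, n+2} = x {i, n+2} + (if i = p then x {n+1, n+2} else 0)"
  using assms by (auto simp: Mmap_def pair_in_pairs doubleton_eq_iff Let_def)

lemma Mmap_moved_pair:
  assumes "p \<in> {1..n}" "k \<in> {1..n}" "k \<noteq> p"
  shows "Mmap n p x {p, k} = x {p, k} + x {k, n+1} + x {p, n+2} + x {n+1, n+2} - x {k, n+2} - x {p, n+1}"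
proof -
  have "{p, k} - {p} = {k}" using assms by auto
  then show ?thesis using assms by (auto simp: Mmap_def pair_in_pairs doubleton_eq_iff Let_def)
qed

lemma Mmap_pair:
  assumes "p \<in> {1..n}" "i \<in> {1..n}" "j \<in> {1..n}" "i \<noteq> j"
  shows "Mmap n p x {i, j} = x {i, j} +
    (if i = p then x {j, n+1} + x {p, n+2} + x {n+1, n+2} - x {j, n+2} - x {p, n+1}
     else if j = p then x {i, n+1} + x {p, n+2} + x {n+1, n+2} - x {i, n+2} - x {p, n+1}
     else 0)"
proof -
  consider "i = p" | "j = p" "i \<noteq> p" | "i \<noteq> p" "j \<noteq> p" by blast
  then show ?thesis
  proof cases
    case 1
    then show ?thesis using Mmap_moved_pair[OF assms(1,3)] assms(4) by simp
  next
    case 2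
    have "{i, j} = {p, i}" using 2 by blast
    then show ?thesis using Mmap_moved_pair[OF assms(1,2) 2(2)] 2 by simp
  next
    case 3
    then show ?thesis using assms by (auto simp: Mmap_def pair_in_pairs doubleton_eq_iff Let_def)
  qed
qed

lemmas Mmap_simps = Mmap_AB[simplified] Mmap_values[simplified] Mmap_pair[simplified]

text \<open>\<open>M\<^sub>p\<close> moves the position of the leaf \<open>p\<close> once around
  the cycle.\<close>

lemma Mmap_coords:
  assumes p: "p \<in> {1..n}"
  shows "cyc_len n (Mmap n p x) = cyc_len n x"
  "i \<in> {1..n} \<Longrightarrow> pos n (Mmap n p x) i = pos n x i - (if i = p then cyc_len n x else 0)"
  "i \<in> {1..n} \<Longrightarrow> j \<in> {1..n} \<Longrightarrow> i \<noteq> j \<Longrightarrow> rdist n (Mmap n p x) i j = rdist n x i j +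
     (if i = p then 2 * pos n x j - 2 * pos n x p + cyc_len n x
      else if j = p then 2 * pos n x i - 2 * pos n x p + cyc_len n x else 0)"
  unfolding cyc_len_def pos_def rdist_def
  using p by (simp_all add: Mmap_simps field_simps)

lemma invs_Imap: "invs n (Imap n x) = invs n x"
  unfolding invs_eq_iff cinv_def by (auto simp: Imap_coords power2_commute)

lemma invs_Mmap: "p \<in> {1..n} \<Longrightarrow> invs n (Mmap n p x) = invs n x"
  unfolding invs_eq_iff cinv_def
  by (auto simp: Mmap_coords algebra_simps power2_eq_square)

text \<open>Conjugation with the reversal of the cycle inverts \<open>M\<^sub>p\<close>.\<close>

definition Nmap :: "nat \<Rightarrow> nat \<Rightarrow> vec \<Rightarrow> vec" where
  "Nmap n p x = Imap n (Mmap n p (Imap n x))"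

lemma Rpairs_eqI:
  assumes "x \<in> Rpairs n" "y \<in> Rpairs n" "\<And>t. t \<in> pairs n \<Longrightarrow> x t = y t"
  shows "x = y"
  using assms unfolding Rpairs_def by (meson PiE_ext)

lemma Imap_Imap:
  assumes "x \<in> Rpairs n" shows "Imap n (Imap n x) = x"
proof (rule Rpairs_eqI[OF Imap_in assms])
  fix t assume "t \<in> pairs n"
  then show "Imap n (Imap n x) t = x t"
    by (cases rule: pairs_cases) (simp_all add: Imap_simps)
qed

lemma Nmap_Mmap:
  assumes "x \<in> Rpairs n" "p \<in> {1..n}"
  shows "Nmap n p (Mmap n p x) = x" "Mmap n p (Nmap n p x) = x"
proof -
  show "Nmap n p (Mmap n p x) = x"
    unfolding Nmap_def
  proof (rule Rpairs_eqI[OF Imap_in assms(1)])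
    fix t assume "t \<in> pairs n"
    then show "Imap n (Mmap n p (Imap n (Mmap n p x))) t = x t"
      by (cases rule: pairs_cases) (use assms(2) in \<open>auto simp: Imap_simps Mmap_simps\<close>)
  qed
  show "Mmap n p (Nmap n p x) = x"
    unfolding Nmap_def
  proof (rule Rpairs_eqI[OF Mmap_in assms(1)])
    fix t assume "t \<in> pairs n"
    then show "Mmap n p (Imap n (Mmap n p (Imap n x))) t = x t"
      by (cases rule: pairs_cases) (use assms(2) in \<open>auto simp: Imap_simps Mmap_simps\<close>)
  qed
qed

lemma Imap_cong: "y \<in> Vclass n x \<Longrightarrow> Imap n y \<in> Vclass n (Imap n x)"
  unfolding Vclass_iff
proof (elim conjE exE, intro conjI)
  fix r assume "\<forall>i\<in>{1..n}. pos n y i = pos n x i + r"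
  then show "\<exists>r. \<forall>i\<in>{1..n}. pos n (Imap n y) i = pos n (Imap n x) i + r"
    by (intro exI[of _ "- r"]) (simp add: Imap_coords)
qed (simp_all add: Imap_coords Imap_in)

lemma Mmap_cong:
  assumes p: "p \<in> {1..n}"
  shows "y \<in> Vclass n x \<Longrightarrow> Mmap n p y \<in> Vclass n (Mmap n p x)"
  unfolding Vclass_iff
proof (elim conjE exE, intro conjI)
  fix r assume "\<forall>i\<in>{1..n}. pos n y i = pos n x i + r" "cyc_len n y = cyc_len n x"
    "\<forall>i\<in>{1..n}. \<forall>j\<in>{1..n}. i \<noteq> j \<longrightarrow> rdist n y i j = rdist n x i j"
  then show "\<exists>r. \<forall>i\<in>{1..n}. pos n (Mmap n p y) i = pos n (Mmap n p x) i + r"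
    "\<forall>i\<in>{1..n}. \<forall>j\<in>{1..n}. i \<noteq> j \<longrightarrow> rdist n (Mmap n p y) i j = rdist n (Mmap n p x) i j"
    "cyc_len n (Mmap n p y) = cyc_len n (Mmap n p x)"
    using p by (auto simp: Mmap_coords[OF p] intro!: exI[of _ r])
qed (simp_all add: Mmap_in)

lemma Imap_image:
  assumes x: "x \<in> Rpairs n"
  shows "Imap n ` Vclass n x = Vclass n (Imap n x)"
proof
  show "Imap n ` Vclass n x \<subseteq> Vclass n (Imap n x)" using Imap_cong by blast
  show "Vclass n (Imap n x) \<subseteq> Imap n ` Vclass n x"
  proof
    fix z assume z: "z \<in> Vclass n (Imap n x)"
    then have "Imap n z \<in> Vclass n x" using Imap_cong[OF z] Imap_Imap[OF x] by simp
    moreover have "z = Imap n (Imap n z)" using z Imap_Imap by (simp add: Vclass_def)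
    ultimately show "z \<in> Imap n ` Vclass n x" by blast
  qed
qed

lemma Nmap_cong: "p \<in> {1..n} \<Longrightarrow> y \<in> Vclass n x \<Longrightarrow> Nmap n p y \<in> Vclass n (Nmap n p x)"
  unfolding Nmap_def by (intro Imap_cong Mmap_cong)

lemma Mmap_image:
  assumes p: "p \<in> {1..n}" and x: "x \<in> Rpairs n"
  shows "Mmap n p ` Vclass n x = Vclass n (Mmap n p x)"
proof
  show "Mmap n p ` Vclass n x \<subseteq> Vclass n (Mmap n p x)" using Mmap_cong[OF p] by blast
  show "Vclass n (Mmap n p x) \<subseteq> Mmap n p ` Vclass n x"
  proof
    fix z assume z: "z \<in> Vclass n (Mmap n p x)"
    then have "Nmap n p z \<in> Vclass n x" using Nmap_cong[OF p z] Nmap_Mmap[OF x p] by simp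
    moreover have "z = Mmap n p (Nmap n p z)" using z Nmap_Mmap(2)[OF _ p] by (simp add: Vclass_def)
    ultimately show "z \<in> Mmap n p ` Vclass n x" by blast
  qed
qed

lemma Vclass_in: "x \<in> Rpairs n \<Longrightarrow> Vclass n x \<in> Vn n"
  by (simp add: Vn_def)

lemma Vn_repr:
  assumes "K \<in> Vn n" obtains x where "x \<in> Rpairs n" "K = Vclass n x"
  using assms by (auto simp: Vn_def)

lemma Nmap_in: "Nmap n p x \<in> Rpairs n"
  by (simp add: Nmap_def Imap_in)

definition gens :: "nat \<Rightarrow> (vec set \<Rightarrow> vec set) set" where
  "gens n = insert (\<lambda>K\<in>Vn n. Imap n ` K) ((\<lambda>p. \<lambda>K\<in>Vn n. Mmap n p ` K) ` {1..n})"

lemma Imap_Bij: "(\<lambda>K\<in>Vn n. Imap n ` K) \<in> Bij (Vn n)"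
proof -
  have "bij_betw (\<lambda>K. Imap n ` K) (Vn n) (Vn n)"
  proof (rule bij_betw_byWitness[where f' = "\<lambda>K. Imap n ` K"])
    have *: "Imap n ` K \<in> Vn n \<and> Imap n ` Imap n ` K = K" if "K \<in> Vn n" for K
    proof -
      from that obtain x where x: "x \<in> Rpairs n" "K = Vclass n x" by (rule Vn_repr)
      then show ?thesis
        using Imap_image[OF x(1)] Imap_image[OF Imap_in] Imap_Imap[OF x(1)] Vclass_in[OF Imap_in] by simp
    qed
    show "\<forall>K\<in>Vn n. Imap n ` Imap n ` K = K" "(`) (Imap n) ` Vn n \<subseteq> Vn n" using * by blast+
    show "\<forall>K\<in>Vn n. Imap n ` Imap n ` K = K" "(`) (Imap n) ` Vn n \<subseteq> Vn n" using * by blast+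
  qed
  then show ?thesis by (simp add: Bij_def bij_betw_def inj_on_def)
qed

lemma Mmap_Bij:
  assumes p: "p \<in> {1..n}"
  shows "(\<lambda>K\<in>Vn n. Mmap n p ` K) \<in> Bij (Vn n)"
proof -
  have M: "Mmap n p ` K \<in> Vn n \<and> Nmap n p ` Mmap n p ` K = K" if "K \<in> Vn n" for K
  proof -
    from that obtain x where x: "x \<in> Rpairs n" "K = Vclass n x" by (rule Vn_repr)
    have "Nmap n p ` Mmap n p ` K = (\<lambda>x. x) ` K"
      unfolding image_image using Nmap_Mmap(1)[OF _ p] x(2) by (intro image_cong) (auto simp: Vclass_def)
    then show ?thesis using Mmap_image[OF p x(1)] x(2) Vclass_in[OF Mmap_in] by simp
  qed
  have N: "Nmap n p ` K \<in> Vn n \<and> Mmap n p ` Nmap n p ` K = K" if "K \<in> Vn n" for K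
  proof -
    from that obtain x where x: "x \<in> Rpairs n" "K = Vclass n x" by (rule Vn_repr)
    have "Mmap n p ` Nmap n p ` K = (\<lambda>x. x) ` K"
      unfolding image_image using Nmap_Mmap(2)[OF _ p] x(2) by (intro image_cong) (auto simp: Vclass_def)
    moreover have "Nmap n p ` K = Vclass n (Nmap n p x)"
    proof -
      have "Nmap n p ` K = Imap n ` Mmap n p ` Imap n ` K" by (simp add: Nmap_def image_image)
      then show ?thesis
        using x Imap_image[OF x(1)] Mmap_image[OF p Imap_in] Imap_image[OF Mmap_in] by (simp add: Nmap_def)
    qed
    ultimately show ?thesis using Vclass_in[OF Nmap_in] by simp
  qed
  have "bij_betw (\<lambda>K. Mmap n p ` K) (Vn n) (Vn n)"
    by (rule bij_betw_byWitness[where f' = "\<lambda>K. Nmap n p ` K"]) (use M N in blast)+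
  then show ?thesis by (simp add: Bij_def bij_betw_def inj_on_def)
qed

lemma gens_Bij: "gens n \<subseteq> Bij (Vn n)"
  unfolding gens_def using Imap_Bij Mmap_Bij by blast

abbreviation Hn :: "nat \<Rightarrow> (vec set \<Rightarrow> vec set) set" where
  "Hn n \<equiv> generate (BijGroup (Vn n)) (gens n)"

lemma Gn_carrier: "carrier (Gn n) = Hn n"
  by (simp add: Gn_def gens_def)

lemma carrier_BijGroup: "carrier (BijGroup S) = Bij S"
  by (simp add: BijGroup_def)

lemma Hn_subgroup: "subgroup (Hn n) (BijGroup (Vn n))"
  by (rule group.generate_is_subgroup[OF group_BijGroup]) (simp add: carrier_BijGroup gens_Bij)

lemma Hn_Bij: "g \<in> Hn n \<Longrightarrow> g \<in> Bij (Vn n)"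
  using subgroup.subset[OF Hn_subgroup[of n]] carrier_BijGroup by blast

lemma Bij_apply: "g \<in> Bij S \<Longrightarrow> x \<in> S \<Longrightarrow> g x \<in> S"
  by (auto simp: Bij_def bij_betw_def)

lemma in_Psi_iff: "X \<in> Psi n K \<longleftrightarrow> (\<exists>g\<in>Hn n. X = g K)"
  unfolding Psi_def orbit_def Gn_carrier by blast

lemma Bij_mult_apply:
  assumes "g \<in> Bij S" "h \<in> Bij S" "x \<in> S"
  shows "(g \<otimes>\<^bsub>BijGroup S\<^esub> h) x = g (h x)"
  using assms by (simp add: BijGroup_def compose_def)

lemma Psi_self:
  assumes "K \<in> Vn n" shows "K \<in> Psi n K"
  unfolding in_Psi_iff
proof
  show "\<one>\<^bsub>BijGroup (Vn n)\<^esub> \<in> Hn n" by (rule generate.one)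
  show "K = \<one>\<^bsub>BijGroup (Vn n)\<^esub> K" using assms by (simp add: BijGroup_def)
qed

lemma Psi_apply:
  assumes h: "h \<in> Hn n" and K: "K \<in> Vn n"
  shows "Psi n (h K) = Psi n K"
proof -
  let ?G = "BijGroup (Vn n)"
  interpret G: group ?G by (rule group_BijGroup)
  note sub = Hn_subgroup[of n]
  have hB: "h \<in> Bij (Vn n)" by (rule Hn_Bij[OF h])
  have hG: "h \<in> carrier ?G" using hB by (simp add: carrier_BijGroup)
  have "X \<in> Psi n K" if X: "X \<in> Psi n (h K)" for X
  proof -
    obtain g where g: "g \<in> Hn n" "X = g (h K)" using X unfolding in_Psi_iff by (elim bexE)
    have "X = (g \<otimes>\<^bsub>?G\<^esub> h) K" using Bij_mult_apply[OF Hn_Bij[OF g(1)] hB K] g(2) by simp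
    then show ?thesis unfolding in_Psi_iff by (rule bexI[OF _ subgroup.m_closed[OF sub g(1) h]])
  qed
  moreover have "X \<in> Psi n (h K)" if X: "X \<in> Psi n K" for X
  proof -
    obtain g where g: "g \<in> Hn n" "X = g K" using X unfolding in_Psi_iff by (elim bexE)
    define k where "k = g \<otimes>\<^bsub>?G\<^esub> inv\<^bsub>?G\<^esub> h"
    have k: "k \<in> Hn n"
      unfolding k_def by (rule subgroup.m_closed[OF sub g(1) subgroup.m_inv_closed[OF sub h]])
    have "g \<in> carrier ?G" using Hn_Bij[OF g(1)] by (simp add: carrier_BijGroup)
    then have "k \<otimes>\<^bsub>?G\<^esub> h = g" using hG unfolding k_def by (simp add: G.m_assoc)
    then have "X = k (h K)" using Bij_mult_apply[OF Hn_Bij[OF k] hB K] g(2) by simp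
    then show ?thesis unfolding in_Psi_iff by (rule bexI[OF _ k])
  qed
  ultimately show ?thesis by (intro equalityI subsetI)
qed

lemma gens_invs:
  assumes "h \<in> gens n" "K \<in> Vn n" "y \<in> h K"
  obtains z where "z \<in> K" "invs n y = invs n z"
proof -
  consider "h = (\<lambda>K\<in>Vn n. Imap n ` K)" | p where "p \<in> {1..n}" "h = (\<lambda>K\<in>Vn n. Mmap n p ` K)"
    using assms(1) unfolding gens_def by blast
  then show ?thesis
  proof cases
    case 1
    then obtain z where "z \<in> K" "y = Imap n z" using assms(2,3) by auto
    then show ?thesis using that invs_Imap by blast
  next
    case 2
    then obtain z where "z \<in> K" "y = Mmap n p z" using assms(2,3) by auto
    then show ?thesis using that invs_Mmap[OF 2(1)] by blast
  qed
qed

lemma invs_class: "K \<in> Vn n \<Longrightarrow> x \<in> K \<Longrightarrow> y \<in> K \<Longrightarrow> invs n y = invs n x"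
  using Vn_memE(1) invs_Vclass by blast

lemma invs_Hn:
  assumes "g \<in> Hn n" "K \<in> Vn n" "x \<in> K" "y \<in> g K"
  shows "invs n y = invs n x"
  using assms
proof (induction arbitrary: K x y rule: generate.induct)
  case one
  then have "y \<in> K" by (simp add: BijGroup_def)
  then show ?case using invs_class one.prems(1,2) by blast
next
  case (incl h)
  obtain z where "z \<in> K" "invs n y = invs n z"
    using incl.hyps incl.prems(1,3) by (rule gens_invs)
  then show ?case using invs_class[OF incl.prems(1,2)] by simp
next
  case (inv h)
  have hB: "h \<in> Bij (Vn n)" using gens_Bij inv.hyps by blast
  let ?K' = "inv_into (Vn n) h K"
  have y: "y \<in> ?K'" using inv.prems(1,3) by (simp add: inv_BijGroup[OF hB])
  have "h ` Vn n = Vn n" using hB by (simp add: Bij_def bij_betw_def)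
  then have K': "?K' \<in> Vn n" "h ?K' = K"
    using inv_into_into[of K h "Vn n"] f_inv_into_f[of K h "Vn n"] inv.prems(1) by simp_all
  have "x \<in> h ?K'" using K'(2) inv.prems(2) by simp
  with inv.hyps K'(1) obtain z where "z \<in> ?K'" "invs n x = invs n z" by (rule gens_invs)
  then show ?case using invs_class[OF K'(1) _ y] by simp
next
  case (eng h1 h2)
  have B: "h1 \<in> Bij (Vn n)" "h2 \<in> Bij (Vn n)" using eng.hyps Hn_Bij by blast+
  have y: "y \<in> h1 (h2 K)" using eng.prems(3) unfolding Bij_mult_apply[OF B eng.prems(1)] .
  have h2K: "h2 K \<in> Vn n" by (rule Bij_apply[OF B(2) eng.prems(1)])
  obtain w where "w \<in> Rpairs n" "h2 K = Vclass n w" by (rule Vn_repr[OF h2K])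
  then obtain z where z: "z \<in> h2 K" using Vclass_self by blast
  have "invs n y = invs n z" by (rule eng.IH(1)[OF h2K z y])
  moreover have "invs n z = invs n x" by (rule eng.IH(2)[OF eng.prems(1,2) z])
  ultimately show ?case by simp
qed

lemma invs_if_Psi_eq:
  assumes "x \<in> Rpairs n" "y \<in> Rpairs n" "Psi n (Vclass n x) = Psi n (Vclass n y)"
  shows "invs n x = invs n y"
proof -
  have "Vclass n x \<in> Psi n (Vclass n y)" using Psi_self[OF Vclass_in[OF assms(1)]] assms(3) by simp
  then obtain g where g: "g \<in> Hn n" "Vclass n x = g (Vclass n y)" unfolding in_Psi_iff by (elim bexE)
  have "x \<in> g (Vclass n y)" using Vclass_self[OF assms(1)] g(2) by simp
  then show ?thesis by (rule invs_Hn[OF g(1) Vclass_in[OF assms(2)] Vclass_self[OF assms(2)]])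
qed

lemma Psi_Imap:
  assumes "x \<in> Rpairs n"
  shows "Psi n (Vclass n (Imap n x)) = Psi n (Vclass n x)"
proof -
  have "(\<lambda>K\<in>Vn n. Imap n ` K) \<in> Hn n" by (rule generate.incl) (simp add: gens_def)
  from Psi_apply[OF this Vclass_in[OF assms]] show ?thesis
    using Imap_image[OF assms] Vclass_in[OF assms] by simp
qed

lemma Psi_Mmap:
  assumes "x \<in> Rpairs n" "p \<in> {1..n}"
  shows "Psi n (Vclass n (Mmap n p x)) = Psi n (Vclass n x)"
proof -
  have "(\<lambda>K\<in>Vn n. Mmap n p ` K) \<in> Hn n" by (rule generate.incl) (use assms in \<open>simp add: gens_def\<close>)
  from Psi_apply[OF this Vclass_in[OF assms(1)]] show ?thesis
    using Mmap_image[OF assms(2,1)] Vclass_in[OF assms(1)] by simp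
qed

lemma Psi_Nmap:
  assumes "x \<in> Rpairs n" "p \<in> {1..n}"
  shows "Psi n (Vclass n (Nmap n p x)) = Psi n (Vclass n x)"
  using Psi_Mmap[OF Nmap_in assms(2)] Nmap_Mmap(2)[OF assms] by metis

lemma Nmap_coords:
  assumes p: "p \<in> {1..n}"
  shows "cyc_len n (Nmap n p x) = cyc_len n x"
  "i \<in> {1..n} \<Longrightarrow> pos n (Nmap n p x) i = pos n x i + (if i = p then cyc_len n x else 0)"
  "invs n (Nmap n p x) = invs n x"
  unfolding Nmap_def by (simp_all add: Imap_coords Mmap_coords[OF p] invs_Imap invs_Mmap[OF p])

lemma orbit_shift_one:
  fixes m :: int
  assumes p: "p \<in> {1..n}" and x: "x \<in> Rpairs n"
  shows "\<exists>y\<in>Rpairs n. Psi n (Vclass n y) = Psi n (Vclass n x) \<and> invs n y = invs n x \<and>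
    (\<forall>i\<in>{1..n}. pos n y i = pos n x i + (if i = p then cyc_len n x * of_int m else 0))"
proof (induction m rule: int_induct[of _ 0])
  case base
  then show ?case using x by (intro bexI[of _ x]) auto
next
  case (step1 m)
  then obtain y where y: "y \<in> Rpairs n" "Psi n (Vclass n y) = Psi n (Vclass n x)" "invs n y = invs n x"
    "\<forall>i\<in>{1..n}. pos n y i = pos n x i + (if i = p then cyc_len n x * of_int m else 0)" by blast
  have "cyc_len n y = cyc_len n x" using y(3) by (simp add: invs_eq_iff)
  then show ?case
    using y Psi_Nmap[OF y(1) p] Nmap_in
    by (intro bexI[of _ "Nmap n p y"]) (auto simp: Nmap_coords[OF p] algebra_simps)
next
  case (step2 m)
  then obtain y where y: "y \<in> Rpairs n" "Psi n (Vclass n y) = Psi n (Vclass n x)" "invs n y = invs n x"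
    "\<forall>i\<in>{1..n}. pos n y i = pos n x i + (if i = p then cyc_len n x * of_int m else 0)" by blast
  have "cyc_len n y = cyc_len n x" using y(3) by (simp add: invs_eq_iff)
  then show ?case
    using y Psi_Mmap[OF y(1) p] Mmap_in
    by (intro bexI[of _ "Mmap n p y"]) (auto simp: Mmap_coords[OF p] invs_Mmap[OF p] algebra_simps)
qed

lemma orbit_shift:
  fixes m :: "nat \<Rightarrow> int"
  assumes x: "x \<in> Rpairs n" and "finite P" "P \<subseteq> {1..n}"
  shows "\<exists>y\<in>Rpairs n. Psi n (Vclass n y) = Psi n (Vclass n x) \<and> invs n y = invs n x \<and>
    (\<forall>i\<in>{1..n}. pos n y i = pos n x i + (if i \<in> P then cyc_len n x * of_int (m i) else 0))"
  using assms(2,3)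
proof (induction P rule: finite_induct)
  case empty
  then show ?case using x by (intro bexI[of _ x]) auto
next
  case (insert p P)
  then obtain y where y: "y \<in> Rpairs n" "Psi n (Vclass n y) = Psi n (Vclass n x)" "invs n y = invs n x"
    "\<forall>i\<in>{1..n}. pos n y i = pos n x i + (if i \<in> P then cyc_len n x * of_int (m i) else 0)" by auto
  have cy: "cyc_len n y = cyc_len n x" using y(3) by (simp add: invs_eq_iff)
  obtain z where z: "z \<in> Rpairs n" "Psi n (Vclass n z) = Psi n (Vclass n y)" "invs n z = invs n y"
    "\<forall>i\<in>{1..n}. pos n z i = pos n y i + (if i = p then cyc_len n y * of_int (m p) else 0)"
    using orbit_shift_one[OF _ y(1), of p "m p"] insert.prems by auto
  show ?case
    by (rule bexI[OF _ z(1)]) (use y z cy insert.hyps(2) in auto)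
qed

text \<open>Changing the positions by multiples of the length of the cycle is the effect of the
  \<open>M\<^sub>p\<close>, their reflection that of \<open>I\<close>, and a common shift
  disappears in \<open>Vn\<close>. As the length of the cycle is not zero, the invariants and the
  positions determine the remaining coordinates.\<close>

lemma Psi_eqI:
  fixes m :: "nat \<Rightarrow> int"
  assumes x: "x \<in> Rpairs n" and y: "y \<in> Rpairs n" and inv: "invs n y = invs n x" and "cyc_len n x \<noteq> 0"
    and \<epsilon>: "\<epsilon> = 1 \<or> \<epsilon> = -1"
    and p: "\<And>i. i \<in> {1..n} \<Longrightarrow> pos n y i = \<epsilon> * pos n x i + r + cyc_len n x * of_int (m i)"
  shows "Psi n (Vclass n y) = Psi n (Vclass n x)"
proof -
  obtain x' where x': "x' \<in> Rpairs n" "Psi n (Vclass n x') = Psi n (Vclass n x)" "invs n x' = invs n x"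
    "\<And>i. i \<in> {1..n} \<Longrightarrow> pos n x' i = \<epsilon> * pos n x i"
  proof (cases "\<epsilon> = 1")
    case True
    then show ?thesis using that[OF x] by simp
  next
    case False
    then show ?thesis
      using that[OF Imap_in Psi_Imap[OF x] invs_Imap] \<epsilon> by (simp add: Imap_coords)
  qed
  have c': "cyc_len n x' = cyc_len n x" using x'(3) by (simp add: invs_eq_iff)
  obtain z where z: "z \<in> Rpairs n" "Psi n (Vclass n z) = Psi n (Vclass n x')" "invs n z = invs n x'"
    "\<And>i. i \<in> {1..n} \<Longrightarrow> pos n z i = pos n x' i + cyc_len n x' * of_int (m i)"
    using orbit_shift[OF x'(1), of "{1..n}" m] by auto
  have pz: "pos n y i = pos n z i + r" if "i \<in> {1..n}" for i
    using p[OF that] z(4)[OF that] x'(4)[OF that] c' by simp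
  have eq: "invs n y = invs n z" using inv x'(3) z(3) by simp
  then have c: "cyc_len n y = cyc_len n z" "cyc_len n z \<noteq> 0"
    using x'(3) z(3) \<open>cyc_len n x \<noteq> 0\<close> by (auto simp: invs_eq_iff)
  have "rdist n y i j = rdist n z i j" if "i \<in> {1..n}" "j \<in> {1..n}" "i \<noteq> j" for i j
  proof -
    have "cinv n y i j = cinv n z i j" using eq that by (simp add: invs_eq_iff)
    then show ?thesis using pz that c by (simp add: cinv_def)
  qed
  then have "y \<in> Vclass n z" unfolding Vclass_iff using y c pz by blast
  then show ?thesis using Vclass_eq z(2) x'(2) by metis
qed

section \<open>Distance vectors of families of splits\<close>

text \<open>The edge \<open>e\<close> separates the leaves in \<open>S e\<close> from the others,
  and contributes its length to the distance of two leaves that it separates.\<close>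

definition split_vec :: "nat \<Rightarrow> nat set \<Rightarrow> (nat \<Rightarrow> real) \<Rightarrow> (nat \<Rightarrow> nat set) \<Rightarrow> vec" where
  "split_vec n E l S = (\<lambda>t\<in>pairs n. \<Sum>e\<in>E. l e * of_bool (card (S e \<inter> t) = 1))"

text \<open>The sides do not contain \<open>n + 1\<close>, as the tree is regarded as rooted at
  this leaf.\<close>

definition laminar :: "nat \<Rightarrow> nat set \<Rightarrow> (nat \<Rightarrow> nat set) \<Rightarrow> bool" where
  "laminar n E S \<longleftrightarrow> (\<forall>e\<in>E. S e \<subseteq> insert (n + 2) {1..n}) \<and>
     (\<forall>e\<in>E. \<forall>f\<in>E. S e \<inter> S f \<noteq> {} \<longrightarrow> S e \<subseteq> S f \<or> S f \<subseteq> S e)"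

text \<open>The edges with \<open>n + 2\<close> in their side form the path from the leaf
  \<open>n + 1\<close> to the leaf \<open>n + 2\<close>, that is, the cut cycle.
  \<open>offset\<close> measures positions on it from \<open>n + 1\<close>,
  \<open>arc_len\<close> is the distance of two of them, and \<open>common_len\<close> the length
  that the paths from the cycle to two leaves have in common.\<close>

definition total_len :: "nat \<Rightarrow> nat set \<Rightarrow> (nat \<Rightarrow> real) \<Rightarrow> (nat \<Rightarrow> nat set) \<Rightarrow> real" where
  "total_len n E l S = (\<Sum>e\<in>E. l e * of_bool (n + 2 \<in> S e))"

definition offset :: "nat \<Rightarrow> nat set \<Rightarrow> (nat \<Rightarrow> real) \<Rightarrow> (nat \<Rightarrow> nat set) \<Rightarrow> nat \<Rightarrow> real" where
  "offset n E l S i = (\<Sum>e\<in>E. l e * of_bool (n + 2 \<in> S e \<and> i \<in> S e))"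

definition arc_len :: "nat \<Rightarrow> nat set \<Rightarrow> (nat \<Rightarrow> real) \<Rightarrow> (nat \<Rightarrow> nat set) \<Rightarrow> nat \<Rightarrow> nat \<Rightarrow> real" where
  "arc_len n E l S i j = (\<Sum>e\<in>E. l e * of_bool (n + 2 \<in> S e \<and> (i \<in> S e) \<noteq> (j \<in> S e)))"

definition common_len :: "nat \<Rightarrow> nat set \<Rightarrow> (nat \<Rightarrow> real) \<Rightarrow> (nat \<Rightarrow> nat set) \<Rightarrow> nat \<Rightarrow> nat \<Rightarrow> real" where
  "common_len n E l S i j = (\<Sum>e\<in>E. l e * of_bool (n + 2 \<notin> S e \<and> i \<in> S e \<and> j \<in> S e))"

lemma split_vec_in: "split_vec n E l S \<in> Rpairs n"
  by (simp add: split_vec_def Rpairs_def)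

lemma card_inter_pair:
  assumes "i \<noteq> j" shows "card (A \<inter> {i, j}) = 1 \<longleftrightarrow> (i \<in> A) \<noteq> (j \<in> A)"
proof -
  have "A \<inter> {i, j} = (if i \<in> A then {i} else {}) \<union> (if j \<in> A then {j} else {})" by auto
  then show ?thesis using assms by simp
qed

lemma split_vec_pair:
  assumes "{i, j} \<in> pairs n"
  shows "split_vec n E l S {i, j} = (\<Sum>e\<in>E. l e * of_bool ((i \<in> S e) \<noteq> (j \<in> S e)))"
proof -
  have "i \<noteq> j" using assms by (simp add: pair_in_pairs)
  then show ?thesis using assms card_inter_pair[OF \<open>i \<noteq> j\<close>] by (simp add: split_vec_def)
qed

lemma laminar_not_A: "laminar n E S \<Longrightarrow> e \<in> E \<Longrightarrow> n + 1 \<notin> S e"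
proof
  assume "laminar n E S" "e \<in> E" "n + 1 \<in> S e"
  then have "n + 1 \<in> insert (n + 2) {1..n}" unfolding laminar_def by blast
  then show False by simp
qed

lemma split_vec_AB:
  assumes "laminar n E S"
  shows "split_vec n E l S {n+1, n+2} = total_len n E l S"
proof -
  have "{n+1, n+2} \<in> pairs n" by (simp add: pair_in_pairs)
  from split_vec_pair[OF this, of E l S] show ?thesis
    unfolding total_len_def using laminar_not_A[OF assms, simplified] by (auto intro!: sum.cong)
qed

lemma split_vec_iA:
  assumes "laminar n E S" "i \<in> {1..n}"
  shows "split_vec n E l S {i, n+1} = (\<Sum>e\<in>E. l e * of_bool (i \<in> S e))"
proof -
  have "{i, n+1} \<in> pairs n" using assms(2) by (auto simp: pair_in_pairs)
  from split_vec_pair[OF this, of E l S] show ?thesis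
    using laminar_not_A[OF assms(1), simplified] by (auto intro!: sum.cong)
qed

lemma split_vec_iB:
  assumes "i \<in> {1..n}"
  shows "split_vec n E l S {i, n+2} = (\<Sum>e\<in>E. l e * of_bool ((i \<in> S e) \<noteq> (n + 2 \<in> S e)))"
  by (rule split_vec_pair) (use assms in \<open>auto simp: pair_in_pairs\<close>)

lemma split_vec_ij:
  assumes "i \<in> {1..n}" "j \<in> {1..n}" "i \<noteq> j"
  shows "split_vec n E l S {i, j} = (\<Sum>e\<in>E. l e * of_bool ((i \<in> S e) \<noteq> (j \<in> S e)))"
  by (rule split_vec_pair) (use assms in \<open>auto simp: pair_in_pairs\<close>)

lemma cyc_len_split: "laminar n E S \<Longrightarrow> cyc_len n (split_vec n E l S) = total_len n E l S"
  unfolding cyc_len_def by (rule split_vec_AB)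

lemma pos_split:
  assumes "laminar n E S" "i \<in> {1..n}"
  shows "pos n (split_vec n E l S) i = offset n E l S i - total_len n E l S / 2"
proof -
  have "split_vec n E l S {i, n+1} - split_vec n E l S {i, n+2} + total_len n E l S = 2 * offset n E l S i"
    unfolding split_vec_iA[OF assms] split_vec_iB[OF assms(2)] total_len_def offset_def
      sum_subtractf[symmetric] sum.distrib[symmetric] sum_distrib_left
    by (rule sum.cong) auto
  then show ?thesis by (simp add: pos_def field_simps)
qed

lemma rdist_split:
  assumes "laminar n E S" "i \<in> {1..n}" "j \<in> {1..n}" "i \<noteq> j"
  shows "rdist n (split_vec n E l S) i j = arc_len n E l S i j - 2 * common_len n E l S i j"
proof -
  let ?x = "split_vec n E l S"
  have "2 * ?x {i, j} + 2 * total_len n E l S =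
      2 * arc_len n E l S i j - 4 * common_len n E l S i j + ?x {i, n+1} + ?x {i, n+2} + ?x {j, n+1} + ?x {j, n+2}"
    unfolding split_vec_iA[OF assms(1,2)] split_vec_iB[OF assms(2)] split_vec_iA[OF assms(1,3)]
      split_vec_iB[OF assms(3)] split_vec_ij[OF assms(2-4)] total_len_def arc_len_def common_len_def
      sum_distrib_left sum_subtractf[symmetric] sum.distrib[symmetric]
    by (rule sum.cong) auto
  then show ?thesis
    unfolding rdist_def cyc_len_split[OF assms(1)] by (simp add: field_simps)
qed

text \<open>The sides of the edges of the cycle form a chain, so all edges between two positions
  on the cycle separate the leaves in the same way.\<close>

lemma offset_diff:
  assumes "laminar n E S" "i \<in> {1..n}" "j \<in> {1..n}"
  shows "offset n E l S i - offset n E l S j = arc_len n E l S i j \<or>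
    offset n E l S j - offset n E l S i = arc_len n E l S i j"
proof -
  have nested: "S e \<subseteq> S f \<or> S f \<subseteq> S e" if "e \<in> E" "f \<in> E" "n + 2 \<in> S e" "n + 2 \<in> S f" for e f
    using assms(1) that unfolding laminar_def by blast
  have "(\<forall>e\<in>E. n + 2 \<in> S e \<and> j \<in> S e \<longrightarrow> i \<in> S e) \<or> (\<forall>e\<in>E. n + 2 \<in> S e \<and> i \<in> S e \<longrightarrow> j \<in> S e)"
    using nested by blast
  then show ?thesis
  proof
    assume *: "\<forall>e\<in>E. n + 2 \<in> S e \<and> j \<in> S e \<longrightarrow> i \<in> S e"
    have "offset n E l S i - offset n E l S j = arc_len n E l S i j"
      unfolding offset_def arc_len_def sum_subtractf[symmetric] by (rule sum.cong) (use * in auto)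
    then show ?thesis by blast
  next
    assume *: "\<forall>e\<in>E. n + 2 \<in> S e \<and> i \<in> S e \<longrightarrow> j \<in> S e"
    have "offset n E l S j - offset n E l S i = arc_len n E l S i j"
      unfolding offset_def arc_len_def sum_subtractf[symmetric] by (rule sum.cong) (use * in auto)
    then show ?thesis by blast
  qed
qed

lemma cinv_split:
  assumes "laminar n E S" "i \<in> {1..n}" "j \<in> {1..n}" "i \<noteq> j"
  shows "cinv n (split_vec n E l S) i j =
    arc_len n E l S i j * (total_len n E l S - arc_len n E l S i j) - 2 * total_len n E l S * common_len n E l S i j"
proof -
  have "(pos n (split_vec n E l S) i - pos n (split_vec n E l S) j)\<^sup>2 = (arc_len n E l S i j)\<^sup>2"
  proof -
    have "(offset n E l S i - offset n E l S j)\<^sup>2 = (arc_len n E l S i j)\<^sup>2"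
      using offset_diff[OF assms(1-3), of l] by (metis power2_commute)
    then show ?thesis unfolding pos_split[OF assms(1,2)] pos_split[OF assms(1,3)] by simp
  qed
  then show ?thesis
    unfolding cinv_def cyc_len_split[OF assms(1)] rdist_split[OF assms]
    by (simp add: algebra_simps power2_eq_square)
qed

lemma arc_bounds:
  assumes "\<And>e. e \<in> E \<Longrightarrow> 0 \<le> l e"
  shows "0 \<le> arc_len n E l S i j" "arc_len n E l S i j \<le> total_len n E l S" "0 \<le> common_len n E l S i j"
  unfolding arc_len_def total_len_def common_len_def
  by (intro sum_nonneg, use assms in simp)
    (intro sum_mono, use assms in simp, intro sum_nonneg, use assms in simp)

text \<open>Two leaves that share an edge outside the cycle leave the cycle at the same point.\<close>

lemma common_or_arc_zero:
  assumes "laminar n E S"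
  shows "common_len n E l S i j = 0 \<or> arc_len n E l S i j = 0"
proof (rule disjCI)
  assume "arc_len n E l S i j \<noteq> 0"
  then obtain f where f: "f \<in> E" "n + 2 \<in> S f" "(i \<in> S f) \<noteq> (j \<in> S f)"
    unfolding arc_len_def by (auto elim: sum.not_neutral_contains_not_neutral)
  have "\<not> (n + 2 \<notin> S e \<and> i \<in> S e \<and> j \<in> S e)" if e: "e \<in> E" for e
    using assms e f unfolding laminar_def by blast
  then show "common_len n E l S i j = 0" unfolding common_len_def by (intro sum.neutral) simp
qed

text \<open>The sign of the invariant decides which of its two terms vanishes.\<close>

lemma circle_invariant_eq:
  fixes a b g h L :: real
  assumes "a * (L - a) - 2 * L * g = b * (L - b) - 2 * L * h" "0 < L"
    "0 \<le> a" "a \<le> L" "0 \<le> b" "b \<le> L" "0 \<le> g" "0 \<le> h" "g = 0 \<or> a = 0" "h = 0 \<or> b = 0"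
  shows "(b = a \<or> b = L - a) \<and> g = h"
proof -
  have "0 \<le> a * (L - a)" "0 \<le> b * (L - b)" "0 \<le> L * g" "0 \<le> L * h" using assms by simp_all
  moreover have "a * (L - a) = 0 \<or> L * g = 0" "b * (L - b) = 0 \<or> L * h = 0" using assms by auto
  ultimately have "a * (L - a) = b * (L - b)" "L * g = L * h" using assms(1) by linarith+
  then have "(b - a) * (b - (L - a)) = 0" "g = h" using assms(2) by (simp_all add: algebra_simps)
  then show ?thesis by auto
qed

text \<open>Here \<open>p\<close> and \<open>q\<close> are positions on a circle of length
  \<open>L\<close> with the same distances. Once a common base point is fixed, each point is
  carried to its counterpart by the identity or by the reflection. If one point were carried only
  by the identity and another one only by the reflection, then their distance would change.\<close>

lemma circle_rigid:
  fixes p q :: "nat \<Rightarrow> real"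
  assumes L: "0 < L" and pq: "\<And>i j. i \<in> J \<Longrightarrow> j \<in> J \<Longrightarrow>
      \<bar>q i - q j\<bar> = \<bar>p i - p j\<bar> \<or> \<bar>q i - q j\<bar> = L - \<bar>p i - p j\<bar>"
  shows "\<exists>\<epsilon> r. \<exists>m::nat \<Rightarrow> int. (\<epsilon> = 1 \<or> \<epsilon> = -1) \<and> (\<forall>i\<in>J. q i = \<epsilon> * p i + r + L * of_int (m i))"
proof (cases "J = {}")
  case False
  then obtain k where k: "k \<in> J" by blast
  have cong: "((q i - q j) - (p i - p j)) / L \<in> \<int> \<or> ((q i - q j) + (p i - p j)) / L \<in> \<int>"
    if "i \<in> J" "j \<in> J" for i j
  proof -
    have "\<bar>q i - q j\<bar> = \<bar>p i - p j\<bar> \<or> \<bar>q i - q j\<bar> = L - \<bar>p i - p j\<bar>" by (rule pq[OF that])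
    then consider "q i - q j = p i - p j" | "q i - q j = - (p i - p j)" |
      "(q i - q j) - (p i - p j) = L" | "(q i - q j) - (p i - p j) = - L" |
      "(q i - q j) + (p i - p j) = L" | "(q i - q j) + (p i - p j) = - L"
      by linarith
    then show ?thesis using L by cases (simp_all add: minus_divide_left[symmetric])
  qed
  define a where "a i = (q i - q k) / L" for i
  define b where "b i = (p i - p k) / L" for i
  have La: "L * a i = q i - q k" and Lb: "L * b i = p i - p k" for i
    using L by (simp_all add: a_def b_def)
  have ab: "a i - b i \<in> \<int> \<or> a i + b i \<in> \<int>" if "i \<in> J" for i
    using cong[OF that k] by (simp add: a_def b_def add_divide_distrib diff_divide_distrib)
  have ab2: "(a i - a j) - (b i - b j) \<in> \<int> \<or> (a i - a j) + (b i - b j) \<in> \<int>" if "i \<in> J" "j \<in> J" for i j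
    using cong[OF that] by (simp add: a_def b_def add_divide_distrib diff_divide_distrib)
  have "(\<forall>i\<in>J. a i - b i \<in> \<int>) \<or> (\<forall>i\<in>J. a i + b i \<in> \<int>)"
  proof (rule ccontr)
    assume "\<not> ?thesis"
    then obtain i j where i: "i \<in> J" "a i - b i \<notin> \<int>" and j: "j \<in> J" "a j + b j \<notin> \<int>" by blast
    then have i': "a i + b i \<in> \<int>" and j': "a j - b j \<in> \<int>" using ab by blast+
    from ab2[OF i(1) j(1)] show False
    proof
      assume "(a i - a j) - (b i - b j) \<in> \<int>"
      then have "((a i - a j) - (b i - b j)) + (a j - b j) \<in> \<int>" using j' by (rule Ints_add)
      then show False using i(2) by (simp add: algebra_simps)
    next
      assume "(a i - a j) + (b i - b j) \<in> \<int>"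
      with i' have "(a i + b i) - ((a i - a j) + (b i - b j)) \<in> \<int>" by (rule Ints_diff)
      then show False using j(2) by (simp add: algebra_simps)
    qed
  qed
  then show ?thesis
  proof
    assume "\<forall>i\<in>J. a i - b i \<in> \<int>"
    then have "\<forall>i\<in>J. \<exists>m. a i - b i = of_int m" by (auto elim: Ints_cases)
    then obtain m where m: "\<forall>i\<in>J. a i - b i = of_int (m i)" by metis
    have "q i = 1 * p i + (q k - p k) + L * of_int (m i)" if "i \<in> J" for i
    proof -
      have "L * (a i - b i) = L * of_int (m i)" using bspec[OF m that] by simp
      then show ?thesis unfolding right_diff_distrib La Lb by simp
    qed
    then show ?thesis by blast
  next
    assume "\<forall>i\<in>J. a i + b i \<in> \<int>"
    then have "\<forall>i\<in>J. \<exists>m. a i + b i = of_int m" by (auto elim: Ints_cases)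
    then obtain m where m: "\<forall>i\<in>J. a i + b i = of_int (m i)" by metis
    have "q i = - 1 * p i + (q k + p k) + L * of_int (m i)" if "i \<in> J" for i
    proof -
      have "L * (a i + b i) = L * of_int (m i)" using bspec[OF m that] by simp
      then show ?thesis unfolding distrib_left La Lb by simp
    qed
    then show ?thesis by blast
  qed
qed (rule exI[of _ 1], simp)

lemma invs_eq_arcs:
  assumes lam: "laminar n E S" "laminar n E' S'"
    and l: "\<And>e. e \<in> E \<Longrightarrow> 0 \<le> l e" "\<And>e. e \<in> E' \<Longrightarrow> 0 \<le> l' e" and pos: "0 < total_len n E l S"
    and eq: "invs n (split_vec n E' l' S') = invs n (split_vec n E l S)"
    and ij: "i \<in> {1..n}" "j \<in> {1..n}" "i \<noteq> j"
  shows "total_len n E' l' S' = total_len n E l S" "common_len n E' l' S' i j = common_len n E l S i j"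
    "arc_len n E' l' S' i j = arc_len n E l S i j \<or> arc_len n E' l' S' i j = total_len n E l S - arc_len n E l S i j"
proof -
  show tot: "total_len n E' l' S' = total_len n E l S"
    using eq unfolding invs_eq_iff cyc_len_split[OF lam(1)] cyc_len_split[OF lam(2)] by blast
  have c: "cinv n (split_vec n E' l' S') i j = cinv n (split_vec n E l S) i j"
    using eq ij unfolding invs_eq_iff by blast
  note ab = arc_bounds[of E' l' n S' i j, OF l(2)] arc_bounds[of E l n S i j, OF l(1)]
  have "(arc_len n E' l' S' i j = arc_len n E l S i j \<or> arc_len n E' l' S' i j = total_len n E l S - arc_len n E l S i j) \<and>
      common_len n E l S i j = common_len n E' l' S' i j"
    by (rule circle_invariant_eq)
      (use c[unfolded cinv_split[OF lam(1) ij] cinv_split[OF lam(2) ij] tot] pos ab tot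
        common_or_arc_zero[OF lam(1), of l i j] common_or_arc_zero[OF lam(2), of l' i j] in simp_all)
  then show "common_len n E' l' S' i j = common_len n E l S i j"
    "arc_len n E' l' S' i j = arc_len n E l S i j \<or> arc_len n E' l' S' i j = total_len n E l S - arc_len n E l S i j"
    by simp_all
qed

lemma abs_offset_diff:
  assumes "laminar n E S" "\<And>e. e \<in> E \<Longrightarrow> 0 \<le> l e" "i \<in> {1..n}" "j \<in> {1..n}"
  shows "\<bar>offset n E l S i - offset n E l S j\<bar> = arc_len n E l S i j"
  using offset_diff[OF assms(1,3,4), of l] arc_bounds(1)[of E l n S i j, OF assms(2)] by auto

lemma offsets_congruent:
  assumes lam: "laminar n E S" "laminar n E' S'"
    and l: "\<And>e. e \<in> E \<Longrightarrow> 0 \<le> l e" "\<And>e. e \<in> E' \<Longrightarrow> 0 \<le> l' e" and pos: "0 < total_len n E l S"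
    and eq: "invs n (split_vec n E' l' S') = invs n (split_vec n E l S)"
  shows "\<exists>\<epsilon> r. \<exists>m::nat \<Rightarrow> int. (\<epsilon> = 1 \<or> \<epsilon> = -1) \<and>
    (\<forall>i\<in>{1..n}. offset n E' l' S' i = \<epsilon> * offset n E l S i + r + total_len n E l S * of_int (m i))"
proof (rule circle_rigid[OF pos])
  fix i j assume ij: "i \<in> {1..n}" "j \<in> {1..n}"
  show "\<bar>offset n E' l' S' i - offset n E' l' S' j\<bar> = \<bar>offset n E l S i - offset n E l S j\<bar> \<or>
      \<bar>offset n E' l' S' i - offset n E' l' S' j\<bar> = total_len n E l S - \<bar>offset n E l S i - offset n E l S j\<bar>"
  proof (cases "i = j")
    case False
    show ?thesis
      using invs_eq_arcs(3)[OF lam l pos eq ij False] abs_offset_diff[OF lam(1) l(1) ij]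
        abs_offset_diff[OF lam(2) l(2) ij] by simp
  qed simp
qed

text \<open>The invariants separate orbits: they determine the distances of the positions on the
  cycle, hence the positions up to an isometry of the circle.\<close>

lemma Psi_eq_if_invs_eq:
  assumes lam: "laminar n E S" "laminar n E' S'"
    and l: "\<And>e. e \<in> E \<Longrightarrow> 0 \<le> l e" "\<And>e. e \<in> E' \<Longrightarrow> 0 \<le> l' e" and pos: "0 < total_len n E l S"
    and eq: "invs n (split_vec n E' l' S') = invs n (split_vec n E l S)"
  shows "Psi n (Vclass n (split_vec n E' l' S')) = Psi n (Vclass n (split_vec n E l S))"
proof -
  have "\<exists>\<epsilon> r. \<exists>m::nat \<Rightarrow> int. (\<epsilon> = 1 \<or> \<epsilon> = -1) \<and>
      (\<forall>i\<in>{1..n}. offset n E' l' S' i = \<epsilon> * offset n E l S i + r + total_len n E l S * of_int (m i))"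
    by (rule offsets_congruent[OF lam _ _ pos eq]) (use l in auto)
  then obtain \<epsilon> r and m :: "nat \<Rightarrow> int"
    where *: "(\<epsilon> = 1 \<or> \<epsilon> = -1) \<and>
      (\<forall>i\<in>{1..n}. offset n E' l' S' i = \<epsilon> * offset n E l S i + r + total_len n E l S * of_int (m i))"
    by (elim exE)
  then have \<epsilon>: "\<epsilon> = 1 \<or> \<epsilon> = -1" and
    m: "\<And>i. i \<in> {1..n} \<Longrightarrow> offset n E' l' S' i = \<epsilon> * offset n E l S i + r + total_len n E l S * of_int (m i)"
    by simp_all
  show ?thesis
  proof (rule Psi_eqI[OF split_vec_in split_vec_in eq _ \<epsilon>])
    show "cyc_len n (split_vec n E l S) \<noteq> 0" using pos cyc_len_split[OF lam(1)] by simp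
    fix i assume i: "i \<in> {1..n}"
    have t: "total_len n E' l' S' = total_len n E l S"
      using eq unfolding invs_eq_iff cyc_len_split[OF lam(1)] cyc_len_split[OF lam(2)] by blast
    show "pos n (split_vec n E' l' S') i = \<epsilon> * pos n (split_vec n E l S) i +
        (r + (\<epsilon> - 1) * total_len n E l S / 2) + cyc_len n (split_vec n E l S) * of_int (m i)"
      unfolding pos_split[OF lam(1) i] pos_split[OF lam(2) i] cyc_len_split[OF lam(1)] m[OF i] t
      by (simp add: field_simps)
  qed
qed

text \<open>An edge outside the cycle with two leaves beyond it is shared by the paths from the
  cycle to these leaves.\<close>

lemma edge_length_bound:
  assumes lam: "laminar n E S" and fin: "finite E" and l: "\<And>e. e \<in> E \<Longrightarrow> 0 \<le> l e"
    and e: "e \<in> E" "n + 2 \<notin> S e" "i \<in> S e" "j \<in> S e" and ij: "i \<in> {1..n}" "j \<in> {1..n}" "i \<noteq> j"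
  shows "2 * total_len n E l S * l e \<le> \<bar>cinv n (split_vec n E l S) i j\<bar>"
proof -
  have "l e = l e * of_bool (n + 2 \<notin> S e \<and> i \<in> S e \<and> j \<in> S e)" using e by simp
  also have "\<dots> \<le> common_len n E l S i j"
    unfolding common_len_def by (rule member_le_sum[OF e(1)]) (use l fin in auto)
  finally have le: "l e \<le> common_len n E l S i j" .
  have t: "0 \<le> total_len n E l S" unfolding total_len_def by (rule sum_nonneg) (use l in simp)
  show ?thesis
  proof (cases "common_len n E l S i j = 0")
    case True
    then have "l e = 0" using le l[OF e(1)] by simp
    then show ?thesis by simp
  next
    case False
    then have "arc_len n E l S i j = 0" using common_or_arc_zero[OF lam] by blast
    then have "\<bar>cinv n (split_vec n E l S) i j\<bar> = 2 * total_len n E l S * common_len n E l S i j"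
      using cinv_split[OF lam ij, of l] t arc_bounds(3)[of E l n S i j, OF l] by simp
    then show ?thesis using le t by (simp add: mult_left_mono)
  qed
qed

lemma cycle_edge_length_bound:
  assumes fin: "finite E" and l: "\<And>e. e \<in> E \<Longrightarrow> 0 \<le> l e" and e: "e \<in> E" "n + 2 \<in> S e"
  shows "l e \<le> total_len n E l S"
proof -
  have "l e = l e * of_bool (n + 2 \<in> S e)" using e by simp
  also have "\<dots> \<le> total_len n E l S"
    unfolding total_len_def by (rule member_le_sum[OF e(1)]) (use l fin in auto)
  finally show ?thesis .
qed

section \<open>Cut systems\<close>

text \<open>What the sides of the edges have in common for all ways to cut a given curve. A
  single edge of the cycle does not separate the curve, but a pair of them does. The cut at an
  edge outside the cycle has the whole cycle on its near side.\<close>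

definition cut_system :: "nat \<Rightarrow> curve \<Rightarrow> (nat \<Rightarrow> nat set) \<Rightarrow> bool" where
  "cut_system n C S \<longleftrightarrow> laminar n (bedges C) S \<and> (\<exists>e\<in>bedges C. n + 2 \<in> S e) \<and>
     (\<forall>e\<in>bedges C. n + 2 \<in> S e \<longrightarrow> nonbridge C e) \<and>
     (\<forall>e\<in>bedges C. n + 2 \<notin> S e \<longrightarrow> (\<exists>\<phi>. crossing C \<phi> = {e} \<and>
        (\<forall>i\<in>{1..n}. \<phi> (leaf C i) \<longleftrightarrow> i \<in> S e) \<and>
        (\<forall>f\<in>bedges C. n + 2 \<in> S f \<longrightarrow> (\<forall>x\<in>ends C f. \<not> \<phi> x)))) \<and>
     (\<forall>e\<in>bedges C. \<forall>f\<in>bedges C. n + 2 \<in> S e \<longrightarrow> n + 2 \<in> S f \<longrightarrow> e \<noteq> f \<longrightarrow>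
        (\<exists>\<phi>. crossing C \<phi> = {e, f} \<and> (\<forall>i\<in>{1..n}. \<phi> (leaf C i) \<longleftrightarrow> (i \<in> S e) \<noteq> (i \<in> S f))))"

lemma cut_systemD:
  assumes "cut_system n C S"
  shows "laminar n (bedges C) S" "\<exists>e\<in>bedges C. n + 2 \<in> S e"
    "e \<in> bedges C \<Longrightarrow> n + 2 \<in> S e \<longleftrightarrow> nonbridge C e"
    "e \<in> bedges C \<Longrightarrow> n + 2 \<notin> S e \<Longrightarrow> \<exists>\<phi>. crossing C \<phi> = {e} \<and>
        (\<forall>i\<in>{1..n}. \<phi> (leaf C i) \<longleftrightarrow> i \<in> S e) \<and>
        (\<forall>f\<in>bedges C. n + 2 \<in> S f \<longrightarrow> (\<forall>x\<in>ends C f. \<not> \<phi> x))"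
    "e \<in> bedges C \<Longrightarrow> f \<in> bedges C \<Longrightarrow> n + 2 \<in> S e \<Longrightarrow> n + 2 \<in> S f \<Longrightarrow> e \<noteq> f \<Longrightarrow>
      \<exists>\<phi>. crossing C \<phi> = {e, f} \<and> (\<forall>i\<in>{1..n}. \<phi> (leaf C i) \<longleftrightarrow> (i \<in> S e) \<noteq> (i \<in> S f))"
proof -
  note * = assms[unfolded cut_system_def]
  show "laminar n (bedges C) S" using * by (elim conjE)
  show "\<exists>e\<in>bedges C. n + 2 \<in> S e" using * by (elim conjE)
  have 3: "\<forall>e\<in>bedges C. n + 2 \<in> S e \<longrightarrow> nonbridge C e" using * by (elim conjE)
  have 4: "\<forall>e\<in>bedges C. n + 2 \<notin> S e \<longrightarrow> (\<exists>\<phi>. crossing C \<phi> = {e} \<and>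
        (\<forall>i\<in>{1..n}. \<phi> (leaf C i) \<longleftrightarrow> i \<in> S e) \<and>
        (\<forall>f\<in>bedges C. n + 2 \<in> S f \<longrightarrow> (\<forall>x\<in>ends C f. \<not> \<phi> x)))" using * by (elim conjE)
  show bridge: "e \<in> bedges C \<Longrightarrow> n + 2 \<notin> S e \<Longrightarrow> \<exists>\<phi>. crossing C \<phi> = {e} \<and>
        (\<forall>i\<in>{1..n}. \<phi> (leaf C i) \<longleftrightarrow> i \<in> S e) \<and>
        (\<forall>f\<in>bedges C. n + 2 \<in> S f \<longrightarrow> (\<forall>x\<in>ends C f. \<not> \<phi> x))" for e
    using bspec[OF 4, of e] by simp
  show "e \<in> bedges C \<Longrightarrow> n + 2 \<in> S e \<longleftrightarrow> nonbridge C e"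
    using bspec[OF 3, of e] bridge[of e] unfolding nonbridge_def by blast
  have 5: "\<forall>e\<in>bedges C. \<forall>f\<in>bedges C. n + 2 \<in> S e \<longrightarrow> n + 2 \<in> S f \<longrightarrow> e \<noteq> f \<longrightarrow>
        (\<exists>\<phi>. crossing C \<phi> = {e, f} \<and> (\<forall>i\<in>{1..n}. \<phi> (leaf C i) \<longleftrightarrow> (i \<in> S e) \<noteq> (i \<in> S f)))"
    using * by (elim conjE)
  show "e \<in> bedges C \<Longrightarrow> f \<in> bedges C \<Longrightarrow> n + 2 \<in> S e \<Longrightarrow> n + 2 \<in> S f \<Longrightarrow> e \<noteq> f \<Longrightarrow>
      \<exists>\<phi>. crossing C \<phi> = {e, f} \<and> (\<forall>i\<in>{1..n}. \<phi> (leaf C i) \<longleftrightarrow> (i \<in> S e) \<noteq> (i \<in> S f))"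
    using bspec[OF bspec[OF 5, of e], of f] by simp
qed

text \<open>As cuts are determined by the edges they cross, two cut systems agree on the edges
  outside the cycle, while on the cycle their sides differ by one fixed set of leaves. For a
  given pair of leaves, this either changes nothing or exchanges the two arcs between them.\<close>

lemma cut_system_invs:
  assumes G: "fin_graph C" "cut_conn C" "\<And>i. i \<in> {1..n} \<Longrightarrow> leaf C i \<in> verts C"
    and S: "cut_system n C S" and S': "cut_system n C S'"
  shows "invs n (split_vec n (bedges C) l S') = invs n (split_vec n (bedges C) l S)"
proof -
  let ?E = "bedges C"
  note lam = cut_systemD(1)[OF S] cut_systemD(1)[OF S']
  have cyc: "n + 2 \<in> S' e \<longleftrightarrow> n + 2 \<in> S e" if "e \<in> ?E" for e
    using cut_systemD(3)[OF S that] cut_systemD(3)[OF S' that] by blast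
  obtain e\<^sub>0 where e0: "e\<^sub>0 \<in> ?E" "n + 2 \<in> S e\<^sub>0" using cut_systemD(2)[OF S] by blast
  obtain z where z: "z \<in> ends C e\<^sub>0" "z \<in> verts C" using fin_graph_endsE[OF G(1) e0(1)] by blast
  have bridge: "i \<in> S' e \<longleftrightarrow> i \<in> S e" if e: "e \<in> ?E" "n + 2 \<notin> S e" and i: "i \<in> {1..n}" for e i
  proof -
    obtain \<phi> where \<phi>: "crossing C \<phi> = {e}" "\<phi> (leaf C i) \<longleftrightarrow> i \<in> S e" "\<not> \<phi> z"
      using cut_systemD(4)[OF S e] i e0 z by blast
    have e': "n + 2 \<notin> S' e" using cyc e by blast
    obtain \<phi>' where \<phi>': "crossing C \<phi>' = {e}" "\<phi>' (leaf C i) \<longleftrightarrow> i \<in> S' e" "\<not> \<phi>' z"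
      using cut_systemD(4)[OF S' e(1) e'] i e0 z cyc by blast
    have "(\<phi> (leaf C i) \<noteq> \<phi> z) = (\<phi>' (leaf C i) \<noteq> \<phi>' z)"
      by (rule cut_unique[OF G(1,2)]) (use \<phi> \<phi>' G(3)[OF i] z in simp_all)
    then show ?thesis using \<phi> \<phi>' by blast
  qed
  have "cinv n (split_vec n ?E l S') i j = cinv n (split_vec n ?E l S) i j"
    if ij: "i \<in> {1..n}" "j \<in> {1..n}" "i \<noteq> j" for i j
  proof -
    have tot: "total_len n ?E l S' = total_len n ?E l S"
      unfolding total_len_def by (rule sum.cong) (use cyc in auto)
    have com: "common_len n ?E l S' i j = common_len n ?E l S i j"
      unfolding common_len_def by (rule sum.cong) (use cyc bridge ij in auto)
    define d where "d R e \<longleftrightarrow> (i \<in> R e) \<noteq> (j \<in> R e)" for R :: "nat \<Rightarrow> nat set" and e :: nat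
    have d: "(d S e \<noteq> d S e\<^sub>0) = (d S' e \<noteq> d S' e\<^sub>0)" if e: "e \<in> ?E" "n + 2 \<in> S e" for e
    proof (cases "e = e\<^sub>0")
      case False
      obtain \<phi> where \<phi>: "crossing C \<phi> = {e, e\<^sub>0}" "\<forall>i\<in>{1..n}. \<phi> (leaf C i) \<longleftrightarrow> (i \<in> S e) \<noteq> (i \<in> S e\<^sub>0)"
        using cut_systemD(5)[OF S e(1) e0(1) e(2) e0(2) False] by blast
      have e': "n + 2 \<in> S' e" "n + 2 \<in> S' e\<^sub>0" using cyc e e0 by blast+
      obtain \<phi>' where \<phi>': "crossing C \<phi>' = {e, e\<^sub>0}" "\<forall>i\<in>{1..n}. \<phi>' (leaf C i) \<longleftrightarrow> (i \<in> S' e) \<noteq> (i \<in> S' e\<^sub>0)"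
        using cut_systemD(5)[OF S' e(1) e0(1) e' False] by blast
      have "(\<phi> (leaf C i) \<noteq> \<phi> (leaf C j)) = (\<phi>' (leaf C i) \<noteq> \<phi>' (leaf C j))"
        by (rule cut_unique[OF G(1,2)]) (use \<phi> \<phi>' G(3) ij in simp_all)
      moreover have "\<phi> (leaf C i) = ((i \<in> S e) \<noteq> (i \<in> S e\<^sub>0))" "\<phi> (leaf C j) = ((j \<in> S e) \<noteq> (j \<in> S e\<^sub>0))"
        "\<phi>' (leaf C i) = ((i \<in> S' e) \<noteq> (i \<in> S' e\<^sub>0))" "\<phi>' (leaf C j) = ((j \<in> S' e) \<noteq> (j \<in> S' e\<^sub>0))"
        using \<phi>(2) \<phi>'(2) ij by blast+
      ultimately show ?thesis unfolding d_def by blast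
    qed simp
    have "arc_len n ?E l S' i j = arc_len n ?E l S i j \<or> arc_len n ?E l S' i j = total_len n ?E l S - arc_len n ?E l S i j"
    proof (cases "d S e\<^sub>0 = d S' e\<^sub>0")
      case True
      have "arc_len n ?E l S' i j = arc_len n ?E l S i j"
        unfolding arc_len_def
      proof (rule sum.cong[OF refl])
        fix e assume e: "e \<in> ?E"
        show "l e * of_bool (n + 2 \<in> S' e \<and> (i \<in> S' e) \<noteq> (j \<in> S' e)) =
            l e * of_bool (n + 2 \<in> S e \<and> (i \<in> S e) \<noteq> (j \<in> S e))"
          using d[OF e] True cyc[OF e] unfolding d_def by (cases "n + 2 \<in> S e") auto
      qed
      then show ?thesis by blast
    next
      case False
      have "arc_len n ?E l S' i j = total_len n ?E l S - arc_len n ?E l S i j"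
        unfolding arc_len_def total_len_def sum_subtractf[symmetric]
      proof (rule sum.cong[OF refl])
        fix e assume e: "e \<in> ?E"
        show "l e * of_bool (n + 2 \<in> S' e \<and> (i \<in> S' e) \<noteq> (j \<in> S' e)) =
            l e * of_bool (n + 2 \<in> S e) - l e * of_bool (n + 2 \<in> S e \<and> (i \<in> S e) \<noteq> (j \<in> S e))"
          using d[OF e] False cyc[OF e] unfolding d_def by (cases "n + 2 \<in> S e") auto
      qed
      then show ?thesis by blast
    qed
    then have "arc_len n ?E l S' i j * (total_len n ?E l S - arc_len n ?E l S' i j) =
        arc_len n ?E l S i j * (total_len n ?E l S - arc_len n ?E l S i j)"
      by (elim disjE) simp_all
    then show ?thesis using tot com by (simp add: cinv_split[OF lam(1) ij] cinv_split[OF lam(2) ij])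
  qed
  moreover have "total_len n ?E l S' = total_len n ?E l S"
    unfolding total_len_def by (rule sum.cong) (use cyc in auto)
  ultimately show ?thesis
    unfolding invs_eq_iff cyc_len_split[OF lam(1)] cyc_len_split[OF lam(2)] by blast
qed

lemma (in rooted_cut) cut_system_side: "cut_system n C side"
proof -
  have lam: "laminar n (bedges C) side"
    unfolding laminar_def
  proof (intro conjI ballI impI)
    fix e f assume ef: "e \<in> bedges C" "f \<in> bedges C" "side e \<inter> side f \<noteq> {}"
    show "side e \<subseteq> side f \<or> side f \<subseteq> side e"
    proof (cases "e = e\<^sub>0 \<or> f = e\<^sub>0")
      case True
      then show ?thesis using ef(3) side_e0 by auto
    next
      case False
      then have E: "e \<in> E" "f \<in> E" using ef by auto
      obtain k where k: "k \<in> side e" "k \<in> side f" using ef(3) by blast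
      have "\<exists>x\<in>verts C. W e x \<and> W f x"
      proof (cases "k = n + 2")
        case True
        then show ?thesis using k E in_side_B u_in by blast
      next
        case False
        then have "k \<in> {1..n}" using k(1) side_subset by blast
        then show ?thesis using k E in_side_leaf leaf by blast
      qed
      then show ?thesis
        using laminar_W[OF E] side_subset_iff[OF E] side_subset_iff[OF E(2,1)] by blast
    qed
  qed (use side_subset in blast)
  have bridge: "\<exists>\<phi>. crossing C \<phi> = {e} \<and> (\<forall>i\<in>{1..n}. \<phi> (leaf C i) \<longleftrightarrow> i \<in> side e) \<and>
      (\<forall>f\<in>bedges C. n + 2 \<in> side f \<longrightarrow> (\<forall>x\<in>ends C f. \<not> \<phi> x))"
    if e: "e \<in> bedges C" "n + 2 \<notin> side e" for e
  proof -
    have "e \<noteq> e\<^sub>0" using e(2) side_e0 by auto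
    then have E: "e \<in> E" using e by simp
    have nu: "\<not> W e u" using in_side_B[OF E] e(2) by blast
    have "\<not> W e x" if f: "f \<in> bedges C" "n + 2 \<in> side f" and x: "x \<in> ends C f" for f x
    proof (cases "f = e\<^sub>0")
      case True
      then have "x = v\<^sub>0 \<or> x = u" using x ends0 by auto
      then show ?thesis using nu root E by auto
    next
      case False
      then have fE: "f \<in> E" using f by simp
      have fu: "W f u" using in_side_B[OF fE] f(2) by blast
      have fe: "f \<noteq> e" using e f by auto
      obtain p q where pq: "p \<in> verts C" "q \<in> verts C" "ends C f = {p, q}" "\<not> W f p" "W f q"
        "\<And>g. g \<in> E \<Longrightarrow> g \<noteq> f \<Longrightarrow> W g p = W g q"
        by (rule endsE[OF fE]) blast
      have epq: "W e p = W e q" using pq(6)[OF E] fe by blast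
      have "\<not> W e q"
      proof
        assume "W e q"
        then have "W e p" using epq by simp
        show False
          by (rule four_values_T[OF E fE fe[symmetric] pq(2) \<open>W e q\<close> pq(5) pq(1) \<open>W e p\<close> pq(4) u_in nu fu])
      qed
      then show ?thesis using epq x pq(3) by auto
    qed
    moreover have "crossing C (W e) = {e}" using crossing_W[OF E] nu by simp
    ultimately show ?thesis using in_side_leaf[OF E] by blast
  qed
  have pair: "\<exists>\<phi>. crossing C \<phi> = {e, f} \<and> (\<forall>i\<in>{1..n}. \<phi> (leaf C i) \<longleftrightarrow> (i \<in> side e) \<noteq> (i \<in> side f))"
    if ef: "e \<in> E" "f \<in> bedges C" "n + 2 \<in> side e" "n + 2 \<in> side f" "e \<noteq> f" for e f
  proof -
    have We: "crossing C (W e) = {e, e\<^sub>0}" using crossing_W[OF ef(1)] in_side_B[OF ef(1)] ef(3) by simp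
    show ?thesis
    proof (cases "f = e\<^sub>0")
      case True
      have "i \<notin> side f" if "i \<in> {1..n}" for i using True side_e0 that by auto
      then have "\<forall>i\<in>{1..n}. W e (leaf C i) \<longleftrightarrow> (i \<in> side e) \<noteq> (i \<in> side f)"
        using in_side_leaf[OF ef(1)] by blast
      then show ?thesis using We True by blast
    next
      case False
      then have fE: "f \<in> E" using ef by simp
      have Wf: "crossing C (W f) = {f, e\<^sub>0}" using crossing_W[OF fE] in_side_B[OF fE] ef(4) by simp
      have "crossing C (\<lambda>x. W e x \<noteq> W f x) = {e, f}"
        unfolding crossing_xor[OF fin] We Wf using ef fE by auto
      moreover have "\<forall>i\<in>{1..n}. (W e (leaf C i) \<noteq> W f (leaf C i)) \<longleftrightarrow> (i \<in> side e) \<noteq> (i \<in> side f)"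
        using in_side_leaf[OF ef(1)] in_side_leaf[OF fE] by blast
      ultimately show ?thesis by blast
    qed
  qed
  have pair': "\<exists>\<phi>. crossing C \<phi> = {e, f} \<and> (\<forall>i\<in>{1..n}. \<phi> (leaf C i) \<longleftrightarrow> (i \<in> side e) \<noteq> (i \<in> side f))"
    if ef: "e \<in> bedges C" "f \<in> bedges C" "n + 2 \<in> side e" "n + 2 \<in> side f" "e \<noteq> f" for e f
  proof (cases "e = e\<^sub>0")
    case False
    then show ?thesis using pair[of e f] ef by simp
  next
    case True
    then obtain \<phi> where "crossing C \<phi> = {f, e}" "\<forall>i\<in>{1..n}. \<phi> (leaf C i) \<longleftrightarrow> (i \<in> side f) \<noteq> (i \<in> side e)"
      using pair[of f e] ef by auto
    then show ?thesis by (intro exI[of _ \<phi>]) auto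
  qed
  have nb: "nonbridge C e" if e: "e \<in> bedges C" "n + 2 \<in> side e" for e
  proof (cases "e = e\<^sub>0")
    case False
    then have eE: "e \<in> E" using e by simp
    have "crossing C \<phi> \<noteq> {e}" for \<phi>
    proof
      assume \<phi>: "crossing C \<phi> = {e}"
      then have "crossing T \<phi> = crossing T (W e)" using W eE by (auto simp: crossing_delete_edge)
      then have "(\<phi> v\<^sub>0 \<noteq> \<phi> u) = (W e v\<^sub>0 \<noteq> W e u)"
        by (rule cut_unique[OF finT connT]) (use v0_in u_in in simp_all)
      then have "\<phi> v\<^sub>0 \<noteq> \<phi> u" using root eE in_side_B[OF eE] e(2) by simp
      then have "e\<^sub>0 \<in> crossing C \<phi>" using in_crossing_iff[OF e0_in ends0] by blast
      then show False using \<phi> eE by auto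
    qed
    then show ?thesis using e by (simp add: nonbridge_def)
  qed (use e0 in simp)
  have "\<exists>e\<in>bedges C. n + 2 \<in> side e" using e0_in side_e0 by blast
  then show ?thesis
    unfolding cut_system_def using lam nb bridge pair' by (intro conjI ballI impI) simp_all
qed

lemma cut_sides_system: "cut_sides n C S \<Longrightarrow> cut_system n C S"
  unfolding cut_sides_def using rooted_cut.cut_system_side by blast

section \<open>Cut trees\<close>

lemma dist_vec_tree:
  assumes D: "tropical_tree (n + 2) D"
  obtains S W where "laminar n (bedges D) S" "dist_vec n D = split_vec n (bedges D) (len D) S"
    "\<forall>e\<in>bedges D. crossing D (W e) = {e}" "\<forall>e. \<not> W e (leaf D (n + 1))"
    "\<forall>e. \<forall>i\<in>insert (n + 2) {1..n}. i \<in> S e \<longleftrightarrow> W e (leaf D i)"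
proof -
  have G: "fin_graph D" "cut_conn D" and lf: "leaf D ` {1..n+2} \<subseteq> verts D"
    using D unfolding tropical_tree_def abstract_curve_iff by blast+
  have lv: "leaf D i \<in> verts D" if "i \<in> {1..n+2}" for i using lf that by blast
  have "\<exists>\<phi>. crossing D \<phi> = {e}" if "e \<in> bedges D" for e
    using cut_or_cycle[OF G(1) that] D unfolding tropical_tree_def by blast
  then have "\<forall>e\<in>bedges D. \<exists>\<phi>. crossing D \<phi> = {e}" by blast
  then obtain K where K: "\<forall>e\<in>bedges D. crossing D (K e) = {e}" by metis
  define W where "W e x \<longleftrightarrow> K e x \<noteq> K e (leaf D (n + 1))" for e x
  define S where "S e = {i \<in> insert (n + 2) {1..n}. W e (leaf D i)}" for e
  have W: "crossing D (W e) = {e}" if "e \<in> bedges D" for e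
  proof -
    have "W e = (\<lambda>x. K e x \<noteq> K e (leaf D (n + 1)))" by (simp add: W_def fun_eq_iff)
    then show ?thesis using bspec[OF K that] crossing_neq by metis
  qed
  have A: "\<not> W e (leaf D (n + 1))" for e by (simp add: W_def)
  have S: "i \<in> S e \<longleftrightarrow> W e (leaf D i)" if "i \<in> insert (n + 2) {1..n}" for e i
    using that by (simp add: S_def)
  have Av: "leaf D (n + 1) \<in> verts D" by (rule lv) simp
  have lam: "laminar n (bedges D) S"
    unfolding laminar_def
  proof (intro conjI ballI impI)
    fix e f assume ef: "e \<in> bedges D" "f \<in> bedges D" "S e \<inter> S f \<noteq> {}"
    show "S e \<subseteq> S f \<or> S f \<subseteq> S e"
    proof (rule ccontr)
      assume "\<not> ?thesis"
      then obtain i j where i: "i \<in> S e" "i \<notin> S f" and j: "j \<in> S f" "j \<notin> S e" by blast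
      obtain k where k: "k \<in> S e" "k \<in> S f" using ef(3) by blast
      have "S g \<subseteq> {1..n+2}" for g by (auto simp: S_def)
      then have v: "leaf D i \<in> verts D" "leaf D j \<in> verts D" "leaf D k \<in> verts D"
        using lv i(1) j(1) k(1) by blast+
      have ins: "i \<in> insert (n+2) {1..n}" "j \<in> insert (n+2) {1..n}" "k \<in> insert (n+2) {1..n}"
        using i(1) j(1) k(1) unfolding S_def by blast+
      have "e \<noteq> f" using i by blast
      show False
        by (rule four_values[OF G(2) W[OF ef(1)] W[OF ef(2)] \<open>e \<noteq> f\<close> v(3) _ _ v(1) _ _ v(2) _ _ Av A A])
          (use i j k S ins in blast)+
    qed
  next
    show "S e \<subseteq> insert (n + 2) {1..n}" for e by (auto simp: S_def)
  qed
  have AnS: "n + 1 \<notin> S e" for e by (simp add: S_def)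
  have sep: "W e (leaf D i) \<longleftrightarrow> i \<in> S e" if i: "i \<in> {1..n+2}" for i e
  proof (cases "i = n + 1")
    case True
    show ?thesis unfolding True using A AnS by blast
  next
    case False
    then have "i \<in> insert (n + 2) {1..n}" using i by auto
    then show ?thesis using S by blast
  qed
  have "dist_vec n D t = split_vec n (bedges D) (len D) S t" for t
  proof (cases "t \<in> pairs n")
    case True
    then obtain a b where t: "t = {a, b}" "a < b"
      unfolding pairs_def mem_Collect_eq card_2_iff by (metis insert_commute linorder_neqE_nat)
    then have mm: "Min t = a" "Max t = b" by auto
    have ab: "a \<in> {1..n+2}" "b \<in> {1..n+2}" using True unfolding t(1) pair_in_pairs by blast+
    have "dist_vec n D t = path_dist D (leaf D a) (leaf D b)"
      using True mm by (simp add: dist_vec_def)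
    also have "\<dots> = (\<Sum>e\<in>bedges D. len D e * of_bool (W e (leaf D a) \<noteq> W e (leaf D b)))"
      by (rule path_dist_tree[OF G W lv[OF ab(1)] lv[OF ab(2)]])
    also have "\<dots> = split_vec n (bedges D) (len D) S t"
      unfolding t(1) split_vec_pair[OF True[unfolded t(1)]] sep[OF ab(1)] sep[OF ab(2)] by simp
    finally show ?thesis .
  qed (simp add: dist_vec_def split_vec_def)
  then have "dist_vec n D = split_vec n (bedges D) (len D) S" by blast
  then show ?thesis using that[OF lam, of W] W A S by simp
qed

text \<open>When the two ends of a cut tree are glued, a cut of the tree that keeps both on the
  same side becomes a cut of the curve. The cuts that separate them do so in pairs.\<close>

lemma splits_cut_system:
  assumes D: "tropical_tree (n + 2) D" and sp: "splits n C a D"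
  obtains S where "cut_system n C S" "dist_vec n D = split_vec n (bedges C) (len C) S"
    "fin_graph C" "cut_conn C" "\<forall>i\<in>{1..n}. leaf C i \<in> verts C"
proof -
  let ?A = "leaf D (n + 1)" and ?B = "leaf D (n + 2)"
  obtain S W where lam: "laminar n (bedges D) S"
    and dv: "dist_vec n D = split_vec n (bedges D) (len D) S"
    and W': "\<forall>e\<in>bedges D. crossing D (W e) = {e}" and WA': "\<forall>e. \<not> W e ?A"
    and S': "\<forall>e. \<forall>i\<in>insert (n + 2) {1..n}. i \<in> S e \<longleftrightarrow> W e (leaf D i)"
    by (rule dist_vec_tree[OF D])
  have W: "crossing D (W e) = {e}" if "e \<in> bedges D" for e using W' that by blast
  have WA: "\<not> W e ?A" for e using WA' by blast
  have S: "i \<in> S e \<longleftrightarrow> W e (leaf D i)" if "i \<in> insert (n + 2) {1..n}" for e i using S' that by blast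
  have G: "fin_graph D" "cut_conn D" using D unfolding tropical_tree_def abstract_curve_iff by blast+
  have E: "bedges D = bedges C" and len: "\<And>e. e \<in> bedges C \<Longrightarrow> len D e = len C e"
    and AB: "?A \<in> verts D" "?B \<in> verts D" "?A \<noteq> ?B"
    using sp unfolding splits_def by simp_all
  have "\<exists>q. q ` verts D = verts C \<and> q ?A = a \<and> q ?B = a \<and> inj_on q (verts D - {?A}) \<and>
        (\<forall>e\<in>bedges C. ends D e \<subseteq> verts D \<and> ends C e = q ` ends D e) \<and>
        (\<forall>i\<in>{1..n}. leaf D i \<in> verts D \<and> leaf C i = q (leaf D i))"
    using sp unfolding splits_def by (elim conjE)
  then obtain q where q: "q ` verts D = verts C" "q ?A = a" "q ?B = a" "inj_on q (verts D - {?A})"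
    and qe': "\<forall>e\<in>bedges C. ends D e \<subseteq> verts D \<and> ends C e = q ` ends D e"
    and ql': "\<forall>i\<in>{1..n}. leaf D i \<in> verts D \<and> leaf C i = q (leaf D i)"
    by (elim exE conjE)
  have qe: "ends C e = q ` ends D e" if "e \<in> bedges C" for e using qe' that by blast
  have ql: "leaf D i \<in> verts D \<and> leaf C i = q (leaf D i)" if "i \<in> {1..n}" for i using ql' that by blast
  have pull: "crossing D (\<lambda>x. \<phi> (q x)) = crossing C \<phi>" for \<phi>
  proof -
    have "(\<exists>x\<in>ends D e. \<exists>y\<in>ends D e. \<phi> (q x) \<noteq> \<phi> (q y)) \<longleftrightarrow>
        (\<exists>x\<in>ends C e. \<exists>y\<in>ends C e. \<phi> x \<noteq> \<phi> y)" if "e \<in> bedges C" for e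
      unfolding qe[OF that] bex_simps ..
    then show ?thesis unfolding crossing_def E by blast
  qed
  have fibre: "\<psi> x = \<psi> y" if "\<psi> ?A = \<psi> ?B" "x \<in> verts D" "y \<in> verts D" "q x = q y" for \<psi> :: "nat \<Rightarrow> bool" and x y
  proof (cases "x = ?A \<or> y = ?A")
    case False
    then show ?thesis using inj_onD[OF q(4) that(4)] that by blast
  next
    case True
    have B: "z = ?B" if "z \<in> verts D" "q z = a" "z \<noteq> ?A" for z
      using inj_onD[OF q(4), of z ?B] that AB q(3) by simp
    show ?thesis using True B[of x] B[of y] that q(2) by metis
  qed
  have push: "\<exists>\<phi>. crossing C \<phi> = crossing D \<psi> \<and> (\<forall>x\<in>verts D. \<phi> (q x) = \<psi> x)"
    if "\<psi> ?A = \<psi> ?B" for \<psi>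
  proof -
    define \<phi> where "\<phi> y \<longleftrightarrow> (\<exists>x\<in>verts D. q x = y \<and> \<psi> x)" for y
    have \<phi>: "\<phi> (q x) = \<psi> x" if "x \<in> verts D" for x
      using fibre[of \<psi>] \<open>\<psi> ?A = \<psi> ?B\<close> that unfolding \<phi>_def by blast
    have "crossing C \<phi> = crossing D (\<lambda>x. \<phi> (q x))" using pull by simp
    moreover have "crossing D (\<lambda>x. \<phi> (q x)) = crossing D \<psi>" by (rule crossing_cong[OF G(1) \<phi>])
    ultimately show ?thesis using \<phi> by (intro exI[of _ \<phi>]) simp
  qed
  have GC: "fin_graph C"
    unfolding fin_graph_def
  proof (intro conjI ballI)
    have "finite (q ` verts D)" using G(1) by (simp add: fin_graph_def)
    then show "finite (verts C)" using q(1) by simp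
    show "finite (bedges C)" using G(1) E by (simp add: fin_graph_def)
    fix e assume e: "e \<in> bedges C"
    have "e \<in> bedges D" using e E by simp
    with G(1) obtain u v where uv: "u \<in> verts D" "v \<in> verts D" "ends D e = {u, v}"
      by (rule fin_graph_endsE)
    then have "ends C e = {q u, q v}" using qe[OF e] by simp
    then show "\<exists>u\<in>verts C. \<exists>v\<in>verts C. ends C e = {u, v}" using uv q(1) by blast
  qed
  have CC: "cut_conn C"
    unfolding cut_conn_def
  proof (intro allI impI ballI)
    fix \<phi> u v assume *: "crossing C \<phi> = {}" "u \<in> verts C" "v \<in> verts C"
    then obtain x y where xy: "x \<in> verts D" "y \<in> verts D" "u = q x" "v = q y" using q(1) by blast
    have "crossing D (\<lambda>x. \<phi> (q x)) = {}" using pull *(1) by simp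
    from cut_conn_const[OF G(2) this xy(1,2)] show "\<phi> u = \<phi> v" using xy by simp
  qed
  have lC: "leaf C i \<in> verts C" if "i \<in> {1..n}" for i using ql[OF that] q(1) by auto
  have cyc: "n + 2 \<in> S e \<longleftrightarrow> W e ?B" for e using S by simp
  have bridge: "\<exists>\<phi>. crossing C \<phi> = {e} \<and> (\<forall>i\<in>{1..n}. \<phi> (leaf C i) \<longleftrightarrow> i \<in> S e) \<and>
        (\<forall>f\<in>bedges C. n + 2 \<in> S f \<longrightarrow> (\<forall>x\<in>ends C f. \<not> \<phi> x))"
    if e: "e \<in> bedges C" "n + 2 \<notin> S e" for e
  proof -
    have eD: "e \<in> bedges D" using e E by simp
    have eB: "\<not> W e ?B" using e cyc by blast
    then obtain \<phi> where \<phi>: "crossing C \<phi> = crossing D (W e)" "\<forall>x\<in>verts D. \<phi> (q x) = W e x"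
      using push[of "W e"] WA by blast
    have "\<not> \<phi> x" if f: "f \<in> bedges C" "n + 2 \<in> S f" "x \<in> ends C f" for f x
    proof -
      have fD: "f \<in> bedges D" using f E by simp
      have fe: "f \<noteq> e" using e f by blast
      have fB: "W f ?B" using f cyc by blast
      obtain u v where uv: "u \<in> verts D" "v \<in> verts D" "ends D f = {u, v}"
        using G(1) fD by (rule fin_graph_endsE)
      have ne: "W f u \<noteq> W f v" using in_crossing_iff[OF fD uv(3), of "W f"] W[OF fD] by simp
      have eq: "W e u = W e v" using in_crossing_iff[OF fD uv(3), of "W e"] W[OF eD] fe by simp
      have "\<not> W e u"
      proof
        assume eu: "W e u"
        then have ev: "W e v" using eq by simp
        have "\<exists>p\<in>verts D. \<exists>r\<in>verts D. W e p \<and> W f p \<and> W e r \<and> \<not> W f r"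
          using ne eu ev uv(1,2) by blast
        then obtain p r where pr: "p \<in> verts D" "r \<in> verts D" "W e p" "W f p" "W e r" "\<not> W f r" by blast
        show False
          by (rule four_values[OF G(2) W[OF eD] W[OF fD] fe[symmetric] pr(1,3,4) pr(2,5,6) AB(2) eB fB
                AB(1) WA WA])
      qed
      moreover have "x = q u \<or> x = q v" using f(3) qe[OF f(1)] uv(3) by auto
      ultimately show ?thesis using \<phi>(2) uv eq by auto
    qed
    moreover have "\<phi> (leaf C i) \<longleftrightarrow> i \<in> S e" if i: "i \<in> {1..n}" for i
      using \<phi>(2) ql[OF i] S[of i e] i by simp
    ultimately show ?thesis using \<phi>(1) W[OF eD] by (intro exI[of _ \<phi>]) simp
  qed
  have pair: "\<exists>\<phi>. crossing C \<phi> = {e, f} \<and> (\<forall>i\<in>{1..n}. \<phi> (leaf C i) \<longleftrightarrow> (i \<in> S e) \<noteq> (i \<in> S f))"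
    if ef: "e \<in> bedges C" "f \<in> bedges C" "n + 2 \<in> S e" "n + 2 \<in> S f" "e \<noteq> f" for e f
  proof -
    have D: "e \<in> bedges D" "f \<in> bedges D" using ef E by simp_all
    have AB': "(W e ?A \<noteq> W f ?A) = (W e ?B \<noteq> W f ?B)" using WA D cyc ef by blast
    obtain \<phi> where \<phi>: "crossing C \<phi> = crossing D (\<lambda>x. W e x \<noteq> W f x)"
      "\<forall>x\<in>verts D. \<phi> (q x) = (W e x \<noteq> W f x)"
      using push[of "\<lambda>x. W e x \<noteq> W f x", OF AB'] by blast
    have "crossing C \<phi> = {e, f}"
      unfolding \<phi>(1) crossing_xor[OF G(1)] W[OF D(1)] W[OF D(2)] using ef(5) by blast
    moreover have "\<phi> (leaf C i) \<longleftrightarrow> (i \<in> S e) \<noteq> (i \<in> S f)" if i: "i \<in> {1..n}" for i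
      using \<phi>(2) ql[OF i] S[of i e] S[of i f] i by simp
    ultimately show ?thesis by blast
  qed
  have nb: "nonbridge C e" if e: "e \<in> bedges C" "n + 2 \<in> S e" for e
    unfolding nonbridge_def
  proof (intro conjI notI)
    assume "\<exists>\<phi>. crossing C \<phi> = {e}"
    then obtain \<phi> where \<phi>: "crossing C \<phi> = {e}" by blast
    have eD: "e \<in> bedges D" using e E by simp
    have "(\<phi> (q ?A) \<noteq> \<phi> (q ?B)) = (W e ?A \<noteq> W e ?B)"
      by (rule cut_unique[OF G _ AB(1,2), of "\<lambda>x. \<phi> (q x)" "W e"]) (use pull \<phi> W[OF eD] in simp)
    then show False using q(2,3) WA cyc e by auto
  qed (use e in simp)
  obtain e where "e \<in> bedges D" "W e ?A \<noteq> W e ?B"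
    by (rule tree_vertices_separated[OF G W AB]) blast
  then have ex: "\<exists>e\<in>bedges C. n + 2 \<in> S e" using WA cyc E by blast
  have "cut_system n C S"
    unfolding cut_system_def using lam[unfolded E] ex nb bridge pair by (intro conjI ballI impI) simp_all
  moreover have "dist_vec n D = split_vec n (bedges C) (len C) S"
    unfolding dv E split_vec_def using len by (intro restrict_ext sum.cong) simp_all
  ultimately show ?thesis using that GC CC lC by simp
qed

text \<open>Both halves of the divided edge inherit its side.\<close>

lemma subdivides_cut_system:
  assumes sub: "subdivides n C w C'" and G: "fin_graph C" and lf: "\<And>i. i \<in> {1..n} \<Longrightarrow> leaf C i \<in> verts C"
    and S: "cut_system n C S" 
  obtains S' where "cut_system n C' S'"
    "split_vec n (bedges C') (len C') S' = split_vec n (bedges C) (len C) S"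
proof -
  have w: "w \<notin> verts C" and lfC': "\<And>i. i \<in> {1..n} \<Longrightarrow> leaf C' i = leaf C i"
    using sub unfolding subdivides_def by blast+
  have "\<exists>e\<in>bedges C. \<exists>e1 e2 u v.
        ends C e = {u, v} \<and> e1 \<noteq> e2 \<and> e1 \<notin> bedges C - {e} \<and> e2 \<notin> bedges C - {e} \<and>
        bedges C' = {e1, e2} \<union> (bedges C - {e}) \<and>
        ends C' e1 = {u, w} \<and> ends C' e2 = {w, v} \<and>
        0 < len C' e1 \<and> 0 < len C' e2 \<and> len C' e1 + len C' e2 = len C e \<and>
        (\<forall>e'\<in>bedges C - {e}. ends C' e' = ends C e' \<and> len C' e' = len C e')"
    using sub unfolding subdivides_def by (elim conjE)
  then obtain e e1 e2 u v where e: "e \<in> bedges C" "ends C e = {u, v}" "e1 \<noteq> e2"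
    "e1 \<notin> bedges C - {e}" "e2 \<notin> bedges C - {e}" and E': "bedges C' = {e1, e2} \<union> (bedges C - {e})"
    and ends: "ends C' e1 = {u, w}" "ends C' e2 = {w, v}" and len: "len C' e1 + len C' e2 = len C e"
    and old: "\<forall>e'\<in>bedges C - {e}. ends C' e' = ends C e' \<and> len C' e' = len C e'"
    by (elim bexE exE conjE)
  have uv: "u \<in> verts C" "v \<in> verts C" using fin_graph_ends[OF G e(1)] e(2) by auto
  define S' where "S' f = (if f = e1 \<or> f = e2 then S e else S f)" for f
  define \<pi> where "\<pi> f = (if f = e1 \<or> f = e2 then e else f)" for f
  have \<pi>: "\<pi> f \<in> bedges C" "S' f = S (\<pi> f)" if "f \<in> bedges C'" for f
    using that e(1) E' by (auto simp: \<pi>_def S'_def)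
  have old_in: "f \<in> bedges C - {e}" if "f \<in> bedges C'" "f \<noteq> e1" "f \<noteq> e2" for f
    using that E' by blast
  \<comment> \<open>a cut of the curve extends to the new vertex, which may be put on either side\<close>
  have ext: "crossing C' (\<phi>(w := b)) =
      (crossing C \<phi> - {e}) \<union> (if \<phi> u \<noteq> b then {e1} else {}) \<union> (if \<phi> v \<noteq> b then {e2} else {})"
    (is "?L = ?R") for \<phi> b
  proof -
    have uw: "u \<noteq> w" "v \<noteq> w" using uv w by blast+
    have in1: "e1 \<in> bedges C'" "e2 \<in> bedges C'" using E' by blast+
    have c1: "e1 \<in> ?L \<longleftrightarrow> \<phi> u \<noteq> b" using in_crossing_iff[OF in1(1) ends(1)] uw by simp
    have c2: "e2 \<in> ?L \<longleftrightarrow> \<phi> v \<noteq> b" using in_crossing_iff[OF in1(2) ends(2)] uw by auto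
    have c3: "f \<in> ?L \<longleftrightarrow> f \<in> crossing C \<phi>" if f: "f \<in> bedges C - {e}" for f
    proof -
      obtain x y where xy: "x \<in> verts C" "y \<in> verts C" "ends C f = {x, y}"
        by (rule fin_graph_endsE[OF G, of f]) (use f in blast)
      have xyw: "x \<noteq> w" "y \<noteq> w" using xy w by blast+
      have f': "f \<in> bedges C'" "ends C' f = {x, y}" using f E' old xy(3) by auto
      show ?thesis
        using in_crossing_iff[OF f'] in_crossing_iff[of f C x y \<phi>] f xy(3) xyw by simp
    qed
    have "f \<in> ?L \<longleftrightarrow> f \<in> ?R" for f
    proof (cases "f \<in> bedges C'")
      case False
      then have "f \<notin> ?L" "f \<noteq> e1" "f \<noteq> e2" "f \<notin> crossing C \<phi> - {e}"
        using crossing_subset[of C' "\<phi>(w := b)"] crossing_subset[of C \<phi>] E' by blast+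
      then show ?thesis by simp
    next
      case True
      consider "f = e1" | "f = e2" | "f \<noteq> e1" "f \<noteq> e2" by blast
      then show ?thesis
      proof cases
        case 1
        have "e1 \<notin> crossing C \<phi> - {e}" using e(4) crossing_subset[of C \<phi>] by blast
        then show ?thesis unfolding 1 c1 using e(3) by simp
      next
        case 2
        have "e2 \<notin> crossing C \<phi> - {e}" using e(5) crossing_subset[of C \<phi>] by blast
        then show ?thesis unfolding 2 c2 using e(3) by simp
      next
        case 3
        then show ?thesis using c3[OF old_in[OF True 3]] old_in[OF True 3] by simp
      qed
    qed
    then show ?thesis by blast
  qed
  have e_cross: "e \<in> crossing C \<phi> \<longleftrightarrow> \<phi> u \<noteq> \<phi> v" for \<phi> by (rule in_crossing_iff[OF e(1,2)])
  have lfw: "(\<phi>(w := b)) (leaf C' i) = \<phi> (leaf C i)" if "i \<in> {1..n}" for \<phi> :: "nat \<Rightarrow> bool" and b i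
    using lf[OF that] lfC'[OF that] w by auto
  note lam = cut_systemD(1)[OF S]
  have lam': "laminar n (bedges C') S'"
    using lam \<pi> unfolding laminar_def by simp
  obtain e0 where e0: "e0 \<in> bedges C" "n + 2 \<in> S e0" using cut_systemD(2)[OF S] by blast
  have ex: "\<exists>f\<in>bedges C'. n + 2 \<in> S' f"
  proof (cases "e0 = e")
    case True
    then show ?thesis using e0 E' by (auto simp: S'_def)
  next
    case False
    then have "e0 \<in> bedges C - {e}" using e0 by simp
    then have "e0 \<in> bedges C'" "S' e0 = S e0" using E' e(4,5) by (auto simp: S'_def)
    then show ?thesis using e0 by auto
  qed
  have nb: "nonbridge C' f" if f: "f \<in> bedges C'" "n + 2 \<in> S' f" for f
    unfolding nonbridge_def
  proof (intro conjI notI)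
    assume "\<exists>\<psi>. crossing C' \<psi> = {f}"
    then obtain \<psi> where \<psi>: "crossing C' \<psi> = {f}" by blast
    have eq: "(crossing C \<psi> - {e}) \<union> (if \<psi> u \<noteq> \<psi> w then {e1} else {}) \<union>
        (if \<psi> v \<noteq> \<psi> w then {e2} else {}) = {f}"
      using ext[of \<psi> "\<psi> w"] \<psi> unfolding fun_upd_triv by simp
    have "nonbridge C (\<pi> f)" using cut_systemD(3)[OF S \<pi>(1)[OF f(1)]] f \<pi>(2)[OF f(1)] by simp
    moreover have "crossing C \<psi> = {\<pi> f}"
    proof (cases "f = e1 \<or> f = e2")
      case True
      have "crossing C \<psi> - {e} \<subseteq> {f}" using eq by blast
      moreover have "f \<notin> crossing C \<psi> - {e}" using True e(4,5) crossing_subset[of C \<psi>] by blast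
      ultimately have "crossing C \<psi> - {e} = {}" by blast
      moreover have "(\<psi> u \<noteq> \<psi> w) \<noteq> (\<psi> v \<noteq> \<psi> w)"
      proof (cases "\<psi> u \<noteq> \<psi> w"; cases "\<psi> v \<noteq> \<psi> w")
        assume "\<psi> u \<noteq> \<psi> w" "\<psi> v \<noteq> \<psi> w"
        then have "e1 \<in> {f}" "e2 \<in> {f}" using eq by auto
        then show ?thesis using e(3) by simp
      next
        assume "\<not> \<psi> u \<noteq> \<psi> w" "\<not> \<psi> v \<noteq> \<psi> w"
        then have "crossing C \<psi> - {e} = {f}" using eq by simp
        then show ?thesis using \<open>crossing C \<psi> - {e} = {}\<close> by simp
      qed simp_all
      then have "e \<in> crossing C \<psi>" using e_cross[of \<psi>] by blast
      moreover have "\<pi> f = e" using True by (simp add: \<pi>_def)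
      ultimately show ?thesis by blast
    next
      case False
      have "\<psi> u = \<psi> w" using eq False by (auto split: if_splits)
      moreover have "\<psi> v = \<psi> w" using eq False by (auto split: if_splits)
      ultimately have "crossing C \<psi> - {e} = {f}" "e \<notin> crossing C \<psi>" using eq e_cross[of \<psi>] by simp_all
      then show ?thesis using False by (simp add: \<pi>_def)
    qed
    ultimately show False unfolding nonbridge_def by blast
  qed (use f in simp)
  have bridge: "\<exists>\<phi>. crossing C' \<phi> = {f} \<and> (\<forall>i\<in>{1..n}. \<phi> (leaf C' i) \<longleftrightarrow> i \<in> S' f) \<and>
        (\<forall>g\<in>bedges C'. n + 2 \<in> S' g \<longrightarrow> (\<forall>x\<in>ends C' g. \<not> \<phi> x))"
    if f: "f \<in> bedges C'" "n + 2 \<notin> S' f" for f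
  proof -
    have "n + 2 \<notin> S (\<pi> f)" using f \<pi>(2) by simp
    then obtain \<phi> where \<phi>: "crossing C \<phi> = {\<pi> f}" "\<forall>i\<in>{1..n}. \<phi> (leaf C i) \<longleftrightarrow> i \<in> S (\<pi> f)"
      "\<forall>g\<in>bedges C. n + 2 \<in> S g \<longrightarrow> (\<forall>x\<in>ends C g. \<not> \<phi> x)"
      using cut_systemD(4)[OF S \<pi>(1)[OF f(1)]] by blast
    \<comment> \<open>at the first half of the edge, the new vertex goes with the end of the other half\<close>
    define b where "b = (if f = e1 then \<phi> v else \<phi> u)"
    have "crossing C' (\<phi>(w := b)) = {f}"
    proof -
      consider "f = e1" | "f = e2" | "f \<noteq> e1" "f \<noteq> e2" by blast
      then show ?thesis
      proof cases
        case 1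
        then have "\<pi> f = e" by (simp add: \<pi>_def)
        then have c: "crossing C \<phi> - {e} = {}" and "\<phi> u \<noteq> \<phi> v" using \<phi>(1) e_cross[of \<phi>] by auto
        then show ?thesis unfolding ext c using 1 by (simp add: b_def)
      next
        case 2
        then have "\<pi> f = e" by (simp add: \<pi>_def)
        then have c: "crossing C \<phi> - {e} = {}" and "\<phi> u \<noteq> \<phi> v" using \<phi>(1) e_cross[of \<phi>] by auto
        then show ?thesis unfolding ext c using 2 e(3) by (simp add: b_def)
      next
        case 3
        have "f \<noteq> e" using old_in[OF f(1) 3] by blast
        then have "\<phi> u = \<phi> v" "crossing C \<phi> - {e} = {f}"
          using \<phi>(1) e_cross[of \<phi>] 3 by (auto simp: \<pi>_def)
        then show ?thesis unfolding ext using 3 by (simp add: b_def)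
      qed
    qed
    moreover have "\<not> (\<phi>(w := b)) x" if g: "g \<in> bedges C'" "n + 2 \<in> S' g" "x \<in> ends C' g" for g x
    proof -
      have 0: "\<not> \<phi> y" if "y \<in> ends C (\<pi> g)" for y
        using \<phi>(3) \<pi>(1)[OF g(1)] g(2) \<pi>(2)[OF g(1)] that by auto
      show ?thesis
      proof (cases "g = e1 \<or> g = e2")
        case True
        then have "\<not> \<phi> u" "\<not> \<phi> v" using 0 e(2) by (auto simp: \<pi>_def)
        moreover have "x = u \<or> x = v \<or> x = w" using True g(3) ends by auto
        ultimately show ?thesis by (auto simp: b_def)
      next
        case False
        then have "g \<in> bedges C - {e}" using old_in[OF g(1)] by blast
        then have "x \<in> ends C g" "x \<in> verts C" using g(3) old fin_graph_ends[OF G, of g x] by auto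
        then show ?thesis using 0[of x] False w by (auto simp: \<pi>_def)
      qed
    qed
    ultimately show ?thesis using \<phi>(2) lfw \<pi>(2)[OF f(1)] by (intro exI[of _ "\<phi>(w := b)"]) simp
  qed
  have pair: "\<exists>\<phi>. crossing C' \<phi> = {f, g} \<and> (\<forall>i\<in>{1..n}. \<phi> (leaf C' i) \<longleftrightarrow> (i \<in> S' f) \<noteq> (i \<in> S' g))"
    if fg: "f \<in> bedges C'" "g \<in> bedges C'" "n + 2 \<in> S' f" "n + 2 \<in> S' g" "f \<noteq> g" for f g
  proof (cases "\<pi> f = \<pi> g")
    case True
    then have ee: "{f, g} = {e1, e2}"
      using fg(5) old_in[OF fg(1)] old_in[OF fg(2)] unfolding \<pi>_def by (auto split: if_splits)
    have "crossing C (\<lambda>x. False) = {}" by (simp add: crossing_def)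
    then have "crossing C' ((\<lambda>x. False)(w := True)) = {e1, e2}" unfolding ext by auto
    moreover have "\<forall>i\<in>{1..n}. ((\<lambda>x. False)(w := True)) (leaf C' i) \<longleftrightarrow> (i \<in> S' f) \<noteq> (i \<in> S' g)"
    proof
      fix i assume "i \<in> {1..n}"
      then have "((\<lambda>x. False)(w := True)) (leaf C' i) = False" by (rule lfw)
      then show "((\<lambda>x. False)(w := True)) (leaf C' i) \<longleftrightarrow> (i \<in> S' f) \<noteq> (i \<in> S' g)"
        using True \<pi>(2)[OF fg(1)] \<pi>(2)[OF fg(2)] by simp
    qed
    ultimately show ?thesis using ee by (intro exI[of _ "(\<lambda>x. False)(w := True)"]) simp
  next
    case False
    obtain \<phi> where \<phi>: "crossing C \<phi> = {\<pi> f, \<pi> g}"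
      "\<forall>i\<in>{1..n}. \<phi> (leaf C i) \<longleftrightarrow> (i \<in> S (\<pi> f)) \<noteq> (i \<in> S (\<pi> g))"
      using cut_systemD(5)[OF S \<pi>(1)[OF fg(1)] \<pi>(1)[OF fg(2)] _ _ False] \<pi>(2) fg by auto
    define b where "b = (if f = e1 \<or> g = e1 then \<phi> v else \<phi> u)"
    have "crossing C' (\<phi>(w := b)) = {f, g}"
    proof -
      have \<pi>e: "\<pi> h = e \<longleftrightarrow> h = e1 \<or> h = e2" if "h \<in> bedges C'" for h
        using old_in[OF that] by (auto simp: \<pi>_def)
      consider "e \<notin> {\<pi> f, \<pi> g}" | "\<pi> f = e" "\<pi> g \<noteq> e" | "\<pi> g = e" "\<pi> f \<noteq> e" using False by auto
      then show ?thesis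
      proof cases
        case 1
        then have ne: "f \<noteq> e1" "f \<noteq> e2" "g \<noteq> e1" "g \<noteq> e2" using \<pi>e fg(1,2) by blast+
        then have "\<pi> f = f" "\<pi> g = g" by (simp_all add: \<pi>_def)
        moreover have "\<phi> u = \<phi> v" using 1 \<phi>(1) e_cross[of \<phi>] by blast
        ultimately show ?thesis unfolding ext using 1 \<phi>(1) ne by (auto simp: b_def)
      next
        case 2
        then have g: "g \<noteq> e1" "g \<noteq> e2" "\<pi> g = g" using \<pi>e fg(2) by (auto simp: \<pi>_def)
        have uv': "\<phi> u \<noteq> \<phi> v" using 2 \<phi>(1) e_cross[of \<phi>] by blast
        have c: "crossing C \<phi> - {e} = {g}" using \<phi>(1) 2 g by auto
        have "f = e1 \<or> f = e2" using \<pi>e[OF fg(1)] 2 by blast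
        then show ?thesis unfolding ext c using g uv' e(3) by (elim disjE) (auto simp: b_def)
      next
        case 3
        then have f: "f \<noteq> e1" "f \<noteq> e2" "\<pi> f = f" using \<pi>e fg(1) by (auto simp: \<pi>_def)
        have uv': "\<phi> u \<noteq> \<phi> v" using 3 \<phi>(1) e_cross[of \<phi>] by blast
        have c: "crossing C \<phi> - {e} = {f}" using \<phi>(1) 3 f by auto
        have "g = e1 \<or> g = e2" using \<pi>e[OF fg(2)] 3 by blast
        then show ?thesis unfolding ext c using f uv' e(3) by (elim disjE) (auto simp: b_def)
      qed
    qed
    then show ?thesis using \<phi>(2) lfw \<pi>(2)[OF fg(1)] \<pi>(2)[OF fg(2)]
      by (intro exI[of _ "\<phi>(w := b)"]) simp
  qed
  have "cut_system n C' S'"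
    unfolding cut_system_def using lam' ex nb bridge pair by (intro conjI ballI impI) simp_all
  moreover have "split_vec n (bedges C') (len C') S' = split_vec n (bedges C) (len C) S"
    unfolding split_vec_def
  proof (rule restrict_ext)
    fix t assume "t \<in> pairs n"
    let ?h = "\<lambda>l R f. l f * of_bool (card (R f \<inter> t) = 1) :: real"
    have fin: "finite (bedges C - {e})" "finite (bedges C)" using G by (simp_all add: fin_graph_def)
    have "{e1, e2} \<inter> (bedges C - {e}) = {}" using e(4,5) by blast
    then have "(\<Sum>f\<in>bedges C'. ?h (len C') S' f) =
        (\<Sum>f\<in>{e1, e2}. ?h (len C') S' f) + (\<Sum>f\<in>bedges C - {e}. ?h (len C') S' f)"
      unfolding E' by (intro sum.union_disjoint) (use fin in auto)
    also have "(\<Sum>f\<in>{e1, e2}. ?h (len C') S' f) = ?h (len C) S e"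
      using e(3) len by (simp add: S'_def distrib_right[symmetric])
    also have "(\<Sum>f\<in>bedges C - {e}. ?h (len C') S' f) = (\<Sum>f\<in>bedges C - {e}. ?h (len C) S f)"
      using old e(4,5) by (intro sum.cong) (auto simp: S'_def)
    also have "?h (len C) S e + (\<Sum>f\<in>bedges C - {e}. ?h (len C) S f) = (\<Sum>f\<in>bedges C. ?h (len C) S f)"
      by (rule sum.remove[OF fin(2) e(1), symmetric])
    finally show "(\<Sum>f\<in>bedges C'. ?h (len C') S' f) = (\<Sum>f\<in>bedges C. ?h (len C) S f)" .
  qed
  ultimately show ?thesis by (rule that)
qed

lemma cut_system_total_pos:
  assumes "cut_system n C S" "finite (bedges C)" "\<And>e. e \<in> bedges C \<Longrightarrow> 0 < l e"
  shows "0 < total_len n (bedges C) l S"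
proof -
  obtain e where e: "e \<in> bedges C" "n + 2 \<in> S e" using cut_systemD(2)[OF assms(1)] by blast
  then have "l e \<le> total_len n (bedges C) l S"
    by (intro cycle_edge_length_bound) (use assms less_imp_le in auto)
  then show ?thesis using assms(3)[OF e(1)] by simp
qed

lemma cut_tree_Psi:
  assumes C: "C \<in> elliptic_curves n" and D: "cut_tree n C D" and S: "cut_system n C S"
  shows "Psi n (Vclass n (dist_vec n D)) = Psi n (Vclass n (split_vec n (bedges C) (len C) S))"
proof -
  have G: "fin_graph C" and lf: "\<And>i. i \<in> {1..n} \<Longrightarrow> leaf C i \<in> verts C"
    and len: "\<And>e. e \<in> bedges C \<Longrightarrow> 0 < len C e"
    using C unfolding elliptic_curves_iff by blast+
  obtain C' a where C': "C' = C \<or> subdivides n C a C'" and sp: "splits n C' a D"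
    and tree: "tropical_tree (n + 2) D" using D unfolding cut_tree_def by blast
  obtain SD where SD: "cut_system n C' SD" "dist_vec n D = split_vec n (bedges C') (len C') SD"
    and G': "fin_graph C'" "cut_conn C'" and lf': "\<forall>i\<in>{1..n}. leaf C' i \<in> verts C'"
    by (rule splits_cut_system[OF tree sp])
  obtain S' where S': "cut_system n C' S'"
    "split_vec n (bedges C') (len C') S' = split_vec n (bedges C) (len C) S"
  proof (cases "C' = C")
    case True
    then show ?thesis using that[of S] S by simp
  next
    case False
    then have "subdivides n C a C'" using C' by blast
    then show ?thesis by (rule subdivides_cut_system[OF _ G _ S]) (use lf that in simp_all)
  qed
  have lenD: "0 < len D e" if "e \<in> bedges D" for e
    using tree that unfolding tropical_tree_def abstract_curve_iff by blast
  have "invs n (split_vec n (bedges C') (len C') SD) = invs n (split_vec n (bedges C') (len C') S')"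
    by (rule cut_system_invs[OF G' _ S'(1) SD(1)]) (use lf' in blast)
  then have inv: "invs n (split_vec n (bedges C') (len C') SD) = invs n (split_vec n (bedges C) (len C) S)"
    using S'(2) by simp
  have E': "bedges C' = bedges D" "\<And>e. e \<in> bedges C' \<Longrightarrow> len C' e = len D e"
    using sp unfolding splits_def by simp_all
  have fin: "finite (bedges C)" using G by (simp add: fin_graph_def)
  show ?thesis
    unfolding SD(2)
  proof (rule Psi_eq_if_invs_eq[OF cut_systemD(1)[OF S] cut_systemD(1)[OF SD(1)] _ _ _ inv])
    show "0 < total_len n (bedges C) (len C) S" by (rule cut_system_total_pos[OF S fin len])
  qed (use len lenD E' in \<open>auto intro: less_imp_le\<close>)
qed

text \<open>The vertex \<open>v\<^sub>0\<close> is split such that only the edge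
  \<open>e\<^sub>0\<close> is moved to the new vertex \<open>w\<close>.\<close>

lemma (in rooted_cut) cut_tree_exists:
  assumes len: "\<And>e. e \<in> bedges C \<Longrightarrow> 0 < len C e" and uni: "\<exists>!Z. simple_cycle C Z"
  shows "\<exists>D. cut_tree n C D"
proof -
  obtain w where w: "w \<notin> verts C" using ex_new_if_finite[OF infinite_UNIV_nat fin_verts] by blast
  define D where "D = \<lparr>verts = insert w (verts C), bedges = bedges C, ends = (ends C)(e\<^sub>0 := {w, u}),
    len = len C, leaf = (leaf C)(n + 1 := v\<^sub>0, n + 2 := w)\<rparr>"
  have D: "verts D = insert w (verts C)" "bedges D = bedges C" "ends D e\<^sub>0 = {w, u}"
    "\<And>e. e \<noteq> e\<^sub>0 \<Longrightarrow> ends D e = ends C e" "len D = len C" "leaf D (n + 1) = v\<^sub>0" "leaf D (n + 2) = w"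
    "\<And>i. i \<in> {1..n} \<Longrightarrow> leaf D i = leaf C i"
    by (auto simp: D_def)
  have wu: "u \<noteq> w" "v\<^sub>0 \<noteq> w" using w u_in v0_in by blast+
  have old: "f \<in> crossing D \<phi> \<longleftrightarrow> f \<in> crossing C \<phi>" if "f \<in> E" for f \<phi>
    using that D by (simp add: crossing_def)
  have new: "e\<^sub>0 \<in> crossing D \<phi> \<longleftrightarrow> \<phi> w \<noteq> \<phi> u" for \<phi>
    by (rule in_crossing_iff) (use D e0_in in simp_all)
  have finD: "fin_graph D"
    unfolding fin_graph_def
  proof (intro conjI ballI)
    show "finite (verts D)" "finite (bedges D)" using fin D by (simp_all add: fin_graph_def)
    fix e assume e: "e \<in> bedges D"
    show "\<exists>u\<in>verts D. \<exists>v\<in>verts D. ends D e = {u, v}"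
    proof (cases "e = e\<^sub>0")
      case True
      then show ?thesis using D(1,3) u_in by blast
    next
      case False
      have "e \<in> bedges C" using e D by simp
      then obtain x y where "x \<in> verts C" "y \<in> verts C" "ends C e = {x, y}" by (rule fin_graph_endsE[OF fin])
      then show ?thesis using D(1) D(4)[OF False] by blast
    qed
  qed
  have connD: "cut_conn D"
    unfolding cut_conn_def
  proof (intro allI impI ballI)
    fix \<phi> x y assume *: "crossing D \<phi> = {}" "x \<in> verts D" "y \<in> verts D"
    have "crossing T \<phi> = {}"
      using *(1) old[of _ \<phi>] crossing_subset[of C \<phi>] unfolding crossing_delete_edge by blast
    then have c: "\<phi> z = \<phi> u" if "z \<in> verts C" for z
      using cut_conn_const[OF connT, of \<phi> z u] that u_in by simp
    have "\<phi> w = \<phi> u" using new[of \<phi>] *(1) by blast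
    then have "\<phi> z = \<phi> u" if "z \<in> verts D" for z using c[of z] that D(1) by auto
    then show "\<phi> x = \<phi> y" using *(2,3) by simp
  qed
  have "\<exists>\<phi>. crossing D \<phi> = {f}" if f: "f \<in> bedges D" for f
  proof (cases "f = e\<^sub>0")
    case True
    have "g \<notin> crossing D (\<lambda>x. x = w)" if "g \<in> E" for g
    proof -
      have "w \<notin> ends C g" using that fin_graph_ends[OF fin, of g w] w by blast
      then show ?thesis using old[OF that] by (auto simp: crossing_def)
    qed
    then have "crossing D (\<lambda>x. x = w) = {e\<^sub>0}"
      using new[of "\<lambda>x. x = w"] wu crossing_subset[of D "\<lambda>x. x = w"] D(2) by blast
    then show ?thesis using True by blast
  next
    case False
    then have fE: "f \<in> E" using f D by simp
    let ?\<phi> = "(W f)(w := W f u)"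
    have "g \<in> crossing D ?\<phi> \<longleftrightarrow> g \<in> {f}" for g
    proof -
      consider "g \<notin> bedges C" | "g = e\<^sub>0" | "g \<in> E" by blast
      then show ?thesis
      proof cases
        case 1
        then show ?thesis using fE crossing_subset[of D ?\<phi>] D(2) by blast
      next
        case 2
        then show ?thesis using new[of ?\<phi>] wu False by simp
      next
        case 3
        have "crossing C ?\<phi> = crossing C (W f)" by (rule crossing_cong[OF fin]) (use w in auto)
        then have "g \<in> crossing D ?\<phi> \<longleftrightarrow> g \<in> crossing C (W f)" using old[OF 3] by simp
        moreover have "g \<in> crossing C (W f) \<longleftrightarrow> g \<in> crossing T (W f)"
          using 3 by (simp add: crossing_delete_edge)
        ultimately show ?thesis using W fE by simp
      qed
    qed
    then show ?thesis by blast
  qed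
  then have no_cycle: "\<nexists>Z. simple_cycle D Z"
    using nonbridge_in_cycle[of D] unfolding nonbridge_def simple_cycle_def by (metis last_in_set)
  have tree: "tropical_tree (n + 2) D"
    unfolding tropical_tree_def abstract_curve_iff
  proof (intro conjI ballI no_cycle finD connD)
    show "leaf D ` {1..n + 2} \<subseteq> verts D"
    proof
      fix x assume "x \<in> leaf D ` {1..n + 2}"
      then obtain i where i: "i \<in> {1..n + 2}" "x = leaf D i" by blast
      then have "i \<in> {1..n} \<or> i = n + 1 \<or> i = n + 2" by auto
      then show "x \<in> verts D" using i(2) D leaf v0_in by auto
    qed
  qed (use D len in auto)
  have cyc: "on_cycle C v\<^sub>0"
  proof -
    obtain Z where Z: "simple_cycle C Z" using uni by blast
    have "e\<^sub>0 \<in> Z"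
    proof (rule ccontr)
      assume n: "e\<^sub>0 \<notin> Z"
      then have ZT: "simple_cycle T Z" using Z by (simp add: simple_cycle_delete_edge)
      obtain f where f: "f \<in> Z" using Z by (force simp: simple_cycle_def)
      then have "nonbridge T f" by (rule nonbridge_in_cycle[OF ZT])
      then have "f \<in> E" "crossing T (W f) \<noteq> {f}" unfolding nonbridge_def by auto
      then show False using W by simp
    qed
    then show ?thesis unfolding on_cycle_def using Z ends0 by blast
  qed
  have "splits n C v\<^sub>0 D"
    unfolding splits_def
  proof (intro conjI exI[of _ "\<lambda>x. if x = w then v\<^sub>0 else x"])
    show "(\<lambda>x. if x = w then v\<^sub>0 else x) ` verts D = verts C" using D(1) v0_in w by auto
    show "inj_on (\<lambda>x. if x = w then v\<^sub>0 else x) (verts D - {leaf D (n + 1)})"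
      unfolding D(6) by (auto simp: inj_on_def)
    show "\<forall>e\<in>bedges C. ends D e \<subseteq> verts D \<and> ends C e = (\<lambda>x. if x = w then v\<^sub>0 else x) ` ends D e"
    proof
      fix e assume e: "e \<in> bedges C"
      show "ends D e \<subseteq> verts D \<and> ends C e = (\<lambda>x. if x = w then v\<^sub>0 else x) ` ends D e"
      proof (cases "e = e\<^sub>0")
        case True
        then show ?thesis using D(1,3) ends0 wu u_in by auto
      next
        case False
        have sub: "ends C e \<subseteq> verts C" using fin_graph_ends[OF fin e] by blast
        then have "(\<lambda>x. if x = w then v\<^sub>0 else x) ` ends C e = (\<lambda>x. x) ` ends C e"
          using w by (intro image_cong) auto
        then show ?thesis using D(1) D(4)[OF False] sub by auto
      qed
    qed
    show "\<forall>i\<in>{1..n}. leaf D i \<in> verts D \<and> leaf C i = (if leaf D i = w then v\<^sub>0 else leaf D i)"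
    proof
      fix i assume i: "i \<in> {1..n}"
      have "leaf C i \<in> verts C" by (rule leaf[OF i])
      then have "leaf C i \<noteq> w" using w by blast
      then show "leaf D i \<in> verts D \<and> leaf C i = (if leaf D i = w then v\<^sub>0 else leaf D i)"
        using D(1) D(8)[OF i] \<open>leaf C i \<in> verts C\<close> by simp
    qed
  qed (use D wu v0_in w in auto)
  then have "cut_tree n C D" unfolding cut_tree_def using cyc tree by blast
  then show ?thesis by blast
qed

lemma cut_sides_exist:
  assumes C: "C \<in> elliptic_curves n"
  obtains S where "cut_sides n C S"
proof -
  obtain e\<^sub>0 where e0: "nonbridge C e\<^sub>0" using C unfolding elliptic_curves_iff unicyclic_at_def by blast
  have "fin_graph C" using C unfolding elliptic_curves_iff by blast
  then obtain v\<^sub>0 u where "ends C e\<^sub>0 = {v\<^sub>0, u}"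
    using e0 fin_graph_endsE unfolding nonbridge_def by metis
  then obtain W where "rooted_cut n C e\<^sub>0 v\<^sub>0 u W" using rooted_cut_exists[OF C e0] by blast
  then show ?thesis using that cut_sidesI by blast
qed

lemma cut_tree_exists:
  assumes C: "C \<in> elliptic_curves n"
  obtains D where "cut_tree n C D"
proof -
  obtain S where "cut_sides n C S" using C by (rule cut_sides_exist)
  then obtain e\<^sub>0 v\<^sub>0 u W where R: "rooted_cut n C e\<^sub>0 v\<^sub>0 u W" by (rule cut_sidesE)
  have "\<exists>!Z. simple_cycle C Z" using C unfolding elliptic_curves_def by blast
  moreover have "0 < len C e" if "e \<in> bedges C" for e using C that unfolding elliptic_curves_iff by blast
  ultimately show ?thesis using rooted_cut.cut_tree_exists[OF R] that by blast
qed

section \<open>Isomorphisms and the distance class\<close>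

lemma curve_iso_refl: "curve_iso n C C"
  unfolding curve_iso_def
  by (intro exI[of _ "\<lambda>x. x"]) (auto simp: bij_betw_def)

lemma curve_iso_sym:
  assumes "fin_graph C" "\<And>i. i \<in> {1..n} \<Longrightarrow> leaf C i \<in> verts C" "curve_iso n C D"
  shows "curve_iso n D C"
proof -
  obtain f g where f: "bij_betw f (verts C) (verts D)" and g: "bij_betw g (bedges C) (bedges D)"
    and e: "\<forall>e\<in>bedges C. ends D (g e) = f ` ends C e \<and> len D (g e) = len C e"
    and l: "\<forall>i\<in>{1..n}. leaf D i = f (leaf C i)"
    using assms(3) unfolding curve_iso_def by (elim exE conjE)
  let ?f = "inv_into (verts C) f" and ?g = "inv_into (bedges C) g"
  have inj: "inj_on f (verts C)" using f by (simp add: bij_betw_def)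
  have E: "ends C (?g e) = ?f ` ends D e \<and> len C (?g e) = len D e" if e': "e \<in> bedges D" for e
  proof -
    have ge: "?g e \<in> bedges C" "g (?g e) = e"
      using bij_betw_inv_into[OF g] e' bij_betwE bij_betw_inv_into_right[OF g e'] by blast+
    have "ends D e = f ` ends C (?g e)" "len D e = len C (?g e)" using bspec[OF e ge(1)] ge(2) by simp_all
    moreover have "ends C (?g e) \<subseteq> verts C" using fin_graph_ends[OF assms(1) ge(1)] by blast
    ultimately show ?thesis using inv_into_image_cancel[OF inj] by simp
  qed
  have L: "leaf C i = ?f (leaf D i)" if i: "i \<in> {1..n}" for i
    using bspec[OF l i] inv_into_f_f[OF inj assms(2)[OF i]] by simp
  show ?thesis
    unfolding curve_iso_def
    using bij_betw_inv_into[OF f] bij_betw_inv_into[OF g] E L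
    by (intro exI[of _ ?f] exI[of _ ?g]) simp
qed

lemma curve_iso_trans:
  assumes "curve_iso n C D" "curve_iso n D F"
  shows "curve_iso n C F"
proof -
  obtain f g where f: "bij_betw f (verts C) (verts D)" and g: "bij_betw g (bedges C) (bedges D)"
    and e: "\<forall>e\<in>bedges C. ends D (g e) = f ` ends C e \<and> len D (g e) = len C e"
    and l: "\<forall>i\<in>{1..n}. leaf D i = f (leaf C i)"
    using assms(1) unfolding curve_iso_def by (elim exE conjE)
  obtain f' g' where f': "bij_betw f' (verts D) (verts F)" and g': "bij_betw g' (bedges D) (bedges F)"
    and e': "\<forall>e\<in>bedges D. ends F (g' e) = f' ` ends D e \<and> len F (g' e) = len D e"
    and l': "\<forall>i\<in>{1..n}. leaf F i = f' (leaf D i)"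
    using assms(2) unfolding curve_iso_def by (elim exE conjE)
  have "ends F ((g' \<circ> g) x) = (f' \<circ> f) ` ends C x \<and> len F ((g' \<circ> g) x) = len C x" if x: "x \<in> bedges C" for x
  proof -
    have "g x \<in> bedges D" using g x bij_betwE by blast
    then show ?thesis using bspec[OF e x] bspec[OF e', of "g x"] by (simp add: image_comp)
  qed
  moreover have "leaf F i = (f' \<circ> f) (leaf C i)" if "i \<in> {1..n}" for i
    using bspec[OF l that] bspec[OF l' that] by simp
  ultimately show ?thesis
    unfolding curve_iso_def using bij_betw_trans[OF f f'] bij_betw_trans[OF g g']
    by (intro exI[of _ "f' \<circ> f"] exI[of _ "g' \<circ> g"]) simp
qed

lemma elliptic_leaf: "C \<in> elliptic_curves n \<Longrightarrow> i \<in> {1..n} \<Longrightarrow> leaf C i \<in> verts C"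
  unfolding elliptic_curves_iff by blast

lemma elliptic_fin: "C \<in> elliptic_curves n \<Longrightarrow> fin_graph C"
  and elliptic_conn: "C \<in> elliptic_curves n \<Longrightarrow> cut_conn C"
  and elliptic_len: "C \<in> elliptic_curves n \<Longrightarrow> e \<in> bedges C \<Longrightarrow> 0 < len C e"
  unfolding elliptic_curves_iff by blast+

lemma elliptic_finite: "C \<in> elliptic_curves n \<Longrightarrow> finite (bedges C)"
  using elliptic_fin unfolding fin_graph_def by blast

lemma equiv_iso_rel: "equiv (elliptic_curves n) (iso_rel n)"
proof (rule equivI)
  show "iso_rel n \<subseteq> elliptic_curves n \<times> elliptic_curves n" by (auto simp: iso_rel_def)
  show "refl_on (elliptic_curves n) (iso_rel n)"
    by (auto simp: refl_on_def iso_rel_def curve_iso_refl)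
  show "sym (iso_rel n)"
    unfolding sym_def iso_rel_def using curve_iso_sym elliptic_fin elliptic_leaf by blast
  show "trans (iso_rel n)"
    unfolding trans_def iso_rel_def using curve_iso_trans by blast
qed

lemma M1_class: "C \<in> elliptic_curves n \<Longrightarrow> iso_rel n `` {C} \<in> M1 n"
  unfolding M1_def by (rule quotientI)

lemma M1_rep:
  assumes "c \<in> M1 n"
  obtains C where "C \<in> elliptic_curves n" "c = iso_rel n `` {C}"
  using assms unfolding M1_def by (rule quotientE)

lemma cut_system_iso:
  assumes G: "fin_graph C" and f: "bij_betw f (verts C) (verts D)" and g: "bij_betw g (bedges C) (bedges D)"
    and e: "\<And>e. e \<in> bedges C \<Longrightarrow> ends D (g e) = f ` ends C e"
    and l: "\<And>i. i \<in> {1..n} \<Longrightarrow> leaf D i = f (leaf C i)" and lf: "\<And>i. i \<in> {1..n} \<Longrightarrow> leaf C i \<in> verts C"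
    and S: "cut_system n D S"
  shows "cut_system n C (\<lambda>e. S (g e))"
proof -
  have gE: "g x \<in> bedges D" if "x \<in> bedges C" for x using g that bij_betwE by blast
  have ginj: "inj_on g (bedges C)" using g by (simp add: bij_betw_def)
  have pull: "x \<in> crossing C (\<lambda>y. \<phi> (f y)) \<longleftrightarrow> g x \<in> crossing D \<phi>" if x: "x \<in> bedges C" for \<phi> x
  proof -
    have "x \<in> crossing C (\<lambda>y. \<phi> (f y)) \<longleftrightarrow> (\<exists>a\<in>ends C x. \<exists>b\<in>ends C x. \<phi> (f a) \<noteq> \<phi> (f b))"
      using x by (simp add: crossing_def)
    also have "\<dots> \<longleftrightarrow> (\<exists>a\<in>ends D (g x). \<exists>b\<in>ends D (g x). \<phi> a \<noteq> \<phi> b)"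
      unfolding e[OF x] bex_simps ..
    also have "\<dots> \<longleftrightarrow> g x \<in> crossing D \<phi>" using gE[OF x] by (simp add: crossing_def)
    finally show ?thesis .
  qed
  have single: "crossing C (\<lambda>y. \<phi> (f y)) = X" if "X \<subseteq> bedges C" "crossing D \<phi> = g ` X" for \<phi> X
  proof -
    have "x \<in> crossing C (\<lambda>y. \<phi> (f y)) \<longleftrightarrow> x \<in> X" if x: "x \<in> bedges C" for x
      unfolding pull[OF x] \<open>crossing D \<phi> = g ` X\<close>
      using inj_on_image_mem_iff[OF ginj x \<open>X \<subseteq> bedges C\<close>] .
    then show ?thesis using crossing_subset[of C] \<open>X \<subseteq> bedges C\<close> by blast
  qed
  have lam: "laminar n (bedges C) (\<lambda>e. S (g e))"
    using cut_systemD(1)[OF S] gE unfolding laminar_def by simp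
  have surj: "\<exists>x\<in>bedges C. y = g x" if "y \<in> bedges D" for y using g that unfolding bij_betw_def by blast
  have ex: "\<exists>x\<in>bedges C. n + 2 \<in> S (g x)" using cut_systemD(2)[OF S] surj by blast
  have nb: "nonbridge C x" if x: "x \<in> bedges C" "n + 2 \<in> S (g x)" for x
    unfolding nonbridge_def
  proof (intro conjI notI)
    assume "\<exists>\<phi>. crossing C \<phi> = {x}"
    then obtain \<phi> where \<phi>: "crossing C \<phi> = {x}" by blast
    define \<psi> where "\<psi> y = \<phi> (inv_into (verts C) f y)" for y
    have finj: "inj_on f (verts C)" using f by (simp add: bij_betw_def)
    have "crossing C (\<lambda>y. \<psi> (f y)) = crossing C \<phi>"
      by (rule crossing_cong[OF G]) (simp add: \<psi>_def inv_into_f_f[OF finj])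
    then have c: "crossing C (\<lambda>y. \<psi> (f y)) = {x}" using \<phi> by simp
    have "z \<in> crossing D \<psi> \<longleftrightarrow> z = g x" for z
    proof
      assume z: "z \<in> crossing D \<psi>"
      then obtain y where y: "y \<in> bedges C" "z = g y" using surj crossing_subset[of D] by blast
      then show "z = g x" using pull[OF y(1), of \<psi>] c z by simp
    next
      assume "z = g x"
      then show "z \<in> crossing D \<psi>" using pull[OF x(1), of \<psi>] c by simp
    qed
    then have "crossing D \<psi> = {g x}" by blast
    then show False using cut_systemD(3)[OF S gE[OF x(1)]] x(2) unfolding nonbridge_def by blast
  qed (use x in simp)
  have bridge: "\<exists>\<phi>. crossing C \<phi> = {x} \<and> (\<forall>i\<in>{1..n}. \<phi> (leaf C i) \<longleftrightarrow> i \<in> S (g x)) \<and>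
        (\<forall>y\<in>bedges C. n + 2 \<in> S (g y) \<longrightarrow> (\<forall>z\<in>ends C y. \<not> \<phi> z))"
    if x: "x \<in> bedges C" "n + 2 \<notin> S (g x)" for x
  proof -
    obtain \<phi> where \<phi>: "crossing D \<phi> = {g x}" "\<forall>i\<in>{1..n}. \<phi> (leaf D i) \<longleftrightarrow> i \<in> S (g x)"
      "\<forall>y\<in>bedges D. n + 2 \<in> S y \<longrightarrow> (\<forall>z\<in>ends D y. \<not> \<phi> z)"
      using cut_systemD(4)[OF S gE[OF x(1)] x(2)] by blast
    have "crossing C (\<lambda>y. \<phi> (f y)) = {x}" by (rule single) (use x \<phi>(1) in auto)
    moreover have "\<forall>i\<in>{1..n}. \<phi> (f (leaf C i)) \<longleftrightarrow> i \<in> S (g x)" using \<phi>(2) l by simp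
    moreover have "\<not> \<phi> (f z)" if y: "y \<in> bedges C" "n + 2 \<in> S (g y)" "z \<in> ends C y" for y z
      using bspec[OF \<phi>(3) gE[OF y(1)]] y(2,3) e[OF y(1)] by simp
    ultimately show ?thesis by (intro exI[of _ "\<lambda>y. \<phi> (f y)"]) blast
  qed
  have pair: "\<exists>\<phi>. crossing C \<phi> = {x, y} \<and> (\<forall>i\<in>{1..n}. \<phi> (leaf C i) \<longleftrightarrow> (i \<in> S (g x)) \<noteq> (i \<in> S (g y)))"
    if xy: "x \<in> bedges C" "y \<in> bedges C" "n + 2 \<in> S (g x)" "n + 2 \<in> S (g y)" "x \<noteq> y" for x y
  proof -
    have "g x \<noteq> g y" using inj_onD[OF ginj _ xy(1,2)] xy(5) by blast
    then obtain \<phi> where \<phi>: "crossing D \<phi> = {g x, g y}"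
      "\<forall>i\<in>{1..n}. \<phi> (leaf D i) \<longleftrightarrow> (i \<in> S (g x)) \<noteq> (i \<in> S (g y))"
      using cut_systemD(5)[OF S gE[OF xy(1)] gE[OF xy(2)] xy(3,4)] by blast
    have "crossing C (\<lambda>y. \<phi> (f y)) = {x, y}" by (rule single) (use xy \<phi>(1) in auto)
    moreover have "\<forall>i\<in>{1..n}. \<phi> (f (leaf C i)) \<longleftrightarrow> (i \<in> S (g x)) \<noteq> (i \<in> S (g y))" using \<phi>(2) l by simp
    ultimately show ?thesis by (intro exI[of _ "\<lambda>y. \<phi> (f y)"]) blast
  qed
  show ?thesis
    unfolding cut_system_def using lam ex nb bridge pair by (intro conjI ballI impI) simp_all
qed

lemma split_vec_reindex:
  assumes "bij_betw g E E'" "\<And>e. e \<in> E \<Longrightarrow> l' (g e) = l e"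
  shows "split_vec n E' l' S = split_vec n E l (\<lambda>e. S (g e))"
  unfolding split_vec_def
proof (rule restrict_ext)
  fix t assume "t \<in> pairs n"
  have "(\<Sum>e\<in>E'. l' e * of_bool (card (S e \<inter> t) = 1)) =
      (\<Sum>e\<in>E. l' (g e) * of_bool (card (S (g e) \<inter> t) = 1))"
    by (rule sum.reindex_bij_betw[OF assms(1), symmetric])
  also have "\<dots> = (\<Sum>e\<in>E. l e * of_bool (card (S (g e) \<inter> t) = 1))"
    using assms(2) by (intro sum.cong) simp_all
  finally show "(\<Sum>e\<in>E'. l' e * of_bool (card (S e \<inter> t) = 1)) =
      (\<Sum>e\<in>E. l e * of_bool (card (S (g e) \<inter> t) = 1))" .
qed

text \<open>All cut systems have the same invariants, so they lead to the same orbit, and so do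
  all cut trees of all curves in the isomorphism class.\<close>

lemma dist_class_eq:
  assumes C: "C \<in> elliptic_curves n" and S: "cut_system n C S"
  shows "dist_class n (iso_rel n `` {C}) = Psi n (Vclass n (split_vec n (bedges C) (len C) S))"
  unfolding dist_class_def
proof (rule the_equality)
  obtain D where "cut_tree n C D" by (rule cut_tree_exists[OF C])
  moreover have "C \<in> iso_rel n `` {C}" using C by (simp add: iso_rel_def curve_iso_refl)
  ultimately show "\<exists>C'\<in>iso_rel n `` {C}. \<exists>D. cut_tree n C' D \<and>
      Psi n (Vclass n (split_vec n (bedges C) (len C) S)) = Psi n (Vclass n (dist_vec n D))"
    using cut_tree_Psi[OF C _ S] by metis
next
  fix w assume "\<exists>C'\<in>iso_rel n `` {C}. \<exists>D. cut_tree n C' D \<and> w = Psi n (Vclass n (dist_vec n D))"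
  then obtain C' D where C': "(C, C') \<in> iso_rel n" and D: "cut_tree n C' D" "w = Psi n (Vclass n (dist_vec n D))"
    by blast
  have el: "C' \<in> elliptic_curves n" and "curve_iso n C C'" using C' by (simp_all add: iso_rel_def)
  then obtain f g where f: "bij_betw f (verts C) (verts C')" and g: "bij_betw g (bedges C) (bedges C')"
    and e: "\<forall>e\<in>bedges C. ends C' (g e) = f ` ends C e \<and> len C' (g e) = len C e"
    and l: "\<forall>i\<in>{1..n}. leaf C' i = f (leaf C i)"
    unfolding curve_iso_def by (elim exE conjE)
  obtain S' where S': "cut_sides n C' S'" by (rule cut_sides_exist[OF el])
  have S'': "cut_system n C (\<lambda>e. S' (g e))"
    by (rule cut_system_iso[OF elliptic_fin[OF C] f g _ _ elliptic_leaf[OF C] cut_sides_system[OF S']])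
      (use e l in simp_all)
  have "split_vec n (bedges C') (len C') S' = split_vec n (bedges C) (len C) (\<lambda>e. S' (g e))"
    by (rule split_vec_reindex[OF g]) (use e in simp)
  moreover have "invs n (split_vec n (bedges C) (len C) (\<lambda>e. S' (g e))) = invs n (split_vec n (bedges C) (len C) S)"
    by (rule cut_system_invs[OF elliptic_fin[OF C] elliptic_conn[OF C] elliptic_leaf[OF C] S S''])
  moreover have "Psi n (Vclass n (split_vec n (bedges C) (len C) (\<lambda>e. S' (g e)))) =
      Psi n (Vclass n (split_vec n (bedges C) (len C) S))"
  proof (rule Psi_eq_if_invs_eq[OF cut_systemD(1)[OF S] cut_systemD(1)[OF S'']])
    show "0 < total_len n (bedges C) (len C) S"
      by (rule cut_system_total_pos[OF S elliptic_finite[OF C] elliptic_len[OF C]])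
    show "invs n (split_vec n (bedges C) (len C) (\<lambda>e. S' (g e))) = invs n (split_vec n (bedges C) (len C) S)"
      by fact
  qed (use elliptic_len[OF C] in \<open>auto intro: less_imp_le\<close>)
  moreover have "w = Psi n (Vclass n (split_vec n (bedges C') (len C') S'))"
    using D cut_tree_Psi[OF el D(1) cut_sides_system[OF S']] by simp
  ultimately show "w = Psi n (Vclass n (split_vec n (bedges C) (len C) S))" by simp
qed

section \<open>Recovering a weighted laminar family from its overlaps\<close>

text \<open>\<open>overlap E l S i j\<close> is the length of the common part of the paths from the root to \<open>i\<close>
  and to \<open>j\<close>.\<close>

definition overlap :: "nat set \<Rightarrow> (nat \<Rightarrow> real) \<Rightarrow> (nat \<Rightarrow> nat set) \<Rightarrow> nat \<Rightarrow> nat \<Rightarrow> real" where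
  "overlap E l S i j = (\<Sum>e\<in>{e \<in> E. i \<in> S e \<and> j \<in> S e}. l e)"

lemma overlap_mono:
  assumes "finite E" "\<And>e. e \<in> E \<Longrightarrow> 0 < l e"
    "{e \<in> E. i \<in> S e \<and> j \<in> S e} \<subseteq> {e \<in> E. i' \<in> S e \<and> j' \<in> S e}"
  shows "overlap E l S i j \<le> overlap E l S i' j'"
  unfolding overlap_def by (rule sum_mono2) (use assms less_imp_le in auto)

lemma overlap_strict:
  assumes "finite E" "\<And>e. e \<in> E \<Longrightarrow> 0 < l e"
    "{e \<in> E. i \<in> S e \<and> j \<in> S e} \<subset> {e \<in> E. i' \<in> S e \<and> j' \<in> S e}"
  shows "overlap E l S i j < overlap E l S i' j'"
proof -
  obtain b where "b \<in> {e \<in> E. i' \<in> S e \<and> j' \<in> S e}" "b \<notin> {e \<in> E. i \<in> S e \<and> j \<in> S e}" using assms(3) by blast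
  then show ?thesis
    unfolding overlap_def by (intro sum_strict_mono2[of _ _ b]) (use assms less_imp_le in auto)
qed

text \<open>Members with less than two elements are excluded, except for the side
  \<open>{b}\<close> of the edge that was cut.\<close>

definition nested_family :: "nat set \<Rightarrow> nat \<Rightarrow> nat set \<Rightarrow> (nat \<Rightarrow> nat set) \<Rightarrow> bool" where
  "nested_family J b E S \<longleftrightarrow> finite E \<and> inj_on S E \<and> (\<forall>e\<in>E. S e \<subseteq> J) \<and>
     (\<forall>e\<in>E. \<forall>f\<in>E. S e \<inter> S f \<noteq> {} \<longrightarrow> S e \<subseteq> S f \<or> S f \<subseteq> S e) \<and>
     (\<forall>e\<in>E. S e = {b} \<or> (\<exists>i\<in>S e. \<exists>j\<in>S e. i \<noteq> j)) \<and> b \<in> J"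

text \<open>The overlaps define an ultrametric, in which the member is a ball around
  \<open>i\<close>.\<close>

lemma smallest_is_ball:
  assumes fam: "nested_family J b E S" and l: "\<And>e. e \<in> E \<Longrightarrow> 0 < l e"
    and e: "e \<in> E" "i \<in> S e" "j \<in> S e" and least: "\<And>f. f \<in> E \<Longrightarrow> i \<in> S f \<Longrightarrow> j \<in> S f \<Longrightarrow> S e \<subseteq> S f"
  shows "S e = {k \<in> J. k = i \<or> overlap E l S i k \<ge> overlap E l S i j}"
proof -
  have fin: "finite E" using fam by (simp add: nested_family_def)
  have sub: "S e \<subseteq> J" using fam e by (simp add: nested_family_def)
  have "overlap E l S i k \<ge> overlap E l S i j" if "k \<in> S e" for k
    by (rule overlap_mono[OF fin l]) (use least that in auto)
  moreover have "overlap E l S i k < overlap E l S i j" if k: "k \<notin> S e" for k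
  proof (rule overlap_strict[OF fin l])
    have "j \<in> S f" if f: "f \<in> E" "i \<in> S f" "k \<in> S f" for f
    proof -
      have "S e \<inter> S f \<noteq> {}" using e f by blast
      then have "S e \<subseteq> S f \<or> S f \<subseteq> S e" using fam e(1) f(1) unfolding nested_family_def by blast
      then show ?thesis using f k e by blast
    qed
    then show "{f \<in> E. i \<in> S f \<and> k \<in> S f} \<subset> {f \<in> E. i \<in> S f \<and> j \<in> S f}" using e k by blast
  qed
  ultimately show ?thesis using sub e by force
qed

text \<open>If there are nonempty members properly contained in \<open>S e\<close>, take
  \<open>i\<close> from a maximal one of them and \<open>j\<close> outside of it.\<close>

lemma smallest_containing_pair:
  assumes fam: "nested_family J b E S" and e: "e \<in> E"
  shows "\<exists>i j. (i \<noteq> j \<or> i = b) \<and> i \<in> S e \<and> j \<in> S e \<and> (\<forall>f\<in>E. i \<in> S f \<longrightarrow> j \<in> S f \<longrightarrow> S e \<subseteq> S f)"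
proof (cases "S e = {b}")
  case True
  then show ?thesis by (intro exI[of _ b]) auto
next
  case False
  then obtain i\<^sub>0 j\<^sub>0 where ij: "i\<^sub>0 \<in> S e" "j\<^sub>0 \<in> S e" "i\<^sub>0 \<noteq> j\<^sub>0" using fam e unfolding nested_family_def by blast
  let ?P = "{f \<in> E. S f \<subset> S e \<and> S f \<noteq> {}}"
  have comp: "S f \<subseteq> S g \<or> S g \<subseteq> S f" if "f \<in> E" "g \<in> E" "k \<in> S f" "k \<in> S g" for f g k
    using fam that unfolding nested_family_def by blast
  have finJ: "finite (S f)" if "S f \<noteq> {}" "f \<in> ?P" "finite (S e)" for f using that finite_subset by blast
  show ?thesis
  proof (cases "?P = {}")
    case True
    have "S e \<subseteq> S f" if "f \<in> E" "i\<^sub>0 \<in> S f" for f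
      using comp[OF e that(1) ij(1) that(2)] True that by blast
    then show ?thesis using ij by blast
  next
    case False
    have "finite ?P" using fam by (simp add: nested_family_def)
    then obtain f where f: "f \<in> ?P" "\<forall>g\<in>?P. card {h \<in> E. S h \<subseteq> S g} \<le> card {h \<in> E. S h \<subseteq> S f}"
      using finite_has_greatest[of ?P "\<lambda>g. card {h \<in> E. S h \<subseteq> S g}"] False by blast
    obtain i where i: "i \<in> S f" using f(1) by blast
    obtain j where j: "j \<in> S e" "j \<notin> S f" using f(1) by blast
    have "S e \<subseteq> S g" if g: "g \<in> E" "i \<in> S g" "j \<in> S g" for g
    proof (rule ccontr)
      assume n: "\<not> S e \<subseteq> S g"
      have ie: "i \<in> S e" using f(1) i by blast
      then have "S g \<subset> S e" using comp[OF e g(1) ie g(2)] n by blast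
      then have gP: "g \<in> ?P" using g by blast
      have "S f \<subset> S g" using comp[of f g i] f(1) g i j by blast
      then have "{h \<in> E. S h \<subseteq> S f} \<subset> {h \<in> E. S h \<subseteq> S g}" using g(1) by blast
      moreover have "finite {h \<in> E. S h \<subseteq> S g}" using fam by (simp add: nested_family_def)
      ultimately have "card {h \<in> E. S h \<subseteq> S f} < card {h \<in> E. S h \<subseteq> S g}" by (rule psubset_card_mono[rotated])
      then show False using f(2) gP by (meson not_less)
    qed
    then have "\<forall>g\<in>E. i \<in> S g \<longrightarrow> j \<in> S g \<longrightarrow> S e \<subseteq> S g" by blast
    moreover have "i \<noteq> j" "i \<in> S e" using i j f(1) by blast+
    ultimately show ?thesis using j(1) by (intro exI[of _ i] exI[of _ j]) simp
  qed
qed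

lemma nested_smallest:
  assumes fam: "nested_family J b E S" and e: "e \<in> E" "i \<in> S e" "j \<in> S e"
  shows "\<exists>e\<in>E. i \<in> S e \<and> j \<in> S e \<and> (\<forall>f\<in>E. i \<in> S f \<longrightarrow> j \<in> S f \<longrightarrow> S e \<subseteq> S f)"
proof -
  let ?P = "{f \<in> E. i \<in> S f \<and> j \<in> S f}"
  have "finite ?P" "?P \<noteq> {}" using fam e by (auto simp: nested_family_def)
  then obtain f where f: "f \<in> ?P" "\<forall>g\<in>?P. card {h \<in> ?P. S g \<subseteq> S h} \<le> card {h \<in> ?P. S f \<subseteq> S h}"
    using finite_has_greatest[of ?P "\<lambda>g. card {h \<in> ?P. S g \<subseteq> S h}"] by blast
  have "S f \<subseteq> S g" if g: "g \<in> ?P" for g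
  proof (rule ccontr)
    assume n: "\<not> S f \<subseteq> S g"
    have "S f \<subseteq> S g \<or> S g \<subseteq> S f" using fam f(1) g unfolding nested_family_def by blast
    then have "S g \<subset> S f" using n by blast
    then have "{h \<in> ?P. S f \<subseteq> S h} \<subset> {h \<in> ?P. S g \<subseteq> S h}" using g by blast
    moreover have "finite {h \<in> ?P. S g \<subseteq> S h}" using \<open>finite ?P\<close> by (rule rev_finite_subset) blast
    ultimately have "card {h \<in> ?P. S f \<subseteq> S h} < card {h \<in> ?P. S g \<subseteq> S h}" by (rule psubset_card_mono[rotated])
    then show False using f(2) g by (meson not_less)
  qed
  then show ?thesis using f(1) by blast
qed

lemma overlap_nonzero_common:
  assumes "overlap E l S i j \<noteq> 0"
  shows "\<exists>e\<in>E. i \<in> S e \<and> j \<in> S e"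
proof (rule ccontr)
  assume "\<not> ?thesis"
  then have "{e \<in> E. i \<in> S e \<and> j \<in> S e} = {}" by blast
  then show False using assms unfolding overlap_def by (metis sum.empty)
qed

text \<open>Every member is the smallest one that contains some pair, and as such it is a ball
  that depends on the overlaps only.\<close>

lemma nested_family_image_subset:
  assumes fam: "nested_family J b E S" "nested_family J b E' S'"
    and l: "\<And>e. e \<in> E \<Longrightarrow> 0 < l e" "\<And>e. e \<in> E' \<Longrightarrow> 0 < l' e"
    and eq: "\<And>i j. i \<in> J \<Longrightarrow> j \<in> J \<Longrightarrow> i \<noteq> j \<or> i = b \<Longrightarrow> overlap E l S i j = overlap E' l' S' i j"
  shows "S ` E \<subseteq> S' ` E'"
proof
  fix X assume "X \<in> S ` E"
  then obtain e where e: "e \<in> E" "X = S e" by blast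
  obtain i j where ij: "i \<noteq> j \<or> i = b" "i \<in> S e" "j \<in> S e" "\<forall>f\<in>E. i \<in> S f \<longrightarrow> j \<in> S f \<longrightarrow> S e \<subseteq> S f"
    using smallest_containing_pair[OF fam(1) e(1)] by (elim exE conjE)
  have J: "i \<in> J" "j \<in> J" using ij e fam(1) unfolding nested_family_def by blast+
  have X: "X = {k \<in> J. k = i \<or> overlap E l S i k \<ge> overlap E l S i j}"
    unfolding e(2) by (rule smallest_is_ball[OF fam(1) l(1) e(1) ij(2,3)]) (use ij(4) in auto)
  have fin: "finite E" using fam(1) by (simp add: nested_family_def)
  have "l e \<le> overlap E l S i j"
    unfolding overlap_def by (rule member_le_sum) (use e ij l(1) fin in \<open>auto intro: less_imp_le\<close>)
  then have "overlap E' l' S' i j \<noteq> 0" using l(1)[OF e(1)] eq[OF J ij(1)] by simp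
  then obtain e'' where "e'' \<in> E'" "i \<in> S' e''" "j \<in> S' e''" using overlap_nonzero_common by blast
  then have "\<exists>e\<in>E'. i \<in> S' e \<and> j \<in> S' e \<and> (\<forall>f\<in>E'. i \<in> S' f \<longrightarrow> j \<in> S' f \<longrightarrow> S' e \<subseteq> S' f)"
    by (rule nested_smallest[OF fam(2)])
  then obtain e' where e': "e' \<in> E'" "i \<in> S' e'" "j \<in> S' e'"
    "\<forall>f\<in>E'. i \<in> S' f \<longrightarrow> j \<in> S' f \<longrightarrow> S' e' \<subseteq> S' f" by (elim bexE conjE)
  have "S' e' = {k \<in> J. k = i \<or> overlap E' l' S' i k \<ge> overlap E' l' S' i j}"
    by (rule smallest_is_ball[OF fam(2) l(2) e'(1-3)]) (use e'(4) in auto)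
  moreover have "(k = i \<or> overlap E' l' S' i j \<le> overlap E' l' S' i k) \<longleftrightarrow>
      (k = i \<or> overlap E l S i j \<le> overlap E l S i k)" if "k \<in> J" for k
    using eq[OF J(1) that] eq[OF J ij(1)] by (cases "k = i") auto
  ultimately have "S' e' = X" unfolding X by blast
  then show "X \<in> S' ` E'" using e'(1) by blast
qed

text \<open>The weights are recovered from the largest members downwards: the overlap of a pair
  is the sum of the weights of the smallest member that contains it and of all larger ones.\<close>

lemma nested_family_weights:
  assumes fam: "nested_family J b E S" "nested_family J b E' S'"
    and l: "\<And>e. e \<in> E \<Longrightarrow> 0 < l e" "\<And>e. e \<in> E' \<Longrightarrow> 0 < l' e"
    and eq: "\<And>i j. i \<in> J \<Longrightarrow> j \<in> J \<Longrightarrow> i \<noteq> j \<or> i = b \<Longrightarrow> overlap E l S i j = overlap E' l' S' i j"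
    and g: "bij_betw g E E'" "\<And>e. e \<in> E \<Longrightarrow> S' (g e) = S e" and e: "e \<in> E"
  shows "l' (g e) = l e"
  using e
proof (induction "card {f \<in> E. S e \<subset> S f}" arbitrary: e rule: less_induct)
  case less
  have fin: "finite E" "inj_on S E" using fam(1) by (simp_all add: nested_family_def)
  obtain i j where ij: "i \<noteq> j \<or> i = b" "i \<in> S e" "j \<in> S e" "\<forall>f\<in>E. i \<in> S f \<longrightarrow> j \<in> S f \<longrightarrow> S e \<subseteq> S f"
    using smallest_containing_pair[OF fam(1) less.prems] by (elim exE conjE)
  have J: "i \<in> J" "j \<in> J" using ij less.prems fam(1) unfolding nested_family_def by blast+
  let ?U = "{f \<in> E. S e \<subset> S f}"
  have U: "{f \<in> E. i \<in> S f \<and> j \<in> S f} = insert e ?U"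
  proof (intro equalityI subsetI)
    fix f assume f: "f \<in> {f \<in> E. i \<in> S f \<and> j \<in> S f}"
    then have "S e \<subseteq> S f" using ij(4) by blast
    then show "f \<in> insert e ?U" using f inj_onD[OF fin(2), of e f] less.prems by blast
  qed (use ij less.prems in blast)
  have "overlap E' l' S' i j = (\<Sum>f\<in>{f \<in> E. i \<in> S f \<and> j \<in> S f}. l' (g f))"
  proof -
    have "bij_betw g {f \<in> E. i \<in> S f \<and> j \<in> S f} {f \<in> E'. i \<in> S' f \<and> j \<in> S' f}"
    proof (rule bij_betw_imageI)
      show "inj_on g {f \<in> E. i \<in> S f \<and> j \<in> S f}"
        using g(1) unfolding bij_betw_def by (blast intro: inj_on_subset)
      show "g ` {f \<in> E. i \<in> S f \<and> j \<in> S f} = {f \<in> E'. i \<in> S' f \<and> j \<in> S' f}"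
      proof (intro equalityI subsetI)
        fix y assume "y \<in> g ` {f \<in> E. i \<in> S f \<and> j \<in> S f}"
        then show "y \<in> {f \<in> E'. i \<in> S' f \<and> j \<in> S' f}" using g bij_betwE[OF g(1)] by auto
      next
        fix y assume y: "y \<in> {f \<in> E'. i \<in> S' f \<and> j \<in> S' f}"
        then obtain f where "f \<in> E" "y = g f" using g(1) unfolding bij_betw_def by blast
        then show "y \<in> g ` {f \<in> E. i \<in> S f \<and> j \<in> S f}" using y g(2) by auto
      qed
    qed
    from sum.reindex_bij_betw[OF this, of l'] show ?thesis unfolding overlap_def by simp
  qed
  moreover have "(\<Sum>f\<in>?U. l' (g f)) = (\<Sum>f\<in>?U. l f)"
  proof (rule sum.cong[OF refl])
    fix f assume f: "f \<in> ?U"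
    have "{h \<in> E. S f \<subset> S h} \<subset> ?U" using f by blast
    then have "card {h \<in> E. S f \<subset> S h} < card ?U" using fin(1) by (intro psubset_card_mono) simp_all
    then show "l' (g f) = l f" using less.hyps f by blast
  qed
  moreover have "e \<notin> ?U" "finite ?U" using fin by auto
  ultimately show ?case using eq[OF J ij(1)] unfolding overlap_def[of E] U by simp
qed

section \<open>Injectivity\<close>

lemma cut_sides_nested:
  assumes "cut_sides n C S"
  shows "nested_family (insert (n + 2) {1..n}) (n + 2) (bedges C) S" "\<exists>e\<in>bedges C. S e = {n + 2}"
    "\<forall>e\<in>bedges C. S e \<noteq> {n + 2} \<longrightarrow> (\<exists>i\<in>S e. \<exists>j\<in>S e. i \<noteq> j)"
proof -
  obtain e\<^sub>0 v\<^sub>0 u W where R: "rooted_cut n C e\<^sub>0 v\<^sub>0 u W" and Sdef: "S = rooted_cut.side n C e\<^sub>0 u W"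
    using assms by (rule cut_sidesE)
  interpret R: rooted_cut n C e\<^sub>0 v\<^sub>0 u W by fact
  have S: "S = R.side" by (fact Sdef)
  show two: "\<forall>e\<in>bedges C. S e \<noteq> {n + 2} \<longrightarrow> (\<exists>i\<in>S e. \<exists>j\<in>S e. i \<noteq> j)"
  proof (intro ballI impI)
    fix e assume e: "e \<in> bedges C" "S e \<noteq> {n + 2}"
    then have "e \<noteq> e\<^sub>0" using S R.side_e0 by auto
    then have "e \<in> R.E" using e by simp
    then show "\<exists>i\<in>S e. \<exists>j\<in>S e. i \<noteq> j" unfolding S by (rule R.side_has_two) blast
  qed
  show "\<exists>e\<in>bedges C. S e = {n + 2}" using R.e0_in R.side_e0 S by blast
  have "laminar n (bedges C) S" by (rule cut_systemD(1)[OF cut_sides_system[OF assms]])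
  then show "nested_family (insert (n + 2) {1..n}) (n + 2) (bedges C) S"
    using R.inj_side R.fin two unfolding nested_family_def laminar_def S fin_graph_def by blast
qed

text \<open>The edge that was cut comes after all leaves, so the upper bound is strict.\<close>

lemma offset_bounds:
  assumes S: "cut_sides n C S" and l': "\<forall>e\<in>bedges C. 0 < l e" and i: "i \<in> {1..n}"
  shows "0 \<le> offset n (bedges C) l S i" "offset n (bedges C) l S i < total_len n (bedges C) l S"
proof -
  have l: "0 < l e" if "e \<in> bedges C" for e using l' that by blast
  obtain e where e: "e \<in> bedges C" "S e = {n + 2}" using cut_sides_nested(2)[OF S] by blast
  have fin: "finite (bedges C)" using cut_sides_nested(1)[OF S] by (simp add: nested_family_def)
  show "0 \<le> offset n (bedges C) l S i"
    unfolding offset_def by (rule sum_nonneg) (use l in \<open>auto intro: less_imp_le\<close>)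
  have "i \<noteq> n + 2" using i by auto
  show "offset n (bedges C) l S i < total_len n (bedges C) l S"
    unfolding offset_def total_len_def
  proof (rule sum_strict_mono_ex1[OF fin])
    show "\<forall>e\<in>bedges C. l e * of_bool (n + 2 \<in> S e \<and> i \<in> S e) \<le> l e * of_bool (n + 2 \<in> S e)"
      using l by (auto intro: less_imp_le)
    show "\<exists>e\<in>bedges C. l e * of_bool (n + 2 \<in> S e \<and> i \<in> S e) < l e * of_bool (n + 2 \<in> S e)"
      using e l[OF e(1)] \<open>i \<noteq> n + 2\<close> by (intro bexI[of _ e]) simp_all
  qed
qed

lemma offset_zero:
  assumes "\<forall>f\<in>E. n + 2 \<in> S f \<longrightarrow> i \<notin> S f"
  shows "offset n E l S i = 0"
  unfolding offset_def by (rule sum.neutral) (use assms in auto)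

lemma residue_unique:
  fixes a b L :: real
  assumes "0 \<le> a" "a < L" "0 \<le> b" "b < L" "a = b + L * of_int m"
  shows "a = b"
proof -
  have "\<bar>L * of_int m\<bar> < L" using assms by linarith
  then have "\<bar>of_int m :: real\<bar> < 1" using assms(1,2) by (simp add: abs_mult)
  then have "m = 0" by linarith
  then show ?thesis using assms(5) by simp
qed

text \<open>In both curves the cut is moved such that the path to the leaf \<open>1\<close>
  leaves the cycle at the root. Then the positions agree up to sign modulo the length of the
  cycle, and the sign is removed by reversing the direction in one of the curves.\<close>

lemma matching_offsets:
  assumes C: "C \<in> elliptic_curves n" and C': "C' \<in> elliptic_curves n"
    and eq: "dist_class n (iso_rel n `` {C}) = dist_class n (iso_rel n `` {C'})"
  obtains S S' where "cut_sides n C S" "cut_sides n C' S'"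
    "invs n (split_vec n (bedges C') (len C') S') = invs n (split_vec n (bedges C) (len C) S)"
    "\<forall>i\<in>{1..n}. offset n (bedges C') (len C') S' i = offset n (bedges C) (len C) S i"
proof -
  have inv: "invs n (split_vec n (bedges C') (len C') S') = invs n (split_vec n (bedges C) (len C) S)"
    if "cut_sides n C S" "cut_sides n C' S'" for S S'
  proof (rule invs_if_Psi_eq[OF split_vec_in split_vec_in])
    show "Psi n (Vclass n (split_vec n (bedges C') (len C') S')) = Psi n (Vclass n (split_vec n (bedges C) (len C) S))"
      using eq dist_class_eq[OF C cut_sides_system[OF that(1)]] dist_class_eq[OF C' cut_sides_system[OF that(2)]]
      by simp
  qed
  have len_pos: "\<forall>e\<in>bedges C. 0 < len C e" "\<forall>e\<in>bedges C'. 0 < len C' e"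
    using elliptic_len[OF C] elliptic_len[OF C'] by blast+
  obtain S\<^sub>0 where S0: "cut_sides n C S\<^sub>0" by (rule cut_sides_exist[OF C])
  obtain S\<^sub>0' where S0': "cut_sides n C' S\<^sub>0'" by (rule cut_sides_exist[OF C'])
  show ?thesis
  proof (cases "n = 0")
    case True
    then show ?thesis using that[OF S0 S0' inv[OF S0 S0']] by simp
  next
    case False
    then have one: "1 \<in> {1..n}" by simp
    obtain S where S: "cut_sides n C S" "\<forall>f\<in>bedges C. n + 2 \<in> S f \<longrightarrow> 1 \<notin> S f"
      using cut_sides_normalized[OF S0 one] by blast
    obtain S' where S': "cut_sides n C' S'" "\<forall>f\<in>bedges C'. n + 2 \<in> S' f \<longrightarrow> 1 \<notin> S' f"
      using cut_sides_normalized[OF S0' one] by blast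
    let ?o = "offset n (bedges C) (len C) S" and ?o' = "offset n (bedges C') (len C') S'"
    let ?L = "total_len n (bedges C) (len C) S"
    note lam = cut_systemD(1)[OF cut_sides_system[OF S(1)]] cut_systemD(1)[OF cut_sides_system[OF S'(1)]]
    have pos: "0 < ?L"
      by (rule cut_system_total_pos[OF cut_sides_system[OF S(1)] elliptic_finite[OF C] elliptic_len[OF C]])
    have tot: "total_len n (bedges C') (len C') S' = ?L"
      using inv[OF S(1) S'(1)] unfolding invs_eq_iff cyc_len_split[OF lam(1)] cyc_len_split[OF lam(2)] by blast
    have "\<exists>\<epsilon> r. \<exists>m::nat \<Rightarrow> int. (\<epsilon> = 1 \<or> \<epsilon> = -1) \<and> (\<forall>i\<in>{1..n}. ?o' i = \<epsilon> * ?o i + r + ?L * of_int (m i))"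
      by (rule offsets_congruent[OF lam _ _ pos inv[OF S(1) S'(1)]])
        (use elliptic_len[OF C] elliptic_len[OF C'] in \<open>auto intro: less_imp_le\<close>)
    then obtain \<epsilon> r and m :: "nat \<Rightarrow> int" where
      *: "(\<epsilon> = 1 \<or> \<epsilon> = -1) \<and> (\<forall>i\<in>{1..n}. ?o' i = \<epsilon> * ?o i + r + ?L * of_int (m i))"
      by (elim exE)
    then have "?o' 1 = \<epsilon> * ?o 1 + r + ?L * of_int (m 1)" using one by blast
    moreover have "?o 1 = 0" "?o' 1 = 0" by (rule offset_zero, fact)+
    ultimately have r: "r = - (?L * of_int (m 1))" by simp
    have cong: "?o' i = \<epsilon> * ?o i + ?L * of_int (m i - m 1)" if "i \<in> {1..n}" for i
      using * that r by (simp add: algebra_simps)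
    note bo = offset_bounds[OF S(1) len_pos(1)]
    from * have "\<epsilon> = 1 \<or> \<epsilon> = -1" by blast
    then show ?thesis
    proof
      assume \<epsilon>: "\<epsilon> = 1"
      have "?o' i = ?o i" if i: "i \<in> {1..n}" for i
        by (rule residue_unique[of _ ?L _ "m i - m 1"])
          (use offset_bounds[OF S'(1) len_pos(2) i, unfolded tot] bo[OF i] cong[OF i] \<epsilon> in simp_all)
      then show ?thesis using that[OF S(1) S'(1) inv[OF S(1) S'(1)]] by simp
    next
      assume \<epsilon>: "\<epsilon> = -1"
      have "\<exists>S'' F. cut_sides n C' S'' \<and> (\<forall>f\<in>bedges C'. n + 2 \<in> S'' f \<longleftrightarrow> n + 2 \<in> S' f) \<and>
          (\<forall>f\<in>bedges C'. n + 2 \<in> S' f \<longrightarrow> S' f - {n + 2} \<subseteq> F \<and> S'' f - {n + 2} = F - S' f)"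
        by (rule cut_sides_reversed[OF S'(1)])
      then obtain S'' F where S'': "cut_sides n C' S''"
        and cyc: "\<forall>f\<in>bedges C'. n + 2 \<in> S'' f \<longleftrightarrow> n + 2 \<in> S' f"
        and F: "\<forall>f\<in>bedges C'. n + 2 \<in> S' f \<longrightarrow> S' f - {n + 2} \<subseteq> F \<and> S'' f - {n + 2} = F - S' f"
        by (elim exE conjE)
      let ?o'' = "offset n (bedges C') (len C') S''"
      have tot'': "total_len n (bedges C') (len C') S'' = ?L"
      proof -
        have "total_len n (bedges C') (len C') S'' = total_len n (bedges C') (len C') S'"
          unfolding total_len_def by (rule sum.cong) (use cyc in auto)
        then show ?thesis using tot by simp
      qed
      have "\<exists>k::int. ?o'' i = - ?o' i + ?L * of_int k" if i: "i \<in> {1..n}" for i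
      proof -
        have iB: "i \<noteq> n + 2" using i by auto
        have F1: "i \<in> S' f \<longrightarrow> i \<in> F" and F2: "i \<in> S'' f \<longleftrightarrow> i \<in> F \<and> i \<notin> S' f"
          if "f \<in> bedges C'" "n + 2 \<in> S' f" for f
          using bspec[OF F that(1)] that(2) iB by blast+
        show ?thesis
        proof (cases "i \<in> F")
          case True
          have "?o'' i = total_len n (bedges C') (len C') S' - ?o' i"
            unfolding offset_def total_len_def sum_subtractf[symmetric]
          proof (rule sum.cong[OF refl])
            fix f assume f: "f \<in> bedges C'"
            show "len C' f * of_bool (n + 2 \<in> S'' f \<and> i \<in> S'' f) =
                len C' f * of_bool (n + 2 \<in> S' f) - len C' f * of_bool (n + 2 \<in> S' f \<and> i \<in> S' f)"
              using F2[OF f] bspec[OF cyc f] True by (cases "n + 2 \<in> S' f") auto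
          qed
          then have "?o'' i = - ?o' i + ?L * of_int 1" using tot by simp
          then show ?thesis by blast
        next
          case False
          have "?o'' i = 0" by (rule offset_zero) (use F2 cyc False in blast)
          moreover have "?o' i = 0" by (rule offset_zero) (use F1 False in blast)
          ultimately show ?thesis by (intro exI[of _ 0]) simp
        qed
      qed
      then have "?o'' i = ?o i" if i: "i \<in> {1..n}" for i
      proof -
        assume "\<And>i. i \<in> {1..n} \<Longrightarrow> \<exists>k::int. ?o'' i = - ?o' i + ?L * of_int k"
        then obtain k :: int where k: "?o'' i = - ?o' i + ?L * of_int k" using i by blast
        have "?o'' i = ?o i + ?L * of_int (k - (m i - m 1))"
          using k cong[OF i] \<epsilon> by (simp add: algebra_simps)
        then show ?thesis
          by (rule residue_unique[rotated 4])
            (use offset_bounds[OF S'' len_pos(2) i, unfolded tot''] bo[OF i] in simp_all)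
      qed
      then show ?thesis using that[OF S(1) S'' inv[OF S(1) S'']] by simp
    qed
  qed
qed

lemma overlap_alt:
  assumes "finite E"
  shows "overlap E l S i j = (\<Sum>e\<in>E. l e * of_bool (i \<in> S e \<and> j \<in> S e))"
proof -
  have "overlap E l S i j = (\<Sum>e\<in>E. if i \<in> S e \<and> j \<in> S e then l e else 0)"
    unfolding overlap_def by (rule sum.inter_filter[OF assms])
  also have "\<dots> = (\<Sum>e\<in>E. l e * of_bool (i \<in> S e \<and> j \<in> S e))"
    by (rule sum.cong) simp_all
  finally show ?thesis .
qed

lemma overlap_leaves:
  assumes "finite E"
  shows "2 * overlap E l S i j =
    offset n E l S i + offset n E l S j - arc_len n E l S i j + 2 * common_len n E l S i j"
  unfolding overlap_alt[OF assms] offset_def arc_len_def common_len_def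
    sum_distrib_left sum_subtractf[symmetric] sum.distrib[symmetric]
  by (rule sum.cong) auto

lemma overlap_commute: "overlap E l S i j = overlap E l S j i"
  unfolding overlap_def by (rule sum.cong) auto

lemma overlap_B: "finite E \<Longrightarrow> overlap E l S (n + 2) i = offset n E l S i"
  unfolding overlap_alt offset_def by simp

lemma overlap_BB: "finite E \<Longrightarrow> overlap E l S (n + 2) (n + 2) = total_len n E l S"
  unfolding overlap_alt total_len_def by simp

text \<open>With matching cuts, the positions on the cycle and the common parts of the paths
  agree, so all overlaps do. They determine the family of sides with its lengths, and this family
  determines the curve.\<close>

lemma dist_class_injective:
  assumes C: "C \<in> elliptic_curves n" and C': "C' \<in> elliptic_curves n"
    and eq: "dist_class n (iso_rel n `` {C}) = dist_class n (iso_rel n `` {C'})"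
  shows "curve_iso n C C'"
proof -
  obtain S S' where S: "cut_sides n C S" and S': "cut_sides n C' S'"
    and inv: "invs n (split_vec n (bedges C') (len C') S') = invs n (split_vec n (bedges C) (len C) S)"
    and off: "\<forall>i\<in>{1..n}. offset n (bedges C') (len C') S' i = offset n (bedges C) (len C) S i"
    by (rule matching_offsets[OF C C' eq])
  let ?J = "insert (n + 2) {1..n}"
  note lam = cut_systemD(1)[OF cut_sides_system[OF S]] cut_systemD(1)[OF cut_sides_system[OF S']]
  note fin = elliptic_finite[OF C] elliptic_finite[OF C']
  have pos: "0 < total_len n (bedges C) (len C) S"
    by (rule cut_system_total_pos[OF cut_sides_system[OF S] elliptic_finite[OF C] elliptic_len[OF C]])
  have tot: "total_len n (bedges C') (len C') S' = total_len n (bedges C) (len C) S"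
    using inv unfolding invs_eq_iff cyc_len_split[OF lam(1)] cyc_len_split[OF lam(2)] by blast
  have ol: "overlap (bedges C) (len C) S i j = overlap (bedges C') (len C') S' i j"
    if ij: "i \<in> {1..n}" "j \<in> {1..n}" "i \<noteq> j" for i j
  proof -
    have l0: "\<And>e. e \<in> bedges C \<Longrightarrow> 0 \<le> len C e" "\<And>e. e \<in> bedges C' \<Longrightarrow> 0 \<le> len C' e"
      using elliptic_len[OF C] elliptic_len[OF C'] by (auto intro: less_imp_le)
    have com: "common_len n (bedges C') (len C') S' i j = common_len n (bedges C) (len C) S i j"
      by (rule invs_eq_arcs(2)[OF lam _ _ pos inv ij]) (use l0 in auto)
    have "arc_len n (bedges C') (len C') S' i j = arc_len n (bedges C) (len C) S i j"
      using abs_offset_diff[OF lam(1), of "len C", OF l0(1) ij(1,2)]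
        abs_offset_diff[OF lam(2), of "len C'", OF l0(2) ij(1,2)] off ij by simp
    then have "2 * overlap (bedges C) (len C) S i j = 2 * overlap (bedges C') (len C') S' i j"
      unfolding overlap_leaves[OF fin(1), of _ _ _ _ n] overlap_leaves[OF fin(2), of _ _ _ _ n] using com off ij by simp
    then show ?thesis by simp
  qed
  have ov: "overlap (bedges C) (len C) S i j = overlap (bedges C') (len C') S' i j"
    if ij: "i \<in> ?J" "j \<in> ?J" "i \<noteq> j \<or> i = n + 2" for i j
  proof -
    consider "i = n + 2" "j = n + 2" | "i = n + 2" "j \<in> {1..n}" | "i \<in> {1..n}" "j = n + 2" |
      "i \<in> {1..n}" "j \<in> {1..n}" "i \<noteq> j" using ij by blast
    then show ?thesis
    proof cases
      case 1
      show ?thesis unfolding 1 overlap_BB[OF fin(1)] overlap_BB[OF fin(2)] using tot by simp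
    next
      case 2
      show ?thesis unfolding 2(1) overlap_B[OF fin(1)] overlap_B[OF fin(2)] using off 2(2) by simp
    next
      case 3
      have "overlap (bedges C) (len C) S j i = overlap (bedges C') (len C') S' j i"
        unfolding 3(2) overlap_B[OF fin(1)] overlap_B[OF fin(2)] using off 3(1) by simp
      then show ?thesis using overlap_commute by metis
    next
      case 4
      then show ?thesis by (rule ol)
    qed
  qed
  note nest = cut_sides_nested(1)[OF S] cut_sides_nested(1)[OF S']
  have "S ` bedges C \<subseteq> S' ` bedges C'"
    by (rule nested_family_image_subset[OF nest elliptic_len[OF C] elliptic_len[OF C'] ov])
  moreover have "S' ` bedges C' \<subseteq> S ` bedges C"
    by (rule nested_family_image_subset[OF nest(2,1) elliptic_len[OF C'] elliptic_len[OF C] ov[symmetric]])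
  ultimately have "S ` bedges C = S' ` bedges C'" by blast
  from same_sides_iso[OF S S' this] obtain f g where
    f: "bij_betw f (verts C) (verts C')" and g: "bij_betw g (bedges C) (bedges C')"
    and e: "\<forall>e\<in>bedges C. ends C' (g e) = f ` ends C e \<and> S' (g e) = S e"
    and l: "\<forall>i\<in>{1..n}. leaf C' i = f (leaf C i)" by (elim exE conjE)
  have "len C' (g e) = len C e" if "e \<in> bedges C" for e
    by (rule nested_family_weights[OF nest elliptic_len[OF C] elliptic_len[OF C'] ov g])
      (use e \<open>e \<in> bedges C\<close> in auto)
  then show ?thesis
    unfolding curve_iso_def using f g e l by (intro exI[of _ f] exI[of _ g]) simp
qed

section \<open>Contracting edges\<close>

definition rep :: "curve \<Rightarrow> (nat \<Rightarrow> real) \<Rightarrow> nat \<Rightarrow> nat" where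
  "rep C l v = Min {u \<in> verts C. (u, v) \<in> (joined C {e \<in> bedges C. l e = 0})\<^sup>*}"

lemma contract_simps:
  "verts (contract C l) = rep C l ` verts C" "bedges (contract C l) = {e \<in> bedges C. l e \<noteq> 0}"
  "ends (contract C l) e = rep C l ` ends C e" "len (contract C l) = l"
  "leaf (contract C l) i = rep C l (leaf C i)"
  by (simp_all add: contract_def rep_def Let_def)

lemma rtrancl_joined_sym: "(u, v) \<in> (joined C F)\<^sup>* \<Longrightarrow> (v, u) \<in> (joined C F)\<^sup>*"
  using joined_sym[of _ _ C F] by (metis sym_def sym_rtrancl)

lemma rep_reach:
  assumes "fin_graph C" "v \<in> verts C"
  shows "rep C l v \<in> verts C" "(rep C l v, v) \<in> (joined C {e \<in> bedges C. l e = 0})\<^sup>*"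
proof -
  let ?A = "{u \<in> verts C. (u, v) \<in> (joined C {e \<in> bedges C. l e = 0})\<^sup>*}"
  have "finite ?A" using assms(1) by (simp add: fin_graph_def)
  moreover have "v \<in> ?A" using assms(2) by simp
  ultimately have "rep C l v \<in> ?A" unfolding rep_def using Min_in[of ?A] by blast
  then show "rep C l v \<in> verts C" "(rep C l v, v) \<in> (joined C {e \<in> bedges C. l e = 0})\<^sup>*" by simp_all
qed

lemma rep_eq:
  assumes "(u, v) \<in> (joined C {e \<in> bedges C. l e = 0})\<^sup>*"
  shows "rep C l u = rep C l v"
proof -
  have "(w, u) \<in> (joined C {e \<in> bedges C. l e = 0})\<^sup>* \<longleftrightarrow> (w, v) \<in> (joined C {e \<in> bedges C. l e = 0})\<^sup>*" for w
    using assms rtrancl_joined_sym[OF assms] by (meson rtrancl_trans)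
  then show ?thesis unfolding rep_def by simp
qed

lemma rep_zero_edge:
  assumes "e \<in> bedges C" "l e = 0" "ends C e = {u, v}"
  shows "rep C l u = rep C l v"
  by (rule rep_eq, rule r_into_rtrancl) (use assms in \<open>auto simp: joined_def\<close>)

lemma crossing_contract:
  assumes "fin_graph C"
  shows "crossing (contract C l) \<phi> = crossing C (\<lambda>x. \<phi> (rep C l x))"
proof -
  have "e \<in> crossing (contract C l) \<phi> \<longleftrightarrow> e \<in> crossing C (\<lambda>x. \<phi> (rep C l x))" if e: "e \<in> bedges C" for e
  proof -
    obtain u v where "u \<in> verts C" "v \<in> verts C" and uv: "ends C e = {u, v}"
      by (rule fin_graph_endsE[OF assms e])
    have "e \<notin> crossing C (\<lambda>x. \<phi> (rep C l x))" if "l e = 0"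
      using rep_zero_edge[of e C l, OF e that uv] in_crossing_iff[OF e uv, of "\<lambda>x. \<phi> (rep C l x)"] by simp
    then show ?thesis using e by (auto simp: crossing_def contract_simps)
  qed
  moreover have "crossing (contract C l) \<phi> \<subseteq> bedges C"
    using crossing_subset[of "contract C l" \<phi>] by (auto simp: contract_simps)
  ultimately show ?thesis using crossing_subset[of C] by blast
qed

text \<open>A cut that crosses no contracted edge is constant on the vertices that are merged.\<close>

lemma crossing_contract_lift:
  assumes "fin_graph C" "\<forall>e\<in>crossing C \<phi>. l e \<noteq> 0"
  shows "crossing (contract C l) \<phi> = crossing C \<phi>" "v \<in> verts C \<Longrightarrow> \<phi> (rep C l v) = \<phi> v"
proof -
  show r: "\<phi> (rep C l v) = \<phi> v" if "v \<in> verts C" for v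
    by (rule crossing_empty_joined[OF rep_reach(2)[OF assms(1) that]]) (use assms(2) in auto)
  show "crossing (contract C l) \<phi> = crossing C \<phi>"
    unfolding crossing_contract[OF assms(1)] by (rule crossing_cong[OF assms(1) r])
qed

lemma nonbridge_contract:
  assumes "fin_graph C"
  shows "nonbridge (contract C l) e \<longleftrightarrow> nonbridge C e \<and> l e \<noteq> 0"
proof
  assume a: "nonbridge (contract C l) e"
  then have e: "e \<in> bedges C" "l e \<noteq> 0" by (auto simp: nonbridge_def contract_simps)
  have "crossing C \<phi> \<noteq> {e}" for \<phi>
  proof
    assume \<phi>: "crossing C \<phi> = {e}"
    then have "crossing (contract C l) \<phi> = {e}" using crossing_contract_lift(1)[OF assms, of \<phi> l] e(2) by auto
    then show False using a by (auto simp: nonbridge_def)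
  qed
  then show "nonbridge C e \<and> l e \<noteq> 0" using e by (simp add: nonbridge_def)
next
  assume a: "nonbridge C e \<and> l e \<noteq> 0"
  then show "nonbridge (contract C l) e"
    using crossing_contract[OF assms] by (auto simp: nonbridge_def contract_simps)
qed

lemma contract_cut_system:
  assumes G: "fin_graph C" and lf: "\<And>i. i \<in> {1..n} \<Longrightarrow> leaf C i \<in> verts C"
    and S: "cut_system n C S" and pos: "\<exists>e\<in>bedges C. n + 2 \<in> S e \<and> l e \<noteq> 0"
  shows "cut_system n (contract C l) S"
proof -
  let ?D = "contract C l"
  have E: "e \<in> bedges C" "l e \<noteq> 0" if "e \<in> bedges ?D" for e using that by (simp_all add: contract_simps)
  have lam: "laminar n (bedges ?D) S"
    using cut_systemD(1)[OF S] E unfolding laminar_def by blast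
  have ex: "\<exists>e\<in>bedges ?D. n + 2 \<in> S e" using pos by (auto simp: contract_simps)
  have nb: "nonbridge ?D e" if "e \<in> bedges ?D" "n + 2 \<in> S e" for e
    using nonbridge_contract[OF G] cut_systemD(3)[OF S E(1)] that E by blast
  have bridge: "\<exists>\<phi>. crossing ?D \<phi> = {e} \<and> (\<forall>i\<in>{1..n}. \<phi> (leaf ?D i) \<longleftrightarrow> i \<in> S e) \<and>
        (\<forall>f\<in>bedges ?D. n + 2 \<in> S f \<longrightarrow> (\<forall>x\<in>ends ?D f. \<not> \<phi> x))"
    if e: "e \<in> bedges ?D" "n + 2 \<notin> S e" for e
  proof -
    obtain \<phi> where \<phi>: "crossing C \<phi> = {e}" "\<forall>i\<in>{1..n}. \<phi> (leaf C i) \<longleftrightarrow> i \<in> S e"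
      "\<forall>f\<in>bedges C. n + 2 \<in> S f \<longrightarrow> (\<forall>x\<in>ends C f. \<not> \<phi> x)"
      using cut_systemD(4)[OF S E(1)[OF e(1)] e(2)] by blast
    have nz: "\<forall>f\<in>crossing C \<phi>. l f \<noteq> 0" using \<phi>(1) E(2)[OF e(1)] by simp
    note lift = crossing_contract_lift[of C \<phi> l, OF G nz]
    have "crossing ?D \<phi> = {e}" using lift(1) \<phi>(1) by simp
    moreover have "\<forall>i\<in>{1..n}. \<phi> (leaf ?D i) \<longleftrightarrow> i \<in> S e" using lift(2)[OF lf] \<phi>(2) by (simp add: contract_simps)
    moreover have "\<not> \<phi> x" if f: "f \<in> bedges ?D" "n + 2 \<in> S f" "x \<in> ends ?D f" for f x
    proof -
      obtain y where y: "y \<in> ends C f" "x = rep C l y" using f(3) by (auto simp: contract_simps)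
      have "y \<in> verts C" by (rule fin_graph_ends[OF G E(1)[OF f(1)] y(1)])
      then have "\<phi> x = \<phi> y" using lift(2) y(2) by simp
      then show ?thesis using \<phi>(3) E(1)[OF f(1)] f(2) y(1) by blast
    qed
    ultimately show ?thesis by (intro exI[of _ \<phi>]) blast
  qed
  have pair: "\<exists>\<phi>. crossing ?D \<phi> = {e, f} \<and> (\<forall>i\<in>{1..n}. \<phi> (leaf ?D i) \<longleftrightarrow> (i \<in> S e) \<noteq> (i \<in> S f))"
    if ef: "e \<in> bedges ?D" "f \<in> bedges ?D" "n + 2 \<in> S e" "n + 2 \<in> S f" "e \<noteq> f" for e f
  proof -
    obtain \<phi> where \<phi>: "crossing C \<phi> = {e, f}" "\<forall>i\<in>{1..n}. \<phi> (leaf C i) \<longleftrightarrow> (i \<in> S e) \<noteq> (i \<in> S f)"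
      using cut_systemD(5)[OF S E(1)[OF ef(1)] E(1)[OF ef(2)] ef(3-5)] by blast
    have nz: "\<forall>g\<in>crossing C \<phi>. l g \<noteq> 0" using \<phi>(1) E(2)[OF ef(1)] E(2)[OF ef(2)] by simp
    note lift = crossing_contract_lift[of C \<phi> l, OF G nz]
    have "crossing ?D \<phi> = {e, f}" using lift(1) \<phi>(1) by simp
    moreover have "\<forall>i\<in>{1..n}. \<phi> (leaf ?D i) \<longleftrightarrow> (i \<in> S e) \<noteq> (i \<in> S f)"
      using lift(2)[OF lf] \<phi>(2) by (simp add: contract_simps)
    ultimately show ?thesis by blast
  qed
  show ?thesis
    unfolding cut_system_def using lam ex nb bridge pair by (intro conjI ballI impI) simp_all
qed

lemma contract_split_vec:
  assumes "finite (bedges C)"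
  shows "split_vec n (bedges (contract C l)) l S = split_vec n (bedges C) l S"
  unfolding split_vec_def contract_simps
  by (intro restrict_ext sum.mono_neutral_left) (use assms in auto)

text \<open>A vertex of the contracted curve stands for a subtree of \<open>k\<close> vertices, in which \<open>k - 1\<close>
  edges are contracted, as each contracted edge is the parent edge of a vertex and the vertex
  nearest to the root has none. So of at least \<open>3 k\<close> ends at these vertices at most \<open>2 (k - 1)\<close>
  disappear.\<close>

lemma (in rooted_cut) contract_valence:
  assumes l0: "l e\<^sub>0 \<noteq> 0" and r: "r \<in> rep C l ` verts C"
  shows "3 \<le> valence n (contract C l) r"
proof -
  let ?K = "{x \<in> verts C. rep C l x = r}" and ?B = "bedges C"
  have finB: "finite ?B" using fin by (simp add: fin_graph_def)
  have finK: "finite ?K" "?K \<noteq> {}" using fin_verts r by auto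
  let ?Z = "{e \<in> ?B. l e = 0 \<and> ends C e \<subseteq> ?K}"
  have ZE: "e \<in> E" if "e \<in> ?Z" for e using that l0 by auto
  have "\<forall>e\<in>?Z. \<exists>q. q \<in> ends C e \<and> W e q"
  proof
    fix e assume "e \<in> ?Z"
    then have "e \<in> E" by (rule ZE)
    then show "\<exists>q. q \<in> ends C e \<and> W e q" by (rule endsE) blast
  qed
  from bchoice[OF this] obtain far where far: "\<forall>e\<in>?Z. far e \<in> ends C e \<and> W e (far e)" by (elim exE)
  have inj: "inj_on far ?Z"
  proof (rule inj_onI)
    fix e f assume ef: "e \<in> ?Z" "f \<in> ?Z" "far e = far f"
    have fe: "far e \<in> ends C e" "W e (far e)" and ff: "far f \<in> ends C f" "W f (far f)"
      using far ef(1,2) by blast+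
    have "side e \<subseteq> side f"
      using far_end_iff[OF ZE[OF ef(1)] fe ZE[OF ef(2)]] ff(2) ef(3) by simp
    moreover have "side f \<subseteq> side e"
      using far_end_iff[OF ZE[OF ef(2)] ff ZE[OF ef(1)]] fe(2) ef(3) by simp
    ultimately show "e = f" using inj_onD[OF inj_side] ef(1,2) by blast
  qed
  let ?d = "\<lambda>x. card E - card {g \<in> E. W g x}"
  obtain x where x: "x \<in> ?K" "\<forall>y\<in>?K. ?d y \<le> ?d x" using finite_has_greatest[OF finK, of ?d] by blast
  have "far ` ?Z \<subseteq> ?K - {x}"
  proof
    fix y assume "y \<in> far ` ?Z"
    then obtain e where e: "e \<in> ?Z" "y = far e" by blast
    have y: "y \<in> ends C e" "W e y" "y \<in> ?K" using far e by auto
    have eE: "e \<in> E" by (rule ZE[OF e(1)])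
    from near_end[OF eE y(1,2)] obtain p where p: "p \<in> verts C" "ends C e = {p, y}" "\<not> W e p"
      "\<forall>g\<in>E - {e}. W g p = W g y" by (elim bexE conjE)
    have pK: "p \<in> ?K" using e(1) p(2) by auto
    have "{g \<in> E. W g y} = insert e {g \<in> E. W g p}" using p(3,4) eE y(2) by blast
    then have "card {g \<in> E. W g y} = Suc (card {g \<in> E. W g p})" using finE p(3) by simp
    moreover have "card {g \<in> E. W g y} \<le> card E" by (rule card_mono[OF finE]) blast
    ultimately have "?d y < ?d p" by linarith
    moreover have "?d p \<le> ?d x" using x(2) pK by blast
    ultimately have "y \<noteq> x" by auto
    then show "y \<in> ?K - {x}" using y(3) by simp
  qed
  then have "card (far ` ?Z) \<le> card (?K - {x})" using finK by (intro card_mono) auto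
  then have Zle: "card ?Z < card ?K"
    using card_image[OF inj] x(1) finK(1) card_Diff1_less[of ?K x] by simp
  \<comment> \<open>the number of ends of an edge at the vertices of the subtree\<close>
  define h where "h e = card (ends C e \<inter> ?K) + of_bool (\<exists>x\<in>?K. ends C e = {x})" for e
  have h_zero: "h e = (if ends C e \<subseteq> ?K then 2 else 0)" if e: "e \<in> ?B" "l e = 0" for e
  proof -
    have eE: "e \<in> E" using e l0 by auto
    obtain p q where pq: "p \<in> verts C" "q \<in> verts C" "ends C e = {p, q}" "\<not> W e p" "W e q"
      "\<And>g. g \<in> E \<Longrightarrow> g \<noteq> e \<Longrightarrow> W g p = W g q"
      by (rule endsE[OF eE]) blast
    have "p \<noteq> q" using pq(4,5) by blast
    moreover have "p \<in> ?K \<longleftrightarrow> q \<in> ?K" using rep_zero_edge[of e C l, OF e pq(3)] pq(1,2) by simp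
    ultimately show ?thesis unfolding h_def pq(3) by (cases "p \<in> ?K") auto
  qed
  have h_pos: "h e = of_bool (r \<in> rep C l ` ends C e) + of_bool (rep C l ` ends C e = {r})"
    if e: "e \<in> ?B" for e
  proof -
    obtain p q where pq: "p \<in> verts C" "q \<in> verts C" "ends C e = {p, q}"
      using fin e by (rule fin_graph_endsE)
    have K: "p \<in> ?K \<longleftrightarrow> rep C l p = r" "q \<in> ?K \<longleftrightarrow> rep C l q = r" using pq by simp_all
    show ?thesis
    proof (cases "p = q")
      case True
      have "{p, q} \<inter> ?K = (if p \<in> ?K then {p} else {})" using True by auto
      then show ?thesis unfolding h_def pq(3) using True K by auto
    next
      case False
      have "{p, q} \<inter> ?K = (if p \<in> ?K then {p} else {}) \<union> (if q \<in> ?K then {q} else {})" by auto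
      then have "card ({p, q} \<inter> ?K) = of_bool (p \<in> ?K) + of_bool (q \<in> ?K)" using False by simp
      moreover have "\<not> (\<exists>x\<in>?K. {p, q} = {x})" using False by (auto simp: doubleton_eq_iff)
      ultimately show ?thesis unfolding h_def pq(3) using K by auto
    qed
  qed
  have card_sum: "card {e \<in> A. P e} = (\<Sum>e\<in>A. of_bool (P e))" if "finite A" for A :: "nat set" and P
    using that by (simp add: sum.If_cases Int_def of_bool_def)
  have "(\<Sum>x\<in>?K. card {e \<in> ?B. x \<in> ends C e} + card {e \<in> ?B. ends C e = {x}}) = (\<Sum>e\<in>?B. h e)"
  proof -
    have "(\<Sum>x\<in>?K. card {e \<in> ?B. x \<in> ends C e} + card {e \<in> ?B. ends C e = {x}}) =
        (\<Sum>x\<in>?K. \<Sum>e\<in>?B. of_bool (x \<in> ends C e) + of_bool (ends C e = {x}))"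
      by (rule sum.cong[OF refl]) (simp only: card_sum[OF finB] sum.distrib)
    also have "\<dots> = (\<Sum>e\<in>?B. \<Sum>x\<in>?K. of_bool (x \<in> ends C e) + of_bool (ends C e = {x}))"
      by (rule sum.swap)
    also have "\<dots> = (\<Sum>e\<in>?B. h e)"
    proof (rule sum.cong[OF refl])
      fix e
      have "(\<Sum>x\<in>?K. of_bool (x \<in> ends C e)) = card {x \<in> ?K. x \<in> ends C e}" by (rule card_sum[OF finK(1), symmetric])
      moreover have "{x \<in> ?K. x \<in> ends C e} = ends C e \<inter> ?K" by blast
      moreover have "(\<Sum>x\<in>?K. of_bool (ends C e = {x})) = card {x \<in> ?K. ends C e = {x}}" by (rule card_sum[OF finK(1), symmetric])
      moreover have "card {x \<in> ?K. ends C e = {x}} = of_bool (\<exists>x\<in>?K. ends C e = {x})"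
      proof (cases "\<exists>x\<in>?K. ends C e = {x}")
        case True
        then obtain x where "x \<in> ?K" "ends C e = {x}" by blast
        then have "{x \<in> ?K. ends C e = {x}} = {x}" by auto
        then show ?thesis using True by simp
      next
        case False
        then have "{x \<in> ?K. ends C e = {x}} = {}" by blast
        then have "card {x \<in> ?K. ends C e = {x}} = 0" by (simp only: card.empty)
        then show ?thesis using False by simp
      qed
      ultimately show "(\<Sum>x\<in>?K. of_bool (x \<in> ends C e) + of_bool (ends C e = {x})) = h e"
        unfolding h_def sum.distrib by simp
    qed
    finally show ?thesis .
  qed
  moreover have "(\<Sum>x\<in>?K. card {i \<in> {1..n}. leaf C i = x}) = card {i \<in> {1..n}. rep C l (leaf C i) = r}"
  proof -
    have "card (\<Union>x\<in>?K. {i \<in> {1..n}. leaf C i = x}) = (\<Sum>x\<in>?K. card {i \<in> {1..n}. leaf C i = x})"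
      by (rule card_UN_disjoint) (use finK in auto)
    moreover have "(\<Union>x\<in>?K. {i \<in> {1..n}. leaf C i = x}) = {i \<in> {1..n}. rep C l (leaf C i) = r}"
      using leaf by auto
    ultimately show ?thesis by simp
  qed
  ultimately have "(\<Sum>x\<in>?K. valence n C x) = (\<Sum>e\<in>?B. h e) + card {i \<in> {1..n}. rep C l (leaf C i) = r}"
    unfolding valence_def sum.distrib by simp
  moreover have "3 * card ?K \<le> (\<Sum>x\<in>?K. valence n C x)"
    using sum_bounded_below[of ?K 3 "valence n C"] val by (simp add: mult.commute)
  moreover have "(\<Sum>e\<in>?B. h e) = (\<Sum>e\<in>{e \<in> ?B. l e \<noteq> 0}. h e) + (\<Sum>e\<in>{e \<in> ?B. l e = 0}. h e)"
  proof -
    have "?B \<inter> {e. l e \<noteq> 0} = {e \<in> ?B. l e \<noteq> 0}" "?B - {e. l e \<noteq> 0} = {e \<in> ?B. l e = 0}" by blast+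
    then show ?thesis using sum.Int_Diff[OF finB, of h "{e. l e \<noteq> 0}"] by simp
  qed
  moreover have "(\<Sum>e\<in>{e \<in> ?B. l e = 0}. h e) = 2 * card ?Z"
  proof -
    have "(\<Sum>e\<in>{e \<in> ?B. l e = 0}. h e) = (\<Sum>e\<in>{e \<in> ?B. l e = 0}. 2 * of_bool (ends C e \<subseteq> ?K))"
      by (rule sum.cong[OF refl]) (simp add: h_zero)
    also have "\<dots> = 2 * card {e \<in> {e \<in> ?B. l e = 0}. ends C e \<subseteq> ?K}"
      using card_sum[of "{e \<in> ?B. l e = 0}"] finB by (simp add: sum_distrib_left[symmetric])
    also have "{e \<in> {e \<in> ?B. l e = 0}. ends C e \<subseteq> ?K} = ?Z" by blast
    finally show ?thesis .
  qed
  moreover have "valence n (contract C l) r =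
      (\<Sum>e\<in>{e \<in> ?B. l e \<noteq> 0}. h e) + card {i \<in> {1..n}. rep C l (leaf C i) = r}"
  proof -
    define A where "A = {e \<in> ?B. l e \<noteq> 0}"
    have finA: "finite A" using finB by (simp add: A_def)
    have "(\<Sum>e\<in>A. h e) = (\<Sum>e\<in>A. of_bool (r \<in> rep C l ` ends C e) + of_bool (rep C l ` ends C e = {r}))"
      by (rule sum.cong[OF refl], rule h_pos) (simp add: A_def)
    also have "\<dots> = card {e \<in> A. r \<in> rep C l ` ends C e} + card {e \<in> A. rep C l ` ends C e = {r}}"
      by (simp only: sum.distrib card_sum[OF finA])
    finally show ?thesis unfolding valence_def contract_simps A_def[symmetric] by simp
  qed
  ultimately show ?thesis using Zle by linarith
qed

lemma contract_elliptic:
  assumes C: "C \<in> elliptic_curves n" and l: "\<And>e. e \<in> bedges C \<Longrightarrow> 0 \<le> l e"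
    and e0: "nonbridge C e\<^sub>0" "l e\<^sub>0 \<noteq> 0"
  shows "contract C l \<in> elliptic_curves n"
  unfolding elliptic_curves_iff
proof (intro conjI ballI)
  note G = elliptic_fin[OF C]
  let ?D = "contract C l"
  have "e\<^sub>0 \<in> bedges C" using e0(1) by (simp add: nonbridge_def)
  then obtain v\<^sub>0 u where "v\<^sub>0 \<in> verts C" "u \<in> verts C" "ends C e\<^sub>0 = {v\<^sub>0, u}"
    by (rule fin_graph_endsE[OF G])
  then obtain W where R: "rooted_cut n C e\<^sub>0 v\<^sub>0 u W" using rooted_cut_exists[OF C e0(1)] by blast
  show "fin_graph ?D"
    unfolding fin_graph_def
  proof (intro conjI ballI)
    show "finite (verts ?D)" "finite (bedges ?D)" using G by (simp_all add: contract_simps fin_graph_def)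
    fix e assume "e \<in> bedges ?D"
    then have "e \<in> bedges C" by (simp add: contract_simps)
    then obtain u v where "u \<in> verts C" "v \<in> verts C" "ends C e = {u, v}" by (rule fin_graph_endsE[OF G])
    then show "\<exists>u\<in>verts ?D. \<exists>v\<in>verts ?D. ends ?D e = {u, v}" unfolding contract_simps by auto
  qed
  show "verts ?D \<noteq> {}" using C unfolding elliptic_curves_iff contract_simps by blast
  show "cut_conn ?D"
    unfolding cut_conn_def
  proof (intro allI impI ballI)
    fix \<phi> u v assume *: "crossing ?D \<phi> = {}" "u \<in> verts ?D" "v \<in> verts ?D"
    obtain x y where xy: "x \<in> verts C" "y \<in> verts C" "u = rep C l x" "v = rep C l y"
      using *(2,3) unfolding contract_simps by blast
    have "crossing C (\<lambda>x. \<phi> (rep C l x)) = {}" using *(1) crossing_contract[OF G] by simp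
    from cut_conn_const[OF elliptic_conn[OF C] this xy(1,2)] show "\<phi> u = \<phi> v" using xy by simp
  qed
  show "0 < len ?D e" if "e \<in> bedges ?D" for e
    using that l[of e] unfolding contract_simps by simp
  show "leaf ?D ` {1..n} \<subseteq> verts ?D" unfolding contract_simps using elliptic_leaf[OF C] by blast
  show "3 \<le> valence n ?D v" if "v \<in> verts ?D" for v
    by (rule rooted_cut.contract_valence[OF R]) (use that e0 contract_simps in auto)
  have "unicyclic_at ?D e\<^sub>0"
    unfolding unicyclic_at_def
  proof (intro conjI ballI)
    show "nonbridge ?D e\<^sub>0" using nonbridge_contract[OF G] e0 by blast
    fix f assume f: "f \<in> bedges ?D - {e\<^sub>0}"
    then have fE: "f \<in> bedges C" "f \<noteq> e\<^sub>0" "l f \<noteq> 0" by (simp_all add: contract_simps)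
    have c: "crossing C (W f) - {e\<^sub>0} = {f}"
      using rooted_cut.W[OF R fE(1,2)] by (simp add: crossing_delete_edge)
    have "l g \<noteq> 0" if "g \<in> crossing C (W f)" for g
    proof -
      have "g = e\<^sub>0 \<or> g = f" using that c by blast
      then show ?thesis using e0(2) fE(3) by auto
    qed
    then have "\<forall>g\<in>crossing C (W f). l g \<noteq> 0" by blast
    then have "crossing ?D (W f) = crossing C (W f)" by (rule crossing_contract_lift(1)[OF G])
    then have "crossing (delete_edge ?D e\<^sub>0) (W f) = {f}" using c by (simp add: crossing_delete_edge)
    then show "\<exists>\<phi>. crossing (delete_edge ?D e\<^sub>0) \<phi> = {f}" by blast
  qed
  then show "\<exists>e\<^sub>0. unicyclic_at ?D e\<^sub>0" by blast
qed

lemma total_len_nonzero: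
  assumes "0 < total_len n E l S"
  shows "\<exists>e\<in>E. n + 2 \<in> S e \<and> l e \<noteq> 0"
proof (rule ccontr)
  assume "\<not> ?thesis"
  then have "total_len n E l S = 0" unfolding total_len_def by (intro sum.neutral) auto
  then show False using assms by simp
qed

text \<open>All conditions on a curve survive the contraction, except that the cycle must not be
  contracted as a whole.\<close>

lemma comb_cone_iff:
  assumes C: "C \<in> elliptic_curves n" and S: "cut_system n C S"
  shows "l \<in> comb_cone n C \<longleftrightarrow> l \<in> bedges C \<rightarrow>\<^sub>E {0..} \<and> 0 < total_len n (bedges C) l S"
proof -
  have "contract C l \<in> elliptic_curves n \<longleftrightarrow> 0 < total_len n (bedges C) l S"
    if l: "l \<in> bedges C \<rightarrow>\<^sub>E {0..}"
  proof -
    have l0: "0 \<le> l e" if "e \<in> bedges C" for e using l that by auto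
    show ?thesis
    proof
      assume "contract C l \<in> elliptic_curves n"
      then obtain e where "nonbridge (contract C l) e" unfolding elliptic_curves_iff unicyclic_at_def by blast
      then have e: "nonbridge C e" "l e \<noteq> 0" using nonbridge_contract[OF elliptic_fin[OF C]] by blast+
      have eb: "e \<in> bedges C" using e(1) by (simp add: nonbridge_def)
      then have "n + 2 \<in> S e" using cut_systemD(3)[OF S] e(1) by blast
      then have "l e \<le> total_len n (bedges C) l S"
        by (intro cycle_edge_length_bound) (use eb l0 elliptic_finite[OF C] in auto)
      then show "0 < total_len n (bedges C) l S" using e(2) l0[OF eb] by linarith
    next
      assume "0 < total_len n (bedges C) l S"
      then obtain e where e: "e \<in> bedges C" "n + 2 \<in> S e" "l e \<noteq> 0"
        using total_len_nonzero by blast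
      then have "nonbridge C e" using cut_systemD(3)[OF S e(1)] by blast
      then show "contract C l \<in> elliptic_curves n"
        using contract_elliptic[where l = l and e\<^sub>0 = e, OF C] l0 e(3) by blast
    qed
  qed
  then show ?thesis unfolding comb_cone_def by blast
qed

lemma dist_class_chart:
  assumes C: "C \<in> elliptic_curves n" and S: "cut_system n C S" and l: "l \<in> comb_cone n C"
  shows "dist_class n (iso_rel n `` {contract C l}) = Psi n (Vclass n (split_vec n (bedges C) l S))"
proof -
  have D: "contract C l \<in> elliptic_curves n" using l by (simp add: comb_cone_def)
  have "0 < total_len n (bedges C) l S" using l comb_cone_iff[OF C S] by blast
  then have pos: "\<exists>e\<in>bedges C. n + 2 \<in> S e \<and> l e \<noteq> 0" by (rule total_len_nonzero)
  have "cut_system n (contract C l) S"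
    by (rule contract_cut_system[OF elliptic_fin[OF C] _ S pos]) (rule elliptic_leaf[OF C])
  then show ?thesis
    using dist_class_eq[OF D] contract_split_vec[OF elliptic_finite[OF C]] by (simp add: contract_simps(4))
qed

lemma rep_id:
  assumes "fin_graph C" "\<And>e. e \<in> bedges C \<Longrightarrow> l e \<noteq> 0" "v \<in> verts C"
  shows "rep C l v = v"
proof -
  have Z: "{e \<in> bedges C. l e = 0} = {}" using assms(2) by blast
  have "joined C {} = {}" by (simp add: joined_def)
  then show ?thesis using rep_reach(2)[OF assms(1,3), of l] unfolding Z by simp
qed

text \<open>A curve with the same family of sides lies in the interior of the combinatorial cone.\<close>

lemma same_sides_in_cone:
  assumes C: "C \<in> elliptic_curves n" and D: "D \<in> elliptic_curves n"
    and S: "cut_sides n C S" and S': "cut_sides n D S'" and eq: "S ` bedges C = S' ` bedges D"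
  obtains l g where "l \<in> comb_cone n C" "iso_rel n `` {contract C l} = iso_rel n `` {D}"
    "\<forall>e\<in>bedges C. g e \<in> bedges D \<and> S' (g e) = S e \<and> l e = len D (g e)"
proof -
  from same_sides_iso[OF S S' eq] obtain f g where
    f: "bij_betw f (verts C) (verts D)" and g: "bij_betw g (bedges C) (bedges D)"
    and e: "\<forall>e\<in>bedges C. ends D (g e) = f ` ends C e \<and> S' (g e) = S e"
    and lf: "\<forall>i\<in>{1..n}. leaf D i = f (leaf C i)" by (elim exE conjE)
  note G = elliptic_fin[OF C]
  have gD: "g e \<in> bedges D" if "e \<in> bedges C" for e using g that bij_betwE by blast
  define l where "l = (\<lambda>e\<in>bedges C. len D (g e))"
  have lpos: "0 < l e" if "e \<in> bedges C" for e using elliptic_len[OF D gD[OF that]] that by (simp add: l_def)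
  have tot: "0 < total_len n (bedges C) l S"
    by (rule cut_system_total_pos[OF cut_sides_system[OF S] elliptic_finite[OF C] lpos])
  have "l \<in> bedges C \<rightarrow>\<^sub>E {0..}" using lpos by (auto simp: l_def intro: less_imp_le)
  then have cone: "l \<in> comb_cone n C" using comb_cone_iff[OF C cut_sides_system[OF S]] tot by blast
  have id: "rep C l v = v" if "v \<in> verts C" for v
    by (rule rep_id[OF G _ that]) (use lpos in force)
  have "curve_iso n (contract C l) D"
    unfolding curve_iso_def
  proof (rule exI[of _ f], rule exI[of _ g], intro conjI ballI)
    have "verts (contract C l) = verts C" unfolding contract_simps using id by simp
    then show "bij_betw f (verts (contract C l)) (verts D)" using f by simp
    have "bedges (contract C l) = bedges C" unfolding contract_simps using lpos by force
    then show "bij_betw g (bedges (contract C l)) (bedges D)" using g by simp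
    fix x assume "x \<in> bedges (contract C l)"
    then have x: "x \<in> bedges C" by (simp add: contract_simps)
    have "rep C l ` ends C x = (\<lambda>v. v) ` ends C x"
      by (rule image_cong[OF refl]) (use id fin_graph_ends[OF G x] in blast)
    then show "ends D (g x) = f ` ends (contract C l) x" using e x by (simp add: contract_simps)
    show "len D (g x) = len (contract C l) x" using x by (simp add: contract_simps l_def)
  next
    fix i assume i: "i \<in> {1..n}"
    show "leaf D i = f (leaf (contract C l) i)" using lf i id[OF elliptic_leaf[OF C i]] by (simp add: contract_simps)
  qed
  then have "(contract C l, D) \<in> iso_rel n" using cone D by (simp add: iso_rel_def comb_cone_def)
  then have "iso_rel n `` {contract C l} = iso_rel n `` {D}" by (rule equiv_class_eq[OF equiv_iso_rel])
  then show ?thesis using that[OF cone, of g] gD e by (simp add: l_def)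
qed

section \<open>Topology\<close>

definition inv_space :: "nat \<Rightarrow> (nat \<times> nat \<Rightarrow> real) topology" where
  "inv_space n = powertop_real (index n)"

lemma topspace_final_topology:
  assumes "\<And>i x. i \<in> I \<Longrightarrow> x \<in> topspace (X i) \<Longrightarrow> f i x \<in> Y"
  shows "topspace (final_topology Y I X f) = Y"
proof -
  have "openin (final_topology Y I X f) Y"
    unfolding openin_final_topology
  proof (intro conjI ballI)
    fix i assume "i \<in> I"
    then have "{x \<in> topspace (X i). f i x \<in> Y} = topspace (X i)" using assms by blast
    then show "openin (X i) {x \<in> topspace (X i). f i x \<in> Y}" by simp
  qed simp
  moreover have "topspace (final_topology Y I X f) \<subseteq> Y"
    using openin_topspace[of "final_topology Y I X f"] unfolding openin_final_topology by blast
  ultimately show ?thesis using openin_subset by blast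
qed

lemma continuous_map_final_topology:
  assumes "\<And>i x. i \<in> I \<Longrightarrow> x \<in> topspace (X i) \<Longrightarrow> f i x \<in> Y"
    and "\<And>i. i \<in> I \<Longrightarrow> continuous_map (X i) Z (\<lambda>x. g (f i x))" and gY: "g ` Y \<subseteq> topspace Z"
  shows "continuous_map (final_topology Y I X f) Z g"
  unfolding continuous_map
proof (intro conjI allI impI)
  have top: "topspace (final_topology Y I X f) = Y" by (rule topspace_final_topology[OF assms(1)])
  show "g ` topspace (final_topology Y I X f) \<subseteq> topspace Z" using gY top by simp
  fix U assume U: "openin Z U"
  show "openin (final_topology Y I X f) {x \<in> topspace (final_topology Y I X f). g x \<in> U}"
    unfolding top openin_final_topology
  proof (intro conjI ballI)
    fix i assume i: "i \<in> I"
    have "{x \<in> topspace (X i). f i x \<in> {x \<in> Y. g x \<in> U}} = {x \<in> topspace (X i). g (f i x) \<in> U}"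
      using assms(1)[OF i] by blast
    then show "openin (X i) {x \<in> topspace (X i). f i x \<in> {x \<in> Y. g x \<in> U}}"
      using openin_continuous_map_preimage[OF assms(2)[OF i] U] by simp
  qed blast
qed

lemma closedin_final_topology_chart:
  assumes "\<And>i x. i \<in> I \<Longrightarrow> x \<in> topspace (X i) \<Longrightarrow> f i x \<in> Y"
    and F: "closedin (final_topology Y I X f) F" and i: "i \<in> I"
  shows "closedin (X i) {x \<in> topspace (X i). f i x \<in> F}"
proof -
  have "openin (final_topology Y I X f) (Y - F)" "F \<subseteq> Y"
    using F topspace_final_topology[of I X f Y, OF assms(1)] unfolding closedin_def by auto
  then have "openin (X i) {x \<in> topspace (X i). f i x \<in> Y - F}" using i unfolding openin_final_topology by blast
  moreover have "topspace (X i) - {x \<in> topspace (X i). f i x \<in> Y - F} = {x \<in> topspace (X i). f i x \<in> F}"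
    using assms(1)[OF i] \<open>F \<subseteq> Y\<close> by blast
  ultimately show ?thesis using closedin_diff[OF closedin_topspace] by fastforce
qed

lemma chart_in_M1: "l \<in> comb_cone n C \<Longrightarrow> iso_rel n `` {contract C l} \<in> M1 n"
  by (rule M1_class) (simp add: comb_cone_def)

lemma topspace_M1: "topspace (M1_topology n) = M1 n"
  unfolding M1_topology_def by (rule topspace_final_topology) (auto intro: chart_in_M1)

lemma cone_subset: "comb_cone n C \<subseteq> topspace (powertop_real (bedges C))"
  by (auto simp: comb_cone_def PiE_def)

lemma topspace_Vn: "topspace (Vn_topology n) = Vn n"
proof -
  have "Vclass n ` topspace (powertop_real (pairs n)) = topspace (Vn_topology n)"
    unfolding Vn_topology_def by (rule quotient_imp_surjective_map[OF quotient_map_quotient_topology])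
  then show ?thesis by (simp add: Vn_def Rpairs_def)
qed

lemma topspace_Xn: "topspace (subtopology (Vn_topology n) (Xn n)) = Xn n"
  by (auto simp: topspace_Vn Xn_def)

lemma quotient_Psi: "quotient_map (subtopology (Vn_topology n) (Xn n)) (XG_topology n) (Psi n)"
  unfolding XG_topology_def by (rule quotient_map_quotient_topology)

lemma topspace_XG: "topspace (XG_topology n) = Psi n ` Xn n"
  using quotient_imp_surjective_map[OF quotient_Psi] topspace_Xn by metis

lemma M1_dist_class:
  assumes "c \<in> M1 n"
  obtains C S where "C \<in> elliptic_curves n" "c = iso_rel n `` {C}" "cut_sides n C S"
    "dist_class n c = Psi n (Vclass n (split_vec n (bedges C) (len C) S))"
proof -
  obtain C where C: "C \<in> elliptic_curves n" "c = iso_rel n `` {C}" by (rule M1_rep[OF assms])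
  obtain S where S: "cut_sides n C S" by (rule cut_sides_exist[OF C(1)])
  show ?thesis using that[OF C S] dist_class_eq[OF C(1) cut_sides_system[OF S]] C(2) by simp
qed

lemma dist_class_surj: "dist_class n ` M1 n = Psi n ` Xn n"
proof
  show "dist_class n ` M1 n \<subseteq> Psi n ` Xn n"
  proof
    fix w assume "w \<in> dist_class n ` M1 n"
    then obtain c where c: "c \<in> M1 n" "w = dist_class n c" by blast
    obtain C S where "C \<in> elliptic_curves n" "c = iso_rel n `` {C}" "cut_sides n C S"
        "dist_class n c = Psi n (Vclass n (split_vec n (bedges C) (len C) S))"
      by (rule M1_dist_class[OF c(1)])
    then have "w = Psi n (Vclass n (split_vec n (bedges C) (len C) S))" using c(2) by simp
    moreover then have "Vclass n (split_vec n (bedges C) (len C) S) \<in> Xn n"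
      using \<open>w \<in> dist_class n ` M1 n\<close> Vclass_in[OF split_vec_in] by (simp add: Xn_def)
    ultimately show "w \<in> Psi n ` Xn n" by blast
  qed
  show "Psi n ` Xn n \<subseteq> dist_class n ` M1 n" by (auto simp: Xn_def)
qed

lemma dist_class_inj: "inj_on (dist_class n) (M1 n)"
proof (rule inj_onI)
  fix c c' assume c: "c \<in> M1 n" "c' \<in> M1 n" "dist_class n c = dist_class n c'"
  obtain C where C: "C \<in> elliptic_curves n" "c = iso_rel n `` {C}" by (rule M1_rep[OF c(1)])
  obtain C' where C': "C' \<in> elliptic_curves n" "c' = iso_rel n `` {C'}" by (rule M1_rep[OF c(2)])
  have "curve_iso n C C'" by (rule dist_class_injective[OF C(1) C'(1)]) (use c(3) C(2) C'(2) in simp)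
  then have "(C, C') \<in> iso_rel n" using C(1) C'(1) by (simp add: iso_rel_def)
  then show "c = c'" unfolding C(2) C'(2) by (rule equiv_class_eq[OF equiv_iso_rel])
qed

lemma continuous_coordinate: "k \<in> K \<Longrightarrow> continuous_map (powertop_real K) euclideanreal (\<lambda>x. x k)"
  by (rule continuous_map_product_projection)

lemma continuous_split_vec:
  assumes "finite E"
  shows "continuous_map (powertop_real E) (powertop_real (pairs n)) (\<lambda>l. split_vec n E l S)"
  unfolding split_vec_def continuous_map_componentwise
proof (intro conjI ballI)
  fix t assume t: "t \<in> pairs n"
  have "continuous_map (powertop_real E) euclideanreal (\<lambda>l. \<Sum>e\<in>E. l e * of_bool (card (S e \<inter> t) = 1))"
    by (intro continuous_map_sum continuous_map_real_mult continuous_coordinate) (use assms in simp_all)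
  then show "continuous_map (powertop_real E) euclideanreal
      (\<lambda>l. (\<lambda>t\<in>pairs n. \<Sum>e\<in>E. l e * of_bool (card (S e \<inter> t) = 1)) t)" using t by simp
qed auto

lemma continuous_cyc_len: "continuous_map (powertop_real (pairs n)) euclideanreal (cyc_len n)"
  unfolding cyc_len_def by (rule continuous_coordinate) (simp add: pair_in_pairs)

lemma continuous_cinv:
  assumes ij: "i \<in> {1..n}" "j \<in> {1..n}" "i \<noteq> j"
  shows "continuous_map (powertop_real (pairs n)) euclideanreal (\<lambda>x. cinv n x i j)"
proof -
  have p: "{i, j} \<in> pairs n" "{i, n+1} \<in> pairs n" "{i, n+2} \<in> pairs n" "{j, n+1} \<in> pairs n" "{j, n+2} \<in> pairs n"
    using ij by (auto simp: pair_in_pairs)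
  note c = p[THEN continuous_coordinate]
  have "continuous_map (powertop_real (pairs n)) euclideanreal (\<lambda>x. pos n x i)"
    "continuous_map (powertop_real (pairs n)) euclideanreal (\<lambda>x. pos n x j)"
    unfolding pos_def divide_inverse
    by (intro continuous_map_real_mult continuous_map_diff continuous_map_const[THEN iffD2] c; simp)+
  moreover have "continuous_map (powertop_real (pairs n)) euclideanreal (\<lambda>x. rdist n x i j)"
    unfolding rdist_def divide_inverse
    by (intro continuous_map_real_mult continuous_map_add continuous_map_diff
        continuous_map_const[THEN iffD2] c continuous_cyc_len; simp)
  ultimately show ?thesis
    unfolding cinv_def power2_eq_square
    by (intro continuous_map_diff continuous_map_real_mult continuous_cyc_len)
qed

lemma continuous_invs: "continuous_map (powertop_real (pairs n)) (inv_space n) (invs n)"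
  unfolding inv_space_def continuous_map_componentwise
proof (intro conjI ballI)
  show "invs n ` topspace (powertop_real (pairs n)) \<subseteq> extensional (index n)" by (auto simp: invs_def)
  fix k assume k: "k \<in> index n"
  show "continuous_map (powertop_real (pairs n)) euclideanreal (\<lambda>x. invs n x k)"
  proof (cases "k = (0, 0)")
    case True
    then show ?thesis using k continuous_cyc_len by (simp add: invs_def)
  next
    case False
    then obtain i j where "k = (i, j)" "i \<in> {1..n}" "j \<in> {1..n}" "i \<noteq> j" using k by (auto simp: index_def)
    then show ?thesis using k False continuous_cinv[of i n j] by (simp add: invs_def)
  qed
qed

definition class_invs :: "nat \<Rightarrow> vec set \<Rightarrow> nat \<times> nat \<Rightarrow> real" where
  "class_invs n K = invs n (SOME x. x \<in> K)"

lemma class_invs_Vclass: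
  assumes "x \<in> Rpairs n" shows "class_invs n (Vclass n x) = invs n x"
proof -
  have "(SOME y. y \<in> Vclass n x) \<in> Vclass n x" by (rule someI[of "\<lambda>y. y \<in> Vclass n x", OF Vclass_self[OF assms]])
  then show ?thesis unfolding class_invs_def by (rule invs_Vclass)
qed

lemma continuous_class_invs: "continuous_map (Vn_topology n) (inv_space n) (class_invs n)"
proof -
  have q: "quotient_map (powertop_real (pairs n)) (Vn_topology n) (Vclass n)"
    unfolding Vn_topology_def by (rule quotient_map_quotient_topology)
  have "continuous_map (powertop_real (pairs n)) (inv_space n) (class_invs n \<circ> Vclass n)"
    by (rule continuous_map_eq[OF continuous_invs]) (simp add: class_invs_Vclass Rpairs_def)
  then show ?thesis using continuous_compose_quotient_map_eq[OF q] by blast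
qed

definition curve_invs :: "nat \<Rightarrow> curve set \<Rightarrow> nat \<times> nat \<Rightarrow> real" where
  "curve_invs n c = class_invs n (SOME K. K \<in> Vn n \<and> Psi n K = dist_class n c)"

lemma class_invs_Psi:
  assumes "K \<in> Vn n" "K' \<in> Vn n" "Psi n K = Psi n K'"
  shows "class_invs n K = class_invs n K'"
proof -
  obtain x where x: "x \<in> Rpairs n" "K = Vclass n x" using assms(1) by (rule Vn_repr)
  obtain y where y: "y \<in> Rpairs n" "K' = Vclass n y" using assms(2) by (rule Vn_repr)
  show ?thesis
    using invs_if_Psi_eq[OF x(1) y(1)] assms(3) x y class_invs_Vclass by simp
qed

lemma curve_invs_eq:
  assumes "K \<in> Vn n" "Psi n K = dist_class n c"
  shows "curve_invs n c = class_invs n K"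
proof -
  let ?K = "SOME K. K \<in> Vn n \<and> Psi n K = dist_class n c"
  have "?K \<in> Vn n \<and> Psi n ?K = dist_class n c" by (rule someI[of _ K]) (use assms in simp)
  then show ?thesis unfolding curve_invs_def using class_invs_Psi[of ?K n K] assms by simp
qed

lemma curve_invs_split:
  assumes "dist_class n c = Psi n (Vclass n (split_vec n E l S))"
  shows "curve_invs n c = invs n (split_vec n E l S)"
  using curve_invs_eq[OF Vclass_in[OF split_vec_in]] assms class_invs_Vclass[OF split_vec_in] by metis

lemma dist_class_if_curve_invs_eq:
  assumes c: "c \<in> M1 n" "c' \<in> M1 n" "curve_invs n c = curve_invs n c'"
  shows "dist_class n c = dist_class n c'"
proof -
  obtain C S where C: "C \<in> elliptic_curves n" "c = iso_rel n `` {C}" "cut_sides n C S"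
    and d: "dist_class n c = Psi n (Vclass n (split_vec n (bedges C) (len C) S))"
    by (rule M1_dist_class[OF c(1)])
  obtain C' S' where C': "C' \<in> elliptic_curves n" "c' = iso_rel n `` {C'}" "cut_sides n C' S'"
    and d': "dist_class n c' = Psi n (Vclass n (split_vec n (bedges C') (len C') S'))"
    by (rule M1_dist_class[OF c(2)])
  note sys = cut_sides_system[OF C(3)] cut_sides_system[OF C'(3)]
  have inv: "invs n (split_vec n (bedges C) (len C) S) = invs n (split_vec n (bedges C') (len C') S')"
    using c(3) curve_invs_split[OF d] curve_invs_split[OF d'] by simp
  have pos: "0 < total_len n (bedges C') (len C') S'"
    by (rule cut_system_total_pos[OF sys(2) elliptic_finite[OF C'(1)] elliptic_len[OF C'(1)]])
  show ?thesis
    unfolding d d'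
    by (rule Psi_eq_if_invs_eq[OF cut_systemD(1)[OF sys(2)] cut_systemD(1)[OF sys(1)] _ _ pos inv])
      (use elliptic_len[OF C(1)] elliptic_len[OF C'(1)] in \<open>auto intro: less_imp_le\<close>)
qed

text \<open>In each chart the distances are linear functions of the edge lengths, for a fixed cut
  system.\<close>

lemma continuous_dist_class: "continuous_map (M1_topology n) (XG_topology n) (dist_class n)"
  unfolding M1_topology_def
proof (rule continuous_map_final_topology)
  show "dist_class n ` M1 n \<subseteq> topspace (XG_topology n)"
    unfolding dist_class_surj topspace_XG by (rule order_refl)
  show "iso_rel n `` {contract C l} \<in> M1 n"
    if "l \<in> topspace (subtopology (powertop_real (bedges C)) (comb_cone n C))" for C l
    using that chart_in_M1 by (simp add: topspace_subtopology)
  fix C assume C: "C \<in> elliptic_curves n"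
  obtain S where S: "cut_sides n C S" by (rule cut_sides_exist[OF C])
  let ?X = "subtopology (powertop_real (bedges C)) (comb_cone n C)"
  let ?\<phi> = "\<lambda>l. Vclass n (split_vec n (bedges C) l S)"
  have chart: "dist_class n (iso_rel n `` {contract C l}) = Psi n (?\<phi> l)" if "l \<in> comb_cone n C" for l
    by (rule dist_class_chart[OF C cut_sides_system[OF S] that])
  have "continuous_map (powertop_real (pairs n)) (Vn_topology n) (Vclass n)"
    unfolding Vn_topology_def by (rule quotient_imp_continuous_map[OF quotient_map_quotient_topology])
  then have "continuous_map (powertop_real (bedges C)) (Vn_topology n) (Vclass n \<circ> (\<lambda>l. split_vec n (bedges C) l S))"
    by (rule continuous_map_compose[OF continuous_split_vec[OF elliptic_finite[OF C]]])
  then have "continuous_map ?X (Vn_topology n) ?\<phi>"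
    unfolding comp_def by (rule continuous_map_from_subtopology)
  moreover have "?\<phi> l \<in> Xn n" if "l \<in> topspace ?X" for l
  proof -
    have l: "l \<in> comb_cone n C" using that by (simp add: topspace_subtopology)
    have "Psi n (?\<phi> l) \<in> dist_class n ` M1 n"
      unfolding chart[OF l, symmetric] by (rule imageI[OF chart_in_M1[OF l]])
    then show ?thesis using Vclass_in[OF split_vec_in] by (simp add: Xn_def)
  qed
  ultimately have "continuous_map ?X (subtopology (Vn_topology n) (Xn n)) ?\<phi>"
    by (simp add: continuous_map_in_subtopology image_subset_iff)
  then have "continuous_map ?X (XG_topology n) (Psi n \<circ> ?\<phi>)"
    by (rule continuous_map_compose[OF _ quotient_imp_continuous_map[OF quotient_Psi]])
  then show "continuous_map ?X (XG_topology n) (\<lambda>l. dist_class n (iso_rel n `` {contract C l}))"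
    by (rule continuous_map_eq) (use chart in \<open>simp add: topspace_subtopology\<close>)
qed

lemma compact_chart:
  assumes C: "C \<in> elliptic_curves n" and S: "cut_system n C S" and \<delta>: "0 < \<delta>"
    and F: "closedin (M1_topology n) F"
  shows "compactin (powertop_real (bedges C))
    {l \<in> bedges C \<rightarrow>\<^sub>E {0..R}. \<delta> \<le> total_len n (bedges C) l S \<and> iso_rel n `` {contract C l} \<in> F}"
proof -
  let ?P = "powertop_real (bedges C)" and ?B = "bedges C \<rightarrow>\<^sub>E {0..R}"
  let ?K = "{l \<in> ?B. \<delta> \<le> total_len n (bedges C) l S}"
  have compB: "compactin ?P ?B" unfolding compactin_PiE by simp
  have "continuous_map ?P euclideanreal (\<lambda>l. total_len n (bedges C) l S)"
    unfolding total_len_def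
    by (intro continuous_map_sum continuous_map_real_mult continuous_coordinate)
      (use elliptic_finite[OF C] in simp_all)
  from closedin_continuous_map_preimage[OF this, of "{\<delta>..}"]
  have "closedin ?P {l \<in> topspace ?P. total_len n (bedges C) l S \<in> {\<delta>..}}" by simp
  then have "compactin ?P ({l \<in> topspace ?P. total_len n (bedges C) l S \<in> {\<delta>..}} \<inter> ?B)"
    by (rule closed_Int_compactin[OF _ compB])
  moreover have "{l \<in> topspace ?P. total_len n (bedges C) l S \<in> {\<delta>..}} \<inter> ?B = ?K" by (auto simp: PiE_def)
  ultimately have compK: "compactin ?P ?K" by simp
  have KC: "?K \<subseteq> comb_cone n C"
  proof
    fix l assume l: "l \<in> ?K"
    then have "l \<in> bedges C \<rightarrow>\<^sub>E {0..}" by (auto simp: PiE_def)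
    then show "l \<in> comb_cone n C" unfolding comb_cone_iff[OF C S] using l \<delta> by auto
  qed
  have "closedin (subtopology ?P (comb_cone n C))
      {l \<in> topspace (subtopology ?P (comb_cone n C)). iso_rel n `` {contract C l} \<in> F}"
    by (rule closedin_final_topology_chart[of "elliptic_curves n" "\<lambda>C. subtopology (powertop_real (bedges C)) (comb_cone n C)"
          "\<lambda>C l. iso_rel n `` {contract C l}" "M1 n" F C])
      (use F C chart_in_M1 in \<open>auto simp: M1_topology_def topspace_subtopology\<close>)
  then obtain D where D: "closedin ?P D"
    "{l \<in> topspace (subtopology ?P (comb_cone n C)). iso_rel n `` {contract C l} \<in> F} = D \<inter> comb_cone n C"
    unfolding closedin_subtopology by blast
  have "{l \<in> ?B. \<delta> \<le> total_len n (bedges C) l S \<and> iso_rel n `` {contract C l} \<in> F} = D \<inter> ?K"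
  proof -
    have "l \<in> D \<longleftrightarrow> iso_rel n `` {contract C l} \<in> F" if "l \<in> ?K" for l
    proof -
      have "l \<in> comb_cone n C" using KC that by blast
      moreover have "l \<in> topspace (subtopology ?P (comb_cone n C))"
        using calculation cone_subset by (auto simp: topspace_subtopology)
      ultimately show ?thesis using D(2) by blast
    qed
    then show ?thesis by blast
  qed
  then show ?thesis using closed_Int_compactin[OF D(1) compK] by simp
qed

lemma Hausdorff_inv_space: "Hausdorff_space (inv_space n)"
  unfolding inv_space_def by (simp add: Hausdorff_space_product_topology)

text \<open>An edge of the cycle is bounded by the length of the cycle, and any other edge has
  two leaves beyond it, whose invariant bounds its length.\<close>

lemma length_bounds:
  assumes C: "C \<in> elliptic_curves n" and S: "cut_sides n C S"
    and \<delta>: "0 < \<delta>" "\<delta> \<le> cyc_len n (split_vec n (bedges C) (len C) S)"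
    and R: "cyc_len n (split_vec n (bedges C) (len C) S) \<le> R"
      "\<And>i j. i \<in> {1..n} \<Longrightarrow> j \<in> {1..n} \<Longrightarrow> i \<noteq> j \<Longrightarrow>
        \<bar>cinv n (split_vec n (bedges C) (len C) S) i j\<bar> \<le> 2 * \<delta> * R"
    and e: "e \<in> bedges C"
  shows "len C e \<le> R"
proof -
  have lam: "laminar n (bedges C) S" by (rule cut_systemD(1)[OF cut_sides_system[OF S]])
  have l0: "0 \<le> len C e" if "e \<in> bedges C" for e using elliptic_len[OF C that] by simp
  show ?thesis
  proof (cases "n + 2 \<in> S e")
    case True
    have "len C e \<le> total_len n (bedges C) (len C) S"
      by (rule cycle_edge_length_bound[of "bedges C" "len C"]) (use elliptic_finite[OF C] l0 e True in simp_all)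
    then show ?thesis using R(1) cyc_len_split[OF lam] by simp
  next
    case False
    then have "S e \<noteq> {n + 2}" by blast
    then obtain i j where ij: "i \<in> S e" "j \<in> S e" "i \<noteq> j" using cut_sides_nested(3)[OF S] e by blast
    have "S e \<subseteq> insert (n + 2) {1..n}" using lam e by (simp add: laminar_def)
    then have ijn: "i \<in> {1..n}" "j \<in> {1..n}" using ij False by blast+
    have "2 * total_len n (bedges C) (len C) S * len C e \<le> \<bar>cinv n (split_vec n (bedges C) (len C) S) i j\<bar>"
      by (rule edge_length_bound[OF lam elliptic_finite[OF C] _ e False ij(1,2) ijn ij(3)]) (rule l0)
    also have "\<dots> \<le> 2 * \<delta> * R" by (rule R(2)[OF ijn ij(3)])
    finally have "2 * total_len n (bedges C) (len C) S * len C e \<le> 2 * \<delta> * R" .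
    moreover have "2 * \<delta> * len C e \<le> 2 * total_len n (bedges C) (len C) S * len C e"
      using \<delta> cyc_len_split[OF lam, of "len C"] l0[OF e] by (intro mult_right_mono) auto
    ultimately have "2 * \<delta> * len C e \<le> 2 * \<delta> * R" by linarith
    then show ?thesis using \<delta>(1) by simp
  qed
qed

text \<open>Near a given point, the invariants of the curves in a closed set come from curves with bounded
  edge lengths and cycle length bounded below, of finitely many combinatorial types. For each type
  such curves form a compact set. Only points with \<open>y (0, 0) > 0\<close> are considered, since curves
  whose cycle shrinks to a point have no limit in \<open>M1 n\<close>.\<close>

lemma closed_curve_invs:
  assumes F: "closedin (M1_topology n) F" and y: "y \<in> topspace (inv_space n)" "0 < y (0, 0)"
    and yF: "y \<notin> curve_invs n ` F"
  shows "\<exists>U. openin (inv_space n) U \<and> y \<in> U \<and> U \<inter> curve_invs n ` F = {}"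
proof -
  define \<delta> where "\<delta> = y (0, 0) / 2"
  have \<delta>: "0 < \<delta>" "\<delta> < y (0, 0)" using y(2) by (simp_all add: \<delta>_def)
  have fin_index: "finite (index n)"
    by (rule finite_subset[of _ "insert (0, 0) ({1..n} \<times> {1..n})"]) (auto simp: index_def)
  define B where "B = (\<Sum>k\<in>index n. \<bar>y k\<bar>) + 1"
  have yB: "\<bar>y k\<bar> < B" if "k \<in> index n" for k
    using member_le_sum[OF that, of "\<lambda>k. \<bar>y k\<bar>"] fin_index by (simp add: B_def)
  define R where "R = max B (B / (2 * \<delta>))"
  define U where "U = {z \<in> topspace (inv_space n). z (0, 0) \<in> {\<delta><..} \<and> (\<forall>k\<in>index n. z k \<in> {-B<..<B})}"
  have k00: "(0, 0) \<in> index n" by (simp add: index_def)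
  have cont: "continuous_map (inv_space n) euclideanreal (\<lambda>z. z k)" if "k \<in> index n" for k
    unfolding inv_space_def by (rule continuous_coordinate[OF that])
  have openU: "openin (inv_space n) U"
  proof -
    have "openin (inv_space n) {z \<in> topspace (inv_space n). z (0, 0) \<in> {\<delta><..}}"
      by (rule openin_continuous_map_preimage[OF cont[OF k00]]) simp
    moreover have "openin (inv_space n) {z \<in> topspace (inv_space n). z k \<in> {-B<..<B}}" if "k \<in> index n" for k
      by (rule openin_continuous_map_preimage[OF cont[OF that]]) simp
    then have "openin (inv_space n) (\<Inter>k\<in>index n. {z \<in> topspace (inv_space n). z k \<in> {-B<..<B}})"
      using fin_index k00 by (intro openin_INT2) auto
    ultimately have "openin (inv_space n) ({z \<in> topspace (inv_space n). z (0, 0) \<in> {\<delta><..}} \<inter>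
        (\<Inter>k\<in>index n. {z \<in> topspace (inv_space n). z k \<in> {-B<..<B}}))" by (rule openin_Int)
    moreover have "{z \<in> topspace (inv_space n). z (0, 0) \<in> {\<delta><..}} \<inter>
        (\<Inter>k\<in>index n. {z \<in> topspace (inv_space n). z k \<in> {-B<..<B}}) = U"
      unfolding U_def using k00 by blast
    ultimately show ?thesis by simp
  qed
  have yU: "y \<in> U" unfolding U_def using y(1) \<delta>(2) yB by (auto simp: abs_less_iff minus_less_iff)
  \<comment> \<open>one representative curve for each family of sides\<close>
  define fams where "fams = {S ` bedges C | C S. C \<in> elliptic_curves n \<and> cut_sides n C S}"
  have "fams \<subseteq> Pow (Pow (insert (n + 2) {1..n}))"
  proof
    fix X assume "X \<in> fams"
    then obtain C S where "X = S ` bedges C" "cut_sides n C S" unfolding fams_def by blast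
    then show "X \<in> Pow (Pow (insert (n + 2) {1..n}))"
      using cut_sides_nested(1)[of n C S] unfolding nested_family_def by blast
  qed
  then have fin_fams: "finite fams" by (rule finite_subset) simp
  have "\<forall>X\<in>fams. \<exists>p. fst p \<in> elliptic_curves n \<and> cut_sides n (fst p) (snd p) \<and> X = snd p ` bedges (fst p)"
    unfolding fams_def by fastforce
  from bchoice[OF this] obtain p where
    p: "\<forall>X\<in>fams. fst (p X) \<in> elliptic_curves n \<and> cut_sides n (fst (p X)) (snd (p X)) \<and>
      X = snd (p X) ` bedges (fst (p X))" by (elim exE)
  define Q where "Q X = (\<lambda>l. invs n (split_vec n (bedges (fst (p X))) l (snd (p X)))) `
    {l \<in> bedges (fst (p X)) \<rightarrow>\<^sub>E {0..R}. \<delta> \<le> total_len n (bedges (fst (p X))) l (snd (p X)) \<and>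
      iso_rel n `` {contract (fst (p X)) l} \<in> F}" for X
  have compQ: "compactin (inv_space n) (Q X)" if X: "X \<in> fams" for X
  proof -
    have C: "fst (p X) \<in> elliptic_curves n" and S: "cut_sides n (fst (p X)) (snd (p X))" using p X by blast+
    have "continuous_map (powertop_real (bedges (fst (p X)))) (inv_space n)
        (invs n \<circ> (\<lambda>l. split_vec n (bedges (fst (p X))) l (snd (p X))))"
      by (rule continuous_map_compose[OF continuous_split_vec[OF elliptic_finite[OF C]] continuous_invs])
    from image_compactin[OF compact_chart[OF C cut_sides_system[OF S] \<delta>(1) F] this]
    show ?thesis unfolding Q_def comp_def .
  qed
  define Z where "Z = (\<Union>X\<in>fams. Q X)"
  have "compactin (inv_space n) Z"
    unfolding Z_def by (rule compactin_Union) (use fin_fams compQ in auto)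
  then have closedZ: "closedin (inv_space n) Z" by (rule compactin_imp_closedin[OF Hausdorff_inv_space])
  have chart_inv: "curve_invs n (iso_rel n `` {contract C l}) = invs n (split_vec n (bedges C) l S)"
    if "C \<in> elliptic_curves n" "cut_sides n C S" "l \<in> comb_cone n C" for C S l
    by (rule curve_invs_split, rule dist_class_chart[OF that(1) cut_sides_system[OF that(2)] that(3)])
  have "y \<notin> Z"
  proof
    assume "y \<in> Z"
    then obtain X where X: "X \<in> fams" "y \<in> Q X" unfolding Z_def by blast
    have C: "fst (p X) \<in> elliptic_curves n" and S: "cut_sides n (fst (p X)) (snd (p X))" using p X by blast+
    obtain l where l: "l \<in> bedges (fst (p X)) \<rightarrow>\<^sub>E {0..R}" "\<delta> \<le> total_len n (bedges (fst (p X))) l (snd (p X))"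
      "iso_rel n `` {contract (fst (p X)) l} \<in> F" "y = invs n (split_vec n (bedges (fst (p X))) l (snd (p X)))"
      using X(2) unfolding Q_def by blast
    have "l \<in> bedges (fst (p X)) \<rightarrow>\<^sub>E {0..}" using l(1) by (auto simp: PiE_def)
    then have "l \<in> comb_cone n (fst (p X))"
      unfolding comb_cone_iff[OF C cut_sides_system[OF S]] using l(2) \<delta>(1) by auto
    then have "y = curve_invs n (iso_rel n `` {contract (fst (p X)) l})" using chart_inv[OF C S] l(4) by simp
    then show False using yF l(3) by blast
  qed
  have UF: "z \<in> Z" if z: "z \<in> U" "z \<in> curve_invs n ` F" for z
  proof -
    obtain c where c: "c \<in> F" "z = curve_invs n c" using z(2) by blast
    have "c \<in> M1 n" using closedin_subset[OF F] c(1) topspace_M1 by blast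
    then obtain D S' where D: "D \<in> elliptic_curves n" "c = iso_rel n `` {D}" "cut_sides n D S'"
      and d: "dist_class n c = Psi n (Vclass n (split_vec n (bedges D) (len D) S'))" by (rule M1_dist_class)
    have zi: "z = invs n (split_vec n (bedges D) (len D) S')" using c(2) curve_invs_split[OF d] by simp
    have lamD: "laminar n (bedges D) S'" by (rule cut_systemD(1)[OF cut_sides_system[OF D(3)]])
    have zU: "\<delta> < z (0, 0)" "\<And>k. k \<in> index n \<Longrightarrow> \<bar>z k\<bar> < B" using z(1) by (auto simp: U_def abs_less_iff minus_less_iff)
    have z00: "z (0, 0) = cyc_len n (split_vec n (bedges D) (len D) S')" using k00 zi by (simp add: invs_def)
    have BR: "B \<le> R" "B \<le> 2 * \<delta> * R"
    proof -
      show "B \<le> R" by (simp add: R_def)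
      have "B / (2 * \<delta>) \<le> R" by (simp add: R_def)
      then show "B \<le> 2 * \<delta> * R" using \<delta>(1) by (simp add: pos_divide_le_eq mult.commute)
    qed
    have bound: "len D e \<le> R" if e: "e \<in> bedges D" for e
    proof (rule length_bounds[OF D(1,3) \<delta>(1) _ _ _ e])
      show "\<delta> \<le> cyc_len n (split_vec n (bedges D) (len D) S')" using zU(1) z00 by simp
      show "cyc_len n (split_vec n (bedges D) (len D) S') \<le> R" using zU(2)[OF k00] z00 BR(1) by simp
      fix i j assume ij: "i \<in> {1..n}" "j \<in> {1..n}" "i \<noteq> j"
      then have k: "(i, j) \<in> index n" "(i, j) \<noteq> (0, 0)" by (auto simp: index_def)
      have "z (i, j) = cinv n (split_vec n (bedges D) (len D) S') i j" using k ij(1) zi by (auto simp: invs_def)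
      then show "\<bar>cinv n (split_vec n (bedges D) (len D) S') i j\<bar> \<le> 2 * \<delta> * R"
        using zU(2)[OF k(1)] BR(2) by simp
    qed
    let ?X = "S' ` bedges D"
    have X: "?X \<in> fams" unfolding fams_def using D by blast
    let ?C = "fst (p ?X)" and ?S = "snd (p ?X)"
    have C: "?C \<in> elliptic_curves n" and S: "cut_sides n ?C ?S" and eq: "?S ` bedges ?C = S' ` bedges D"
      using bspec[OF p X] by simp_all
    obtain l g where l: "l \<in> comb_cone n ?C" "iso_rel n `` {contract ?C l} = iso_rel n `` {D}"
      and g: "\<forall>e\<in>bedges ?C. g e \<in> bedges D \<and> S' (g e) = ?S e \<and> l e = len D (g e)"
      by (rule same_sides_in_cone[OF C D(1) S D(3) eq])
    have zl: "z = invs n (split_vec n (bedges ?C) l ?S)"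
      using chart_inv[OF C S l(1)] l(2) c(2) D(2) by simp
    have "l \<in> bedges ?C \<rightarrow>\<^sub>E {0..R}"
    proof -
      have "l \<in> bedges ?C \<rightarrow>\<^sub>E {0..}" using l(1) by (simp add: comb_cone_def)
      moreover have "l e \<le> R" if "e \<in> bedges ?C" for e using g bound that by simp
      ultimately show ?thesis by (auto simp: PiE_def Pi_def)
    qed
    moreover have "\<delta> \<le> total_len n (bedges ?C) l ?S"
    proof -
      have "z (0, 0) = cyc_len n (split_vec n (bedges ?C) l ?S)" using k00 zl by (simp add: invs_def)
      then show ?thesis
        using zU(1) cyc_len_split[OF cut_systemD(1)[OF cut_sides_system[OF S]]] by simp
    qed
    moreover have "iso_rel n `` {contract ?C l} \<in> F" using l(2) c(1) D(2) by simp
    ultimately have "z \<in> Q ?X" unfolding Q_def using zl by blast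
    then show ?thesis unfolding Z_def using X by blast
  qed
  have "openin (inv_space n) (U - Z)" by (rule openin_diff[OF openU closedZ])
  moreover have "y \<in> U - Z" using yU \<open>y \<notin> Z\<close> by blast
  moreover have "(U - Z) \<inter> curve_invs n ` F = {}" using UF by blast
  ultimately show ?thesis by blast
qed

lemma Xn_class_invs:
  assumes "K \<in> Xn n"
  obtains c where "c \<in> M1 n" "Psi n K = dist_class n c" "curve_invs n c = class_invs n K" "K \<in> Vn n"
    "0 < class_invs n K (0, 0)"
proof -
  have K: "K \<in> Vn n" "Psi n K \<in> dist_class n ` M1 n" using assms by (simp_all add: Xn_def)
  then obtain c where c: "c \<in> M1 n" "Psi n K = dist_class n c" by blast
  obtain C S where C: "C \<in> elliptic_curves n" "c = iso_rel n `` {C}" "cut_sides n C S"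
    and d: "dist_class n c = Psi n (Vclass n (split_vec n (bedges C) (len C) S))" by (rule M1_dist_class[OF c(1)])
  have e: "curve_invs n c = class_invs n K" by (rule curve_invs_eq[OF K(1) c(2)])
  have "curve_invs n c (0, 0) = total_len n (bedges C) (len C) S"
    using curve_invs_split[OF d] cyc_len_split[OF cut_systemD(1)[OF cut_sides_system[OF C(3)]]]
    by (simp add: invs_def index_def)
  moreover have "0 < total_len n (bedges C) (len C) S"
    by (rule cut_system_total_pos[OF cut_sides_system[OF C(3)] elliptic_finite[OF C(1)] elliptic_len[OF C(1)]])
  ultimately show ?thesis using that[OF c e K(1)] e by simp
qed

text \<open>As the invariants separate the orbits of \<open>Xn\<close>, the preimage of the image
  of \<open>F\<close> in \<open>Xn\<close> is described by the invariants of the curves in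
  \<open>F\<close>, which form a closed set.\<close>

lemma closed_map_dist_class: "closed_map (M1_topology n) (XG_topology n) (dist_class n)"
  unfolding closed_map_def
proof (intro allI impI)
  fix F assume F: "closedin (M1_topology n) F"
  have FM: "F \<subseteq> M1 n" using closedin_subset[OF F] topspace_M1 by blast
  let ?X = "subtopology (Vn_topology n) (Xn n)"
  have contX: "continuous_map ?X (inv_space n) (class_invs n)"
    by (rule continuous_map_from_subtopology[OF continuous_class_invs])
  have iff: "Psi n K \<in> dist_class n ` F \<longleftrightarrow> class_invs n K \<in> curve_invs n ` F" if K: "K \<in> Xn n" for K
  proof -
    obtain c where c: "c \<in> M1 n" "Psi n K = dist_class n c" "curve_invs n c = class_invs n K"
        "K \<in> Vn n" "0 < class_invs n K (0, 0)"
      by (rule Xn_class_invs[OF K])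
    show ?thesis
    proof
      assume "Psi n K \<in> dist_class n ` F"
      then obtain c' where c': "c' \<in> F" "Psi n K = dist_class n c'" by blast
      have "c' \<in> M1 n" using c'(1) FM by blast
      then have "c = c'" by (intro inj_onD[OF dist_class_inj _ c(1)]) (use c(2) c'(2) in simp)
      then have "class_invs n K = curve_invs n c'" using c(3) by simp
      then show "class_invs n K \<in> curve_invs n ` F" using c'(1) by blast
    next
      assume "class_invs n K \<in> curve_invs n ` F"
      then obtain c' where c': "c' \<in> F" "class_invs n K = curve_invs n c'" by blast
      then have "dist_class n c = dist_class n c'"
        by (intro dist_class_if_curve_invs_eq[OF c(1)]) (use FM c(3) in auto)
      then show "Psi n K \<in> dist_class n ` F" using c(2) c'(1) by simp
    qed
  qed
  have "openin ?X {K \<in> topspace ?X. Psi n K \<notin> dist_class n ` F}"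
  proof (subst openin_subopen, intro ballI)
    fix K assume "K \<in> {K \<in> topspace ?X. Psi n K \<notin> dist_class n ` F}"
    then have K: "K \<in> Xn n" "K \<in> topspace ?X" "class_invs n K \<notin> curve_invs n ` F"
      using iff topspace_Xn by auto
    have y: "class_invs n K \<in> topspace (inv_space n)"
      using continuous_map_image_subset_topspace[OF contX] K(2) by blast
    have "0 < class_invs n K (0, 0)" by (rule Xn_class_invs[OF K(1)])
    then obtain U where U: "openin (inv_space n) U" "class_invs n K \<in> U" "U \<inter> curve_invs n ` F = {}"
      using closed_curve_invs[OF F y _ K(3)] by blast
    have "openin ?X {L \<in> topspace ?X. class_invs n L \<in> U}"
      by (rule openin_continuous_map_preimage[OF contX U(1)])
    moreover have "{L \<in> topspace ?X. class_invs n L \<in> U} \<subseteq> {K \<in> topspace ?X. Psi n K \<notin> dist_class n ` F}"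
      using U(3) iff topspace_Xn by blast
    ultimately show "\<exists>T. openin ?X T \<and> K \<in> T \<and> T \<subseteq> {K \<in> topspace ?X. Psi n K \<notin> dist_class n ` F}"
      using K(2) U(2) by blast
  qed
  moreover have "{K \<in> topspace ?X. Psi n K \<notin> dist_class n ` F} =
      topspace ?X - {K \<in> topspace ?X. Psi n K \<in> dist_class n ` F}" by blast
  ultimately have "closedin ?X {K \<in> topspace ?X. Psi n K \<in> dist_class n ` F}"
    unfolding closedin_def by auto
  moreover have "dist_class n ` F \<subseteq> topspace (XG_topology n)"
    unfolding topspace_XG dist_class_surj[symmetric] using FM by (rule image_mono)
  ultimately show "closedin (XG_topology n) (dist_class n ` F)"
    using conjunct2[OF quotient_Psi[unfolded quotient_map_closedin], rule_format, of "dist_class n ` F"] by simp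
qed

theorem proposition3p11:
  fixes n :: nat
  shows "homeomorphic_map (M1_topology n) (XG_topology n) (dist_class n)"
proof (rule bijective_closed_imp_homeomorphic_map)
  show "continuous_map (M1_topology n) (XG_topology n) (dist_class n)" by (rule continuous_dist_class)
  show "closed_map (M1_topology n) (XG_topology n) (dist_class n)" by (rule closed_map_dist_class)
  show "dist_class n ` topspace (M1_topology n) = topspace (XG_topology n)"
    using dist_class_surj topspace_M1 topspace_XG by simp
  show "inj_on (dist_class n) (topspace (M1_topology n))" using dist_class_inj topspace_M1 by simp
qed

end
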